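(* Let $G$ be a directed acyclic graph with $T$ topological orders. Assume that there is an algorithm that returns, in time $t_{\mathrm{sample}}$, a random topological order of $G$ whose distribution is $O(1)$-pointwise close to the uniform distribution on the topological orders of $G$. Then there is an algorithm that runs in time $O(t_{\mathrm{sample}}+\log T)$, performs $O(\log T)$ comparisons, and returns a constant-factor approximation of the value of $\log T$ with error probability $O(1/T^{0.9})$.
   Context: $\log$ is the base-two logarithm. A topological order of a directed acyclic graph is a total order of its vertices such that $v<w$ for every arc $vw$. For $c\ge 1$, a distribution $p$ is $c$-pointwise close to a distribution $q$ (on the same finite set) if $q_x/c\le p_x\le c\,q_x$ for every element $x$; "$O(1)$-pointwise close" means $c$-pointwise close for some constant $c$. A comparison is a binary comparison of two vertices with respect to the sampled topological order. The implied constants, including the approximation factor, may depend on $c$ but not on $G$. The error probability is the probability that the returned value is not within the constant factor of $\log T$. *)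

theory Defs
  imports "HOL-Probability.Probability" "Graph_Theory.Pair_Digraph"
begin

section \<open>Topological orders and samplers\<close>

definition dag :: "'a pair_pre_digraph \<Rightarrow> bool" where
  "dag G \<longleftrightarrow> pair_fin_digraph G \<and> acyclic (parcs G)"

text \<open>A topological order is represented by its strict order relation.\<close>

definition topological_orders :: "'a pair_pre_digraph \<Rightarrow> 'a rel set" where
  "topological_orders G =
     {r. r \<subseteq> pverts G \<times> pverts G \<and> strict_linear_order_on (pverts G) r \<and> parcs G \<subseteq> r}"

definition pointwise_close :: "real \<Rightarrow> 'x pmf \<Rightarrow> 'x pmf \<Rightarrow> bool" where
  "pointwise_close c p q \<longleftrightarrow> (\<forall>x. pmf q x / c \<le> pmf p x \<and> pmf p x \<le> c * pmf q x)"

text \<open>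
  A sampling algorithm for \<open>G\<close> is used as a black box: all that matters is its output distribution
  \<open>p\<close> and its running time \<open>t\<close>. As usual, running time includes reading the input (the arcs)
  and writing the output (an ordering of the vertices), whence the lower bounds on \<open>t\<close>.
\<close>

definition sampling_algorithm :: "real \<Rightarrow> 'a pair_pre_digraph \<Rightarrow> 'a rel pmf \<Rightarrow> nat \<Rightarrow> bool" where
  "sampling_algorithm c G p t \<longleftrightarrow>
     pointwise_close c p (pmf_of_set (topological_orders G)) \<and>
     1 \<le> t \<and> card (pverts G) \<le> t \<and> card (parcs G) \<le> t"


section \<open>Word-RAM programs with access to a sampler\<close>

text \<open>
  The model is a word RAM whose words are the numbers below \<open>W\<close>; arithmetic is modulo \<open>W\<close>
  (subtraction is truncated at 0, division by 0 gives 0). Its memory consists of registers and of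
  arrays; a program mentions only finitely many of them, so they could be interleaved
  in a single memory. All memory not holding the input is initially zero.

  The state also holds the most recently sampled topological order. A program can inspect
  this order only by binary comparisons of two vertices, and these are counted.
\<close>

datatype binop = Plus | Minus | Times | Divide | Modulo | Less | Equal

datatype expr =
    Const nat
  | Reg nat
  | Arr nat expr  \<comment> \<open>array, index\<close>
  | Bin binop expr expr

datatype com =
    Skip
  | Assign nat expr  \<comment> \<open>register, value\<close>
  | Store nat expr expr  \<comment> \<open>array, index, value\<close>
  | Sample
  | Compare nat expr expr  \<comment> \<open>register for the answer, the two vertices\<close>
  | Seq com com
  | Cond expr com com
  | Loop expr com

record state =
  regs :: "nat \<Rightarrow> nat"
  arrs :: "nat \<Rightarrow> nat \<Rightarrow> nat"
  sampled :: "nat rel"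
  time :: nat
  comparisons :: nat

fun binop_val :: "binop \<Rightarrow> nat \<Rightarrow> nat \<Rightarrow> nat" where
  "binop_val Plus x y = x + y"
| "binop_val Minus x y = x - y"
| "binop_val Times x y = x * y"
| "binop_val Divide x y = x div y"
| "binop_val Modulo x y = x mod y"
| "binop_val Less x y = of_bool (x < y)"
| "binop_val Equal x y = of_bool (x = y)"

primrec expr_val :: "nat \<Rightarrow> state \<Rightarrow> expr \<Rightarrow> nat" where
  "expr_val W s (Const k) = k mod W"
| "expr_val W s (Reg x) = regs s x"
| "expr_val W s (Arr a e) = arrs s a (expr_val W s e)"
| "expr_val W s (Bin f e1 e2) = binop_val f (expr_val W s e1) (expr_val W s e2) mod W"

definition tick :: "nat \<Rightarrow> state \<Rightarrow> state" where
  "tick d s = s\<lparr>time := time s + d\<rparr>"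

definition set_reg :: "nat \<Rightarrow> nat \<Rightarrow> state \<Rightarrow> state" where
  "set_reg x v s = s\<lparr>regs := (regs s)(x := v)\<rparr>"

definition set_arr :: "nat \<Rightarrow> nat \<Rightarrow> nat \<Rightarrow> state \<Rightarrow> state" where
  "set_arr a i v s = s\<lparr>arrs := (arrs s)(a := (arrs s a)(i := v))\<rparr>"

definition do_compare :: "nat \<Rightarrow> nat \<Rightarrow> nat \<Rightarrow> state \<Rightarrow> state" where
  "do_compare x u v s =
     set_reg x (of_bool ((u, v) \<in> sampled s)) (s\<lparr>comparisons := comparisons s + 1\<rparr>)"

text \<open>
  \<open>exec W p t c s D\<close>: started in state \<open>s\<close>, the program \<open>c\<close> terminates on every outcome of the
  random choices, and \<open>D\<close> is the distribution of its final state. The samples are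
  independent draws from \<open>p\<close>, each at cost \<open>t\<close>. Every other step costs 1; since the expressions of
  a program have bounded size, counting their operators would change times by a constant factor only.
  In the rules for composition and loops, \<open>E\<close> is relevant only on the support of \<open>D\<close>.
\<close>

inductive exec :: "nat \<Rightarrow> nat rel pmf \<Rightarrow> nat \<Rightarrow> com \<Rightarrow> state \<Rightarrow> state pmf \<Rightarrow> bool"
  for W :: nat and p :: "nat rel pmf" and t :: nat where
  Skip: "exec W p t Skip s (return_pmf (tick 1 s))"
| Assign: "exec W p t (Assign x e) s (return_pmf (tick 1 (set_reg x (expr_val W s e) s)))"
| Store: "exec W p t (Store a i e) s
      (return_pmf (tick 1 (set_arr a (expr_val W s i) (expr_val W s e) s)))"
| Sample: "exec W p t Sample s (map_pmf (\<lambda>r. tick t (s\<lparr>sampled := r\<rparr>)) p)"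
| Compare: "exec W p t (Compare x e1 e2) s
      (return_pmf (tick 1 (do_compare x (expr_val W s e1) (expr_val W s e2) s)))"
| Seq: "exec W p t (Seq c1 c2) s (bind_pmf D E)"
    if "exec W p t c1 s D" and "\<forall>s'\<in>set_pmf D. exec W p t c2 s' (E s')"
| CondTrue: "exec W p t (Cond b c1 c2) s D"
    if "expr_val W s b \<noteq> 0" and "exec W p t c1 (tick 1 s) D"
| CondFalse: "exec W p t (Cond b c1 c2) s D"
    if "expr_val W s b = 0" and "exec W p t c2 (tick 1 s) D"
| LoopTrue: "exec W p t (Loop b c) s (bind_pmf D E)"
    if "expr_val W s b \<noteq> 0" and "exec W p t c (tick 1 s) D"
      and "\<forall>s'\<in>set_pmf D. exec W p t (Loop b c) s' (E s')"
| LoopFalse: "exec W p t (Loop b c) s (return_pmf (tick 1 s))"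
    if "expr_val W s b = 0"

inductive_cases exec_SkipE: "exec W p t Skip s D"
inductive_cases exec_AssignE: "exec W p t (Assign x e) s D"
inductive_cases exec_StoreE: "exec W p t (Store a i e) s D"
inductive_cases exec_SampleE: "exec W p t Sample s D"
inductive_cases exec_CompareE: "exec W p t (Compare x e1 e2) s D"
inductive_cases exec_SeqE: "exec W p t (Seq c1 c2) s D"
inductive_cases exec_CondE: "exec W p t (Cond b c1 c2) s D"
inductive_cases exec_LoopE: "exec W p t (Loop b c) s D"

lemma exec_unique:
  assumes "exec W p t c s D" and "exec W p t c s D'"
  shows "D = D'"
  using assms
proof (induction arbitrary: D' rule: exec.induct)
  case (Seq c1 s D c2 E)
  from Seq.prems obtain D1 E1 where D': "D' = bind_pmf D1 E1" and D1: "exec W p t c1 s D1"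
    and E1: "\<forall>s'\<in>set_pmf D1. exec W p t c2 s' (E1 s')"
    by (rule exec_SeqE)
  have "D = D1" using Seq.IH(1) D1 .
  moreover have "E s' = E1 s'" if "s' \<in> set_pmf D" for s'
    using Seq.IH(2) E1 that \<open>D = D1\<close> by blast
  ultimately show ?case unfolding D' by (intro bind_pmf_cong) simp_all
next
  case (LoopTrue s b c D E)
  from LoopTrue.prems obtain D1 E1 where D': "D' = bind_pmf D1 E1"
    and D1: "exec W p t c (tick 1 s) D1"
    and E1: "\<forall>s'\<in>set_pmf D1. exec W p t (Loop b c) s' (E1 s')"
    by (rule exec_LoopE) (use LoopTrue.hyps(1) in simp_all)
  have "D = D1" using LoopTrue.IH(1) D1 .
  moreover have "E s' = E1 s'" if "s' \<in> set_pmf D" for s'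
    using LoopTrue.IH(2) E1 that \<open>D = D1\<close> by blast
  ultimately show ?case unfolding D' by (intro bind_pmf_cong) simp_all
next
  case (CondTrue s b c1 D c2)
  from CondTrue.prems show ?case
    by (rule exec_CondE) (use CondTrue.hyps(1) CondTrue.IH in simp_all)
next
  case (CondFalse s b c2 D c1)
  from CondFalse.prems show ?case
    by (rule exec_CondE) (use CondFalse.hyps(1) CondFalse.IH in simp_all)
next
  case (LoopFalse s b c)
  from LoopFalse.prems show ?case
    by (rule exec_LoopE) (simp_all add: LoopFalse.hyps)
next
  case (Skip s)
  then show ?case by (rule exec_SkipE) simp
next
  case (Assign x e s)
  then show ?case by (rule exec_AssignE) simp
next
  case (Store a i e s)
  then show ?case by (rule exec_StoreE) simp
next
  case (Sample s)
  then show ?case by (rule exec_SampleE) simp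
next
  case (Compare x e1 e2 s)
  then show ?case by (rule exec_CompareE) simp
qed

text \<open>
  Input of a graph with vertices \<open>0, \<dots>, n - 1\<close>: register 0 holds \<open>n\<close>, register 1 holds the number
  of arcs, and arrays 0 and 1 hold the tails and heads of the arcs, in the order of the list \<open>as\<close>.
  No order has been sampled yet, so that comparisons give 0. The output is left in register 0.
\<close>

definition arc_listing :: "nat pair_pre_digraph \<Rightarrow> (nat \<times> nat) list \<Rightarrow> bool" where
  "arc_listing G as \<longleftrightarrow> pverts G = {..<card (pverts G)} \<and> distinct as \<and> set as = parcs G"

definition init_state :: "nat pair_pre_digraph \<Rightarrow> (nat \<times> nat) list \<Rightarrow> state" where
  "init_state G as =
     \<lparr>regs = (\<lambda>_. 0)(0 := card (pverts G), 1 := length as),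
      arrs = (\<lambda>_ _. 0)(0 := (\<lambda>i. if i < length as then fst (as ! i) else 0),
                       1 := (\<lambda>i. if i < length as then snd (as ! i) else 0)),
      sampled = {}, time = 0, comparisons = 0\<rparr>"

definition returned :: "state \<Rightarrow> nat" where
  "returned s = regs s 0"

text \<open>Words of \<open>k log (n + m + 2)\<close> bits.\<close>

definition word_bound :: "nat \<Rightarrow> 'a pair_pre_digraph \<Rightarrow> nat" where
  "word_bound k G = (card (pverts G) + card (parcs G) + 2) ^ k"

end

(*
  With T topological orders, a deterministic procedure V on topological orders estimates log T.
  Kahn's algorithm with a first-in first-out queue splits the vertices into those that were alone in
  the queue when removed, which form a path in every topological order, and the rest, N. Two
  consecutive vertices in the queue are incomparable, so swapping disjoint pairs of neighbours gives
  2^|N| <= T^2.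

  Now run Kahn's algorithm so that the vertices are removed in the sampled order r, on a clock that
  advances with each removal and each release of a vertex of N. For v in N let s(v) be the time
  between the removal of its last predecessor and its own removal, and V(r) = sum (1 + bitlength s(v)).
  If each v in N is moved to an arbitrary one of the s(v) times of its stay, the result still respects
  all arcs, and at most 2^(3|N|+1) such choices give the same topological order. Hence
  prod s(v) <= T 2^(3|N|+1) and V(r) = O(log T) for every r. Conversely the numbers s(v) determine r,
  and at most 4^x tuples of positive integers have sum (1 + bitlength s(v)) <= x, so V is below
  (log T)/20 for at most T^0.1 orders.

  The simulation needs the minimum, with respect to r, of the released vertices. A heap in which
  removing v costs O(log k), for k the number of insertions since that of v, and galloping search in
  the path keep the number of comparisons in O(V(r)).
*)

theory Submission
  imports Defs
begin

section \<open>Counting topological orders\<close>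

text \<open>The obstacle is that \<open>log T\<close> may be far below \<open>n\<close>, so that not
  even one comparison per vertex is affordable, and that it may be of the order of |N| only, so that
  sorting \<open>N\<close> with |N| log |N| comparisons is too expensive as well. Hence every
  comparison is charged to a vertex v of \<open>N\<close>, which may be charged only O(1 + log
  s(v)). The clock is chosen for this charge. A removal from the heap costs the logarithm of a
  number of insertions, which are releases of vertices of \<open>N\<close>; the search in the path
  costs the logarithm of a number of path vertices that are removed while v waits. Both kinds of
  events are ticks, so both numbers are bounded by s(v). Releases of path vertices are no ticks:
  with them, the ticks other than removals of path vertices could far exceed 2|N|, and the exponent
  3|N| + 1 would be lost. The upper bound on V(r) holds for every order, so randomness matters only
  for values that are too small. Few orders have such a value, and each is sampled with probability
  at most c / T; therefore a single sample suffices.\<close>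

fun blen :: "nat \<Rightarrow> nat" where
  "blen x = (if x = 0 then 0 else Suc (blen (x div 2)))"

declare blen.simps [simp del]

lemma blen_0 [simp]: "blen 0 = 0"
  by (simp add: blen.simps)

lemma blen_pos: "0 < x \<Longrightarrow> blen x = Suc (blen (x div 2))"
  by (subst blen.simps) simp

lemma less_two_power_blen: "x < 2 ^ blen x"
proof (induction x rule: blen.induct)
  case (1 x)
  then show ?case by (cases "x = 0") (auto simp: blen_pos)
qed

lemma two_power_blen_le: "0 < x \<Longrightarrow> 2 ^ blen x \<le> 2 * x"
proof (induction x rule: blen.induct)
  case (1 x)
  show ?case
  proof (cases "x div 2 = 0")
    case True
    with 1 show ?thesis by (simp add: blen_pos)
  next
    case False
    then have "2 ^ blen (x div 2) \<le> 2 * (x div 2)" using 1 by simp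
    with 1(2) show ?thesis by (simp add: blen_pos)
  qed
qed

lemma less_blenI: "2 ^ j \<le> x \<Longrightarrow> j < blen x"
proof -
  assume "2 ^ j \<le> x"
  also note less_two_power_blen[of x]
  finally show ?thesis by simp
qed

lemma blen_le: "blen x \<le> x"
proof (induction x rule: blen.induct)
  case (1 x)
  then show ?case by (cases "x = 0") (auto simp: blen_pos)
qed

text \<open>Ranks identify the elements of a finite set of numbers. In \<open>prod_stay_le\<close>
  this recovers a sequence that increases along an order from the set of its values.\<close>

lemma card_below_inj:
  fixes Z :: "nat set"
  assumes "finite Z" "x \<in> Z" "y \<in> Z" "card {z\<in>Z. z < x} = card {z\<in>Z. z < y}"
  shows "x = y"
proof -
  have *: "card {z\<in>Z. z < x} < card {z\<in>Z. z < y}" if "x < y" "x \<in> Z" for x y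
    using that assms(1) by (intro psubset_card_mono) auto
  show ?thesis using *[of x y] *[of y x] assms by linarith
qed

section \<open>Topological orders of a graph on the vertices below \<open>n\<close>\<close>

locale dag_on =
  fixes n :: nat and E :: "nat rel"
  assumes arcs_sub: "E \<subseteq> {..<n} \<times> {..<n}" and acyclic_arcs: "acyclic E"
begin

definition TO :: "nat rel set" where
  "TO = {r. r \<subseteq> {..<n} \<times> {..<n} \<and> strict_linear_order_on {..<n} r \<and> E \<subseteq> r}"

definition pos :: "nat rel \<Rightarrow> nat \<Rightarrow> nat" where
  "pos r v = card {u. (u, v) \<in> r}"

lemma finite_TO: "finite TO"
  by (rule finite_subset[of _ "Pow ({..<n} \<times> {..<n})"]) (auto simp: TO_def)

lemma order_of_key:
  fixes f :: "nat \<Rightarrow> nat"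
  assumes "inj_on f {..<n}" and "\<And>u v. (u, v) \<in> E \<Longrightarrow> f u < f v"
  shows "{(u, v). u < n \<and> v < n \<and> f u < f v} \<in> TO"
proof -
  let ?r = "{(u, v). u < n \<and> v < n \<and> f u < f v}"
  have "trans ?r" by (auto simp: trans_def)
  moreover have "irrefl ?r" by (auto simp: irrefl_def)
  moreover have "total_on {..<n} ?r"
  proof (rule total_onI)
    fix x y assume "x \<in> {..<n}" "y \<in> {..<n}" "x \<noteq> y"
    moreover from this have "f x \<noteq> f y" using assms(1) by (auto simp: inj_on_def)
    ultimately show "(x, y) \<in> ?r \<or> (y, x) \<in> ?r" by auto
  qed
  moreover have "E \<subseteq> ?r" using assms(2) arcs_sub by auto
  moreover have "?r \<subseteq> {..<n} \<times> {..<n}" by auto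
  ultimately show ?thesis by (simp only: TO_def strict_linear_order_on_def mem_Collect_eq simp_thms)
qed

context
  fixes r assumes r: "r \<in> TO"
begin

lemma r_sub: "(u, v) \<in> r \<Longrightarrow> u < n \<and> v < n"
  using r by (auto simp: TO_def)

lemma r_trans: "(u, v) \<in> r \<Longrightarrow> (v, w) \<in> r \<Longrightarrow> (u, w) \<in> r"
  using r by (auto simp: TO_def strict_linear_order_on_def dest: transD)

lemma r_irrefl: "(u, u) \<notin> r"
  using r by (auto simp: TO_def strict_linear_order_on_def irrefl_def)

lemma r_total: "u < n \<Longrightarrow> v < n \<Longrightarrow> u \<noteq> v \<Longrightarrow> (u, v) \<in> r \<or> (v, u) \<in> r"
  using r by (auto simp: TO_def strict_linear_order_on_def total_on_def)

lemma r_arcs: "(u, v) \<in> E \<Longrightarrow> (u, v) \<in> r"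
  using r by (auto simp: TO_def)

lemma r_trancl: "(u, v) \<in> E\<^sup>+ \<Longrightarrow> (u, v) \<in> r"
proof (induction rule: trancl.induct)
  case (r_into_trancl a b) then show ?case by (rule r_arcs)
next
  case (trancl_into_trancl a b c) then show ?case using r_arcs r_trans by blast
qed

lemma finite_before: "finite {u. (u, v) \<in> r}"
  by (rule finite_subset[of _ "{..<n}"]) (auto dest: r_sub)

lemma pos_mono: "(u, v) \<in> r \<Longrightarrow> pos r u < pos r v"
proof -
  assume uv: "(u, v) \<in> r"
  have "{w. (w, u) \<in> r} \<subseteq> {w. (w, v) \<in> r}" using r_trans uv by blast
  moreover have "u \<in> {w. (w, v) \<in> r}" "u \<notin> {w. (w, u) \<in> r}" using uv r_irrefl by auto
  ultimately show ?thesis unfolding pos_def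
    by (intro psubset_card_mono[OF finite_before]) blast
qed

lemma pos_less_iff: "u < n \<Longrightarrow> v < n \<Longrightarrow> pos r u < pos r v \<longleftrightarrow> (u, v) \<in> r"
  using pos_mono[of u v] pos_mono[of v u] r_total[of u v] by (cases "u = v") auto

lemma pos_inj: "u < n \<Longrightarrow> v < n \<Longrightarrow> pos r u = pos r v \<Longrightarrow> u = v"
  using pos_mono[of u v] pos_mono[of v u] r_total[of u v] by auto

lemma pos_less: "v < n \<Longrightarrow> pos r v < n"
proof -
  assume "v < n"
  then have "{u. (u, v) \<in> r} \<subset> {..<n}" using r_irrefl by (auto dest: r_sub)
  then have "card {u. (u, v) \<in> r} < card {..<n}" by (intro psubset_card_mono) auto
  then show ?thesis by (simp add: pos_def)
qed

lemma pos_bij: "bij_betw (pos r) {..<n} {..<n}"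
proof -
  have i: "inj_on (pos r) {..<n}" by (auto simp: inj_on_def intro: pos_inj)
  then have "pos r ` {..<n} = {..<n}"
    using pos_less by (intro endo_inj_surj) auto
  with i show ?thesis by (simp add: bij_betw_def)
qed

lemma pos_ex: "i < n \<Longrightarrow> \<exists>v<n. pos r v = i"
proof -
  assume "i < n"
  then have "i \<in> pos r ` {..<n}" using pos_bij by (simp add: bij_betw_def)
  then show ?thesis by auto
qed

end

text \<open>The pairs of neighbours starting at \<open>J\<close> are disjoint, so every subset of
  them can be swapped at once. No vertex moves by more than one place, hence only arcs that span one
  or two places are in danger. The relative order of each pair reveals whether it was
  swapped.\<close>

lemma two_power_card_swaps_le:
  assumes len: "length \<sigma> = n" and dist: "distinct \<sigma>" and set: "set \<sigma> = {..<n}"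
    and topo: "\<And>i j. i < n \<Longrightarrow> j < n \<Longrightarrow> (\<sigma> ! i, \<sigma> ! j) \<in> E \<Longrightarrow> i < j"
    and J: "\<And>t. t \<in> J \<Longrightarrow> Suc t < n \<and> (\<sigma> ! t, \<sigma> ! Suc t) \<notin> E \<and> Suc t \<notin> J"
  shows "2 ^ card J \<le> card TO"
proof -
  define ix where "ix v = (THE t. t < n \<and> \<sigma> ! t = v)" for v
  have ix: "ix (\<sigma> ! t) = t" if "t < n" for t
    unfolding ix_def using that dist len by (intro the_equality) (auto simp: nth_eq_iff_index_eq)
  have ixn: "\<exists>t<n. v = \<sigma> ! t" if "v < n" for v
    using that set len by (metis in_set_conv_nth lessThan_iff)
  define g where "g A t = (if t \<in> A then Suc t else if 0 < t \<and> t - 1 \<in> A then t - 1 else t)" for A t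
  define ord where "ord A = {(u, v). u < n \<and> v < n \<and> g A (ix u) < g A (ix v)}" for A
  have nc: "Suc t \<notin> A" if "A \<subseteq> J" "t \<in> A" for A t using J that by blast
  have gg: "g A (g A t) = t" if "A \<subseteq> J" for A t
    using nc[OF that, of t] nc[OF that, of "t - 1"] by (auto simp: g_def)
  have ordTO: "ord A \<in> TO" if A: "A \<subseteq> J" for A
    unfolding ord_def
  proof (rule order_of_key)
    show "inj_on (\<lambda>u. g A (ix u)) {..<n}"
    proof (rule inj_onI)
      fix u v assume uv: "u \<in> {..<n}" "v \<in> {..<n}" "g A (ix u) = g A (ix v)"
      then have "ix u = ix v" using gg[OF A] by metis
      with uv ix ixn show "u = v" by (metis lessThan_iff)
    qed
    fix u v assume uv: "(u, v) \<in> E"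
    then obtain i j where ij: "u = \<sigma> ! i" "v = \<sigma> ! j" "i < n" "j < n" using ixn arcs_sub by blast
    then have "i < j" using topo uv by simp
    have "g A i < g A j"
    proof (cases "j = Suc i")
      case True
      then have "i \<notin> A" using J A uv ij by auto
      then show ?thesis using True by (auto simp: g_def)
    next
      \<comment> \<open>At distance two, both ends would have to move to the place between them;
        that takes two overlapping swaps, which \<open>J\<close> excludes.\<close>
      case False
      then show ?thesis using \<open>i < j\<close> nc[OF A, of i]
        by (cases "j = Suc (Suc i)") (auto simp: g_def)
    qed
    then show "g A (ix u) < g A (ix v)" using ij ix by simp
  qed
  have mem: "t \<in> A \<longleftrightarrow> (\<sigma> ! Suc t, \<sigma> ! t) \<in> ord A" if "A \<subseteq> J" "t \<in> J" for A t
  proof -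
    have t: "Suc t < n" "Suc t \<notin> A" using J that by auto
    have "\<sigma> ! t < n" "\<sigma> ! Suc t < n" using t set len by (metis Suc_lessD lessThan_iff nth_mem)+
    then have "(\<sigma> ! Suc t, \<sigma> ! t) \<in> ord A \<longleftrightarrow> g A (Suc t) < g A t" using ix t by (simp add: ord_def)
    also have "\<dots> \<longleftrightarrow> t \<in> A" using t by (auto simp: g_def)
    finally show ?thesis by simp
  qed
  have finJ: "finite J" by (rule finite_subset[of _ "{..<n}"]) (use J in force)+
  have "inj_on ord (Pow J)"
  proof (rule inj_onI)
    fix A B assume "A \<in> Pow J" "B \<in> Pow J" "ord A = ord B"
    then show "A = B" using mem by (metis Pow_iff subsetD subsetI subset_antisym)
  qed
  then have "card (Pow J) = card (ord ` Pow J)" by (simp add: card_image)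
  also have "\<dots> \<le> card TO" using finite_TO ordTO by (intro card_mono) auto
  finally show ?thesis using finJ by (simp add: card_Pow)
qed

text \<open>Positions of equal parity give disjoint pairs. Each of the two parity classes
  contributes a factor \<open>card TO\<close>, whence the square.\<close>

lemma two_power_card_le:
  assumes len: "length \<sigma> = n" and dist: "distinct \<sigma>" and set: "set \<sigma> = {..<n}"
    and topo: "\<And>i j. i < n \<Longrightarrow> j < n \<Longrightarrow> (\<sigma> ! i, \<sigma> ! j) \<in> E \<Longrightarrow> i < j"
    and I: "\<And>t. t \<in> I \<Longrightarrow> Suc t < n \<and> (\<sigma> ! t, \<sigma> ! Suc t) \<notin> E"
  shows "2 ^ card I \<le> card TO ^ 2"
proof -
  have fin: "finite I" by (rule finite_subset[of _ "{..<n}"]) (use I in force)+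
  have e: "2 ^ card {t\<in>I. even t} \<le> card TO"
    by (rule two_power_card_swaps_le[OF len dist set topo]) (use I in auto)
  have o: "2 ^ card {t\<in>I. odd t} \<le> card TO"
    by (rule two_power_card_swaps_le[OF len dist set topo]) (use I in auto)
  have "card I = card {t\<in>I. even t} + card {t\<in>I. odd t}"
    using fin by (subst card_Un_disjoint[symmetric]) (auto intro: arg_cong[where f = card])
  then have "2 ^ card I = (2::nat) ^ card {t\<in>I. even t} * 2 ^ card {t\<in>I. odd t}"
    by (simp add: power_add)
  also have "\<dots> \<le> card TO * card TO" using e o by (intro mult_mono) auto
  finally show ?thesis by (simp add: power2_eq_square)
qed

end

text \<open>
  Kahn's algorithm driven by the order \<open>r\<close> has a clock that advances at every removal of a vertex
  and at every release of a vertex of \<open>N\<close>. A vertex \<open>v\<close> is removed at time \<open>btime r v\<close>, and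
  \<open>atime r v\<close> is the time at which its last predecessor is removed.
\<close>

locale dag_split = dag_on +
  fixes N :: "nat set"
  assumes N_sub: "N \<subseteq> {..<n}"
begin

text \<open>The number of releases once \<open>i\<close> vertices have been removed; the sources in
  \<open>N\<close> count as released before the first removal.\<close>

definition rel :: "nat rel \<Rightarrow> nat \<Rightarrow> nat" where
  "rel r i = card {w\<in>N. \<forall>u. (u, w) \<in> E \<longrightarrow> pos r u < i}"

definition btime :: "nat rel \<Rightarrow> nat \<Rightarrow> nat" where
  "btime r v = Suc (pos r v) + rel r (pos r v)"

definition atime :: "nat rel \<Rightarrow> nat \<Rightarrow> nat" where
  "atime r v = Max (insert 0 (btime r ` {u. (u, v) \<in> E}))"

definition stay :: "nat rel \<Rightarrow> nat \<Rightarrow> nat" where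
  "stay r v = btime r v - atime r v"

definition val :: "nat rel \<Rightarrow> nat" where
  "val r = (\<Sum>v\<in>N. Suc (blen (stay r v)))"

lemma finite_N: "finite N"
  using N_sub finite_subset by blast

lemma finite_preds: "finite {u. (u, v) \<in> E}"
  by (rule finite_subset[of _ "{..<n}"]) (use arcs_sub in auto)

lemma rel_mono: "i \<le> j \<Longrightarrow> rel r i \<le> rel r j"
  unfolding rel_def using finite_N by (intro card_mono) (auto intro: less_le_trans)

lemma rel_le: "rel r i \<le> card N"
  unfolding rel_def using finite_N by (intro card_mono) auto

lemma btime_less: "pos r u < pos r v \<Longrightarrow> btime r u < btime r v"
  unfolding btime_def using rel_mono[of "pos r u" "pos r v" r] by linarith

lemma atime_ge: "(u, v) \<in> E \<Longrightarrow> btime r u \<le> atime r v"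
  unfolding atime_def using finite_preds by (intro Max_ge) auto

lemma atime_cases: "atime r v = 0 \<or> (\<exists>u. (u, v) \<in> E \<and> atime r v = btime r u)"
proof -
  have "atime r v \<in> insert 0 (btime r ` {u. (u, v) \<in> E})"
    unfolding atime_def using finite_preds by (intro Max_in) auto
  then show ?thesis by auto
qed

lemma btime_pos: "0 < btime r v"
  by (simp add: btime_def)

lemma atime_less: "r \<in> TO \<Longrightarrow> atime r v < btime r v"
  using atime_cases[of r v] btime_pos[of r v] btime_less[of r _ v] pos_mono[of r _ v] r_arcs[of r _ v]
  by auto

lemma stay_pos: "r \<in> TO \<Longrightarrow> 0 < stay r v"
  using atime_less by (simp add: stay_def)

lemma btime_inj: "r \<in> TO \<Longrightarrow> u < n \<Longrightarrow> v < n \<Longrightarrow> btime r u = btime r v \<Longrightarrow> u = v"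
  using btime_less[of r u v] btime_less[of r v u] pos_inj[of r u v]
  by (cases "pos r u" "pos r v" rule: linorder_cases) auto

lemma btime_le: "r \<in> TO \<Longrightarrow> v < n \<Longrightarrow> btime r v \<le> n + card N"
  unfolding btime_def using pos_less[of r v] rel_le[of r "pos r v"] by linarith

text \<open>A choice \<open>x\<close> of a time within each stay is encoded by a topological order
  together with a set of numbers up to \<open>3 * card N\<close>. The order alone forgets where
  exactly a vertex was placed between two removals of path vertices; the set restores this.\<close>

lemma prod_stay_le:
  assumes r: "r \<in> TO"
  shows "(\<Prod>v\<in>N. stay r v) \<le> card TO * 2 ^ (3 * card N + 1)"
proof -
  define X where "X = (PiE N (\<lambda>v. {atime r v<..btime r v}))"
  define full where "full x u = (if u \<in> N then x u else btime r u)" for x :: "nat \<Rightarrow> nat" and u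
  \<comment> \<open>At equal times a path vertex precedes the vertices of \<open>N\<close> placed
    there, and the latter are ordered by number. The factor \<open>Suc n\<close> exceeds every
    tie-breaking term.\<close>
  define key where "key x u = full x u * Suc n + (if u \<in> N then Suc u else 0)" for x u
  define ord where "ord x = {(u, v). u < n \<and> v < n \<and> key x u < key x v}" for x
  \<comment> \<open>The ticks other than removals of path vertices: \<open>n + card N\<close> ticks
    without \<open>n - card N\<close> removals leave \<open>2 * card N\<close>.\<close>
  define Ev where "Ev = {1..n + card N} - btime r ` ({..<n} - N)"
  define y where "y x v = card {e\<in>Ev. e \<le> x v}" for x :: "nat \<Rightarrow> nat" and v
  define rk where "rk x v = card {w\<in>N. (w, v) \<in> ord x}" for x v
  \<comment> \<open>As in stars and bars: \<open>y x\<close> is non-decreasing along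
    \<open>ord x\<close>, so adding the rank makes it strictly increasing, and the set of values
    then determines the sequence. The values are at most \<open>2 * card N + card N\<close>.\<close>
  define Z where "Z x = (\<lambda>v. y x v + rk x v) ` N" for x
  have finEv: "finite Ev" by (simp add: Ev_def)
  have cardEv: "card Ev = 2 * card N"
  proof -
    have "inj_on (btime r) ({..<n} - N)" using btime_inj[OF r] by (auto simp: inj_on_def)
    then have "card (btime r ` ({..<n} - N)) = n - card N"
      using N_sub finite_N by (simp add: card_image card_Diff_subset)
    moreover have "btime r ` ({..<n} - N) \<subseteq> {1..n + card N}"
      using btime_pos[of r] btime_le[OF r] by (auto simp: Suc_le_eq)
    moreover have "card N \<le> n" using card_mono[OF _ N_sub] by simp
    ultimately show ?thesis unfolding Ev_def by (subst card_Diff_subset) auto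
  qed
  have key_full: "full x u < full x v \<Longrightarrow> u < n \<Longrightarrow> key x u < key x v" for x u v
  proof -
    assume "full x u < full x v" "u < n"
    then have "Suc (full x u) * Suc n \<le> full x v * Suc n" by (intro mult_right_mono) auto
    then have "full x u * Suc n + Suc n \<le> full x v * Suc n" by simp
    moreover have "(if u \<in> N then Suc u else 0) < Suc n" using \<open>u < n\<close> by simp
    ultimately show ?thesis unfolding key_def by linarith
  qed
  have key_inj: "inj_on (key x) {..<n}" if "x \<in> X" for x
  proof (rule inj_onI)
    fix u v assume u: "u \<in> {..<n}" and v: "v \<in> {..<n}" and eq: "key x u = key x v"
    have f: "full x u = full x v" using key_full[of x u v] key_full[of x v u] u v eq
      by (cases "full x u" "full x v" rule: linorder_cases) auto
    then have "(if u \<in> N then Suc u else 0) = (if v \<in> N then Suc v else 0)"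
      using eq by (simp add: key_def)
    then show "u = v" using f btime_inj[OF r] u v by (auto simp: full_def split: if_splits)
  qed
  have full_le: "full x u \<le> btime r u" if "x \<in> X" for x u
    using that by (auto simp: full_def X_def PiE_iff)
  have full_gt: "atime r u < full x u" if "x \<in> X" for x u
    using that atime_less[OF r] by (auto simp: full_def X_def PiE_iff)
  have ordTO: "ord x \<in> TO" if "x \<in> X" for x
    unfolding ord_def
  proof (rule order_of_key)
    show "inj_on (key x) {..<n}" using key_inj that .
    fix u v assume uv: "(u, v) \<in> E"
    then have "full x u < full x v"
      using full_le[OF that, of u] full_gt[OF that, of v] atime_ge[OF uv, of r] by linarith
    then show "key x u < key x v" using key_full uv arcs_sub by auto
  qed
  have key_le_full: "key x u \<le> key x v \<Longrightarrow> v < n \<Longrightarrow> full x u \<le> full x v" for x u v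
    using key_full[of x v u] by (cases "full x v < full x u") auto
  have rk_mono: "rk x u < rk x v" if "x \<in> X" "u \<in> N" "v \<in> N" "(u, v) \<in> ord x" for x u v
    unfolding rk_def using that finite_N by (intro psubset_card_mono) (auto simp: ord_def)
  have y_mono: "y x u \<le> y x v" if "u \<in> N" "v \<in> N" "(u, v) \<in> ord x" for x u v
  proof -
    have "x u \<le> x v" using key_le_full[of x u v] that by (auto simp: ord_def full_def)
    then show ?thesis unfolding y_def using finEv by (intro card_mono) auto
  qed
  have ZPow: "Z x \<in> Pow {..<Suc (3 * card N)}" if "x \<in> X" for x
  proof -
    have "y x v + rk x v < Suc (3 * card N)" if "v \<in> N" for v
    proof -
      have "y x v \<le> 2 * card N" unfolding y_def cardEv[symmetric] using finEv by (intro card_mono) auto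
      moreover have "rk x v \<le> card N" unfolding rk_def using finite_N by (intro card_mono) auto
      ultimately show ?thesis by linarith
    qed
    then show ?thesis by (auto simp: Z_def)
  qed
  have below: "card {z\<in>Z x. z < y x v + rk x v} = rk x v" if "x \<in> X" "v \<in> N" for x v
  proof -
    have lt: "(y x u + rk x u < y x v + rk x v) = ((u, v) \<in> ord x)" if "u \<in> N" "v \<in> N" for u v
    proof (cases "u = v")
      case True then show ?thesis by (auto simp: ord_def)
    next
      case False
      have "(u, v) \<in> ord x \<or> (v, u) \<in> ord x"
        using r_total[OF ordTO[OF \<open>x \<in> X\<close>]] False that N_sub by blast
      then show ?thesis
        using rk_mono[OF \<open>x \<in> X\<close>, of u v] rk_mono[OF \<open>x \<in> X\<close>, of v u]
          y_mono[of u v x] y_mono[of v u x] that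
        by (auto simp: ord_def)
    qed
    have "{z\<in>Z x. z < y x v + rk x v} = (\<lambda>u. y x u + rk x u) ` {w\<in>N. (w, v) \<in> ord x}"
      using lt that by (auto simp: Z_def)
    moreover have "inj_on (\<lambda>u. y x u + rk x u) {w\<in>N. (w, v) \<in> ord x}"
    proof (rule inj_onI)
      fix a b assume ab: "a \<in> {w\<in>N. (w, v) \<in> ord x}" "b \<in> {w\<in>N. (w, v) \<in> ord x}"
        and eq: "y x a + rk x a = y x b + rk x b"
      show "a = b"
      proof (rule ccontr)
        assume "a \<noteq> b"
        then have "(a, b) \<in> ord x \<or> (b, a) \<in> ord x"
          using r_total[OF ordTO[OF \<open>x \<in> X\<close>], of a b] ab N_sub by blast
        then show False using lt[of a b] lt[of b a] eq ab by auto
      qed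
    qed
    ultimately show ?thesis by (simp add: card_image rk_def)
  qed
  have inj: "inj_on (\<lambda>x. (ord x, Z x)) X"
  proof (rule inj_onI)
    fix x x' assume x: "x \<in> X" and x': "x' \<in> X" and "(ord x, Z x) = (ord x', Z x')"
    then have o: "ord x = ord x'" and Z: "Z x = Z x'" by auto
    have rk: "rk x v = rk x' v" for v by (simp add: rk_def o)
    have finZ: "finite (Z x)" using finite_N by (simp add: Z_def)
    have y: "y x v = y x' v" if v: "v \<in> N" for v
    proof -
      have "y x v + rk x v = y x' v + rk x' v"
      proof (rule card_below_inj[OF finZ])
        show "y x v + rk x v \<in> Z x" using v by (auto simp: Z_def)
        show "y x' v + rk x' v \<in> Z x" using v unfolding Z by (auto simp: Z_def)
        show "card {z\<in>Z x. z < y x v + rk x v} = card {z\<in>Z x. z < y x' v + rk x' v}"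
          using below[OF x v] below[OF x' v] by (simp add: rk Z)
      qed
      then show ?thesis by (simp add: rk)
    qed
    \<comment> \<open>If \<open>x2 v\<close> is larger than \<open>x1 v\<close> although
      \<open>y\<close> agrees, then \<open>x2 v\<close> is no tick of \<open>Ev\<close>, hence it is
      the removal time of a path vertex \<open>u\<close>. By the tie rule \<open>u\<close> precedes
      \<open>v\<close> under \<open>x2\<close>, but it follows \<open>v\<close> under
      \<open>x1\<close>.\<close>
    have no: "\<not> x1 v < x2 v"
      if "x1 \<in> X" "x2 \<in> X" "ord x1 = ord x2" "y x1 v = y x2 v" "v \<in> N" for x1 x2 v
    proof
      assume less: "x1 v < x2 v"
      have v: "v < n" using that N_sub by auto
      have "x2 v \<notin> Ev"
      proof
        assume "x2 v \<in> Ev"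
        then have "y x1 v < y x2 v"
          unfolding y_def using less finEv by (intro psubset_card_mono psubsetI) force+
        with that show False by simp
      qed
      moreover have "x2 v \<in> {1..n + card N}"
        using that btime_le[OF r v] by (fastforce simp: X_def PiE_iff)
      ultimately obtain u where u: "u < n" "u \<notin> N" "x2 v = btime r u" by (auto simp: Ev_def)
      have "(u, v) \<in> ord x2" using u v that by (auto simp: ord_def key_def full_def)
      moreover have "(v, u) \<in> ord x1"
        using key_full[of x1 v u] u v less that by (auto simp: ord_def full_def)
      ultimately show False
        using that(3) r_trans[OF ordTO[OF that(2)], of u v u] r_irrefl[OF ordTO[OF that(2)], of u] by simp
    qed
    have "x v = x' v" if "v \<in> N" for v
      using no[OF x x' o y[OF that] that] no[OF x' x o[symmetric] y[OF that, symmetric] that] by simp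
    then show "x = x'" using x x' by (intro PiE_ext[of x N _ x']) (auto simp: X_def)
  qed
  have "(\<Prod>v\<in>N. stay r v) = card X"
    unfolding X_def stay_def using finite_N by (simp add: card_PiE)
  also have "\<dots> = card ((\<lambda>x. (ord x, Z x)) ` X)" using inj by (simp add: card_image)
  also have "\<dots> \<le> card (TO \<times> Pow {..<Suc (3 * card N)})"
    using finite_TO ordTO ZPow by (intro card_mono) auto
  also have "\<dots> = card TO * 2 ^ (3 * card N + 1)"
    by (simp add: card_cartesian_product card_Pow)
  finally show ?thesis .
qed

text \<open>The order is reconstructed position by position. The positions before \<open>i\<close>
  fix the clock at step \<open>i\<close> and the removal times of all predecessors of the next
  vertex. A vertex of \<open>N\<close> can be next only if its stay, added to the known
  \<open>atime\<close>, gives this clock value; among the remaining vertices the given order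
  decides.\<close>

lemma stay_determines_order:
  assumes r: "r \<in> TO" and r': "r' \<in> TO"
    and chain: "\<And>u v. u < n \<Longrightarrow> v < n \<Longrightarrow> u \<notin> N \<Longrightarrow> v \<notin> N \<Longrightarrow> (u, v) \<in> r \<longleftrightarrow> (u, v) \<in> r'"
    and stay: "\<And>v. v \<in> N \<Longrightarrow> stay r v = stay r' v"
  shows "r = r'"
proof -
  have main: "\<And>w. w < n \<Longrightarrow> pos r w = i \<Longrightarrow> pos r' w = i" if "i < n" for i
    using that
  proof (induction i rule: less_induct)
    case (less i w)
    have fw: "pos r' v = pos r v" if "v < n" "pos r v < i" for v
      using less.IH[OF that(2,1) refl pos_less[OF r that(1)]] .
    have bw: "pos r v = pos r' v" if v: "v < n" "pos r' v < i" for v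
    proof -
      obtain u where u: "u < n" "pos r u = pos r' v"
        using pos_ex[OF r, of "pos r' v"] v less.prems by auto
      then have "pos r' u = pos r' v" using fw[of u] v by simp
      then have "u = v" using pos_inj[OF r'] u v by blast
      with u show ?thesis by simp
    qed
    have set_eq: "pos r u < j \<longleftrightarrow> pos r' u < j" if "u < n" "j \<le> i" for u j
    proof
      assume "pos r u < j"
      then show "pos r' u < j" using fw[OF that(1)] that(2) by simp
    next
      assume "pos r' u < j"
      then show "pos r u < j" using bw[OF that(1)] that(2) by simp
    qed
    have rel_eq: "rel r j = rel r' j" if "j \<le> i" for j
    proof -
      have "(\<forall>u. (u, w) \<in> E \<longrightarrow> pos r u < j) \<longleftrightarrow> (\<forall>u. (u, w) \<in> E \<longrightarrow> pos r' u < j)" for w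
        using set_eq that arcs_sub by blast
      then show ?thesis by (simp add: rel_def)
    qed
    have b_eq: "btime r v = btime r' v" if "v < n" "pos r v < i" for v
      using fw[OF that] rel_eq[of "pos r v"] that by (simp add: btime_def)
    obtain w' where w': "w' < n" "pos r' w' = i" using pos_ex[OF r'] less.prems by auto
    have a_eq: "atime r v = atime r' v" if "v < n" "pos r v = i" for v
    proof -
      have "btime r u = btime r' u" if "(u, v) \<in> E" for u
        using b_eq[of u] pos_mono[OF r r_arcs[OF r that]] \<open>pos r v = i\<close> that arcs_sub by auto
      then have "btime r ` {u. (u, v) \<in> E} = btime r' ` {u. (u, v) \<in> E}" by (intro image_cong) auto
      then show ?thesis by (simp add: atime_def)
    qed
    have a_eq': "atime r v = atime r' v" if "v < n" "pos r' v = i" for v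
    proof -
      have "btime r u = btime r' u" if "(u, v) \<in> E" for u
      proof -
        have u: "u < n" using that arcs_sub by auto
        have "pos r' u < i" using pos_mono[OF r' r_arcs[OF r' that]] \<open>pos r' v = i\<close> by simp
        with bw[of u] u show ?thesis by (intro b_eq) auto
      qed
      then have "btime r ` {u. (u, v) \<in> E} = btime r' ` {u. (u, v) \<in> E}" by (intro image_cong) auto
      then show ?thesis by (simp add: atime_def)
    qed
    have bs: "btime r v = atime r v + stay r v" "btime r' v = atime r' v + stay r' v" for v
      using atime_less[OF r, of v] atime_less[OF r', of v] by (simp_all add: stay_def)
    \<comment> \<open>The clock at step \<open>i\<close> depends on earlier positions only, so
      \<open>w\<close> and \<open>w'\<close> leave at the same time, each in its own order.\<close>
    have bi: "btime r w = btime r' w'"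
      using less.prems w' rel_eq[of i] by (simp add: btime_def)
    have "w = w'"
    proof (cases "w \<in> N")
      case True
      then have "btime r w = btime r' w" using bs a_eq[of w] stay less.prems by simp
      then show ?thesis using bi btime_inj[OF r', of w w'] less.prems w' by simp
    next
      case wN: False
      show ?thesis
      proof (cases "w' \<in> N")
        case True
        then have "btime r w' = btime r' w'" using bs a_eq'[of w'] stay w' by simp
        then show ?thesis using bi btime_inj[OF r, of w w'] less.prems w' by simp
      next
        case w'N: False
        show ?thesis
        proof (rule ccontr)
          assume ne: "w \<noteq> w'"
          have "\<not> pos r w' < pos r w"
          proof
            assume "pos r w' < pos r w"
            then have "pos r' w' < i" using fw[of w'] less.prems w' by simp
            with w' show False by simp
          qed
          then have 1: "(w, w') \<in> r" using r_total[OF r, of w w'] ne less.prems w' pos_mono[OF r] by blast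
          have "\<not> pos r' w < pos r' w'"
          proof
            assume "pos r' w < pos r' w'"
            then have "pos r w < i" using bw[of w] less.prems w' by simp
            with less.prems show False by simp
          qed
          then have "(w', w) \<in> r'" using r_total[OF r', of w w'] ne less.prems w' pos_mono[OF r'] by blast
          moreover have "(w, w') \<in> r'" using 1 chain[of w w'] wN w'N less.prems w' by simp
          ultimately show False using r_trans[OF r'] r_irrefl[OF r'] by blast
        qed
      qed
    qed
    with w' show ?case by simp
  qed
  have "pos r v = pos r' v" if "v < n" for v
    using main[OF pos_less[OF r that], of v] that by simp
  then have "(u, v) \<in> r \<longleftrightarrow> (u, v) \<in> r'" for u v
    using pos_less_iff[OF r, of u v] pos_less_iff[OF r', of u v] r_sub[OF r, of u v] r_sub[OF r', of u v]
    by (cases "u < n \<and> v < n") auto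
  then show ?thesis by (auto simp: set_eq_iff)
qed

section \<open>Counting the orders with a small estimate\<close>

definition weight :: "nat \<Rightarrow> real" where
  "weight k = (1 / 4) ^ Suc (blen k)"

text \<open>A Kraft inequality, proved by comparison with the telescoping series of 1 / (k * (k +
  1)). Base 4 is what makes the sum converge: with base 2, each bit length would contribute the
  constant 1 / 4.\<close>

lemma sum_weight_le: "(\<Sum>k\<in>{1..L}. weight k) \<le> 1 - 1 / (real L + 1)"
proof (induction L)
  case (Suc L)
  have "real (Suc L) \<le> 2 ^ blen (Suc L)"
    using less_two_power_blen[of "Suc L"] by (metis less_imp_le of_nat_le_iff of_nat_numeral of_nat_power)
  then have "real (Suc L) ^ 2 \<le> (2 ^ blen (Suc L)) ^ 2" by (intro power_mono) auto
  moreover have "(2 ^ blen (Suc L)) ^ 2 = (4::real) ^ blen (Suc L)"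
    by (simp add: power_mult[symmetric] mult.commute[of _ 2]) (simp add: power_mult)
  ultimately have 1: "real (Suc L) ^ 2 \<le> 4 ^ blen (Suc L)" by (simp only:)
  have "weight (Suc L) = 1 / (4 * 4 ^ blen (Suc L))" by (simp only: weight_def power_divide power_one power_Suc)
  moreover have "1 / (4 * 4 ^ blen (Suc L)) \<le> 1 / (4 * real (Suc L) ^ 2)"
    using 1 by (intro divide_left_mono) auto
  moreover have "1 / (4 * real (Suc L) ^ 2) \<le> 1 / ((real L + 1) * (real L + 2))"
    by (intro divide_left_mono mult_pos_pos) (simp_all add: power2_eq_square algebra_simps add_pos_nonneg)
  moreover have "1 / ((real L + 1) * (real L + 2)) = 1 / (real L + 1) - 1 / (real (Suc L) + 1)"
    by (simp add: divide_simps)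
  ultimately have "weight (Suc L) \<le> 1 / (real L + 1) - 1 / (real (Suc L) + 1)" by linarith
  then show ?case using Suc.IH by simp
qed simp

text \<open>Expanding the product over \<open>N\<close> of the weight sums gives one term per tuple
  of stays. Different orders have different tuples, an order with \<open>val r \<le> x\<close>
  contributes at least \<open>(1 / 4) ^ x\<close>, and the whole product is at most 1.\<close>

lemma card_val_le:
  assumes chain: "\<And>r r' u v. r \<in> TO \<Longrightarrow> r' \<in> TO \<Longrightarrow> u < n \<Longrightarrow> v < n \<Longrightarrow> u \<notin> N \<Longrightarrow> v \<notin> N
    \<Longrightarrow> (u, v) \<in> r \<longleftrightarrow> (u, v) \<in> r'"
  shows "card {r\<in>TO. val r \<le> x} \<le> 4 ^ x"
proof -
  define F where "F r = restrict (stay r) N" for r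
  define L where "L = n + card N"
  define S where "S = {r\<in>TO. val r \<le> x}"
  have finS: "finite S" using finite_TO by (simp add: S_def)
  have inj: "inj_on F S"
  proof (rule inj_onI)
    fix r r' assume r: "r \<in> S" "r' \<in> S" and eq: "F r = F r'"
    show "r = r'"
    proof (rule stay_determines_order)
      fix v assume "v \<in> N"
      with eq show "stay r v = stay r' v" by (metis F_def restrict_apply')
    qed (use r chain in \<open>auto simp: S_def\<close>)
  qed
  have FX: "F ` S \<subseteq> PiE N (\<lambda>_. {1..L})"
  proof
    fix f assume "f \<in> F ` S"
    then obtain r where r: "r \<in> TO" "f = F r" by (auto simp: S_def)
    have "stay r v \<in> {1..L}" if "v \<in> N" for v
    proof -
      have "stay r v \<le> btime r v" by (simp add: stay_def)
      also have "\<dots> \<le> L" unfolding L_def using btime_le[OF r(1)] that N_sub by auto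
      finally show ?thesis using stay_pos[OF r(1), of v] by (simp add: Suc_le_eq)
    qed
    then show "f \<in> PiE N (\<lambda>_. {1..L})" using r by (auto simp: F_def)
  qed
  have weight_ge: "0 \<le> weight k" for k by (simp add: weight_def)
  have le: "(1 / 4) ^ x \<le> (\<Prod>v\<in>N. weight (f v))" if f: "f \<in> F ` S" for f
  proof -
    obtain r where r: "r \<in> S" "f = F r" using f by blast
    have "(\<Prod>v\<in>N. weight (f v)) = (\<Prod>v\<in>N. (1 / 4) ^ Suc (blen (stay r v)))"
      using r by (intro prod.cong) (auto simp: F_def weight_def)
    also have "\<dots> = (1 / 4) ^ val r" by (simp add: val_def power_sum)
    finally show ?thesis using r by (auto simp: S_def intro: power_decreasing)
  qed
  have "real (card S) * (1 / 4) ^ x = (\<Sum>f\<in>F ` S. (1 / 4) ^ x)"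
    using inj by (simp add: card_image)
  also have "\<dots> \<le> (\<Sum>f\<in>F ` S. \<Prod>v\<in>N. weight (f v))" using le by (rule sum_mono)
  also have "\<dots> \<le> (\<Sum>f\<in>PiE N (\<lambda>_. {1..L}). \<Prod>v\<in>N. weight (f v))"
    using FX finite_N weight_ge by (intro sum_mono2 finite_PiE prod_nonneg) auto
  also have "\<dots> = (\<Prod>v\<in>N. \<Sum>k\<in>{1..L}. weight k)"
    using finite_N by (subst prod_sum_PiE) auto
  also have "\<dots> \<le> (\<Prod>v\<in>N. 1)"
  proof (rule prod_mono)
    fix v assume "v \<in> N"
    have "(\<Sum>k\<in>{1..L}. weight k) \<le> 1" using sum_weight_le[of L] by (smt (verit) divide_nonneg_nonneg of_nat_0_le_iff)
    moreover have "0 \<le> (\<Sum>k\<in>{1..L}. weight k)" using weight_ge by (intro sum_nonneg) auto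
    ultimately show "0 \<le> (\<Sum>k\<in>{1..L}. weight k) \<and> (\<Sum>k\<in>{1..L}. weight k) \<le> 1" by simp
  qed
  finally have "real (card S) * (1 / 4) ^ x \<le> 1" by simp
  then have "real (card S) \<le> 4 ^ x" by (simp add: power_divide field_simps)
  then show ?thesis unfolding S_def by (metis of_nat_le_iff of_nat_numeral of_nat_power)
qed

text \<open>The exponent is 1 + 10 + 2. One factor \<open>card TO\<close> comes from
  \<open>prod_stay_le\<close>. The fifth power of \<open>2 ^ card N\<close>, two factors from
  passing to \<open>4 * stay r v\<close> and three from \<open>prod_stay_le\<close>, accounts for
  ten. The remaining factor 2 is at most \<open>2 ^ card N\<close>, hence at most the square of
  \<open>card TO\<close>, provided that \<open>N\<close> is non-empty; this is why the empty case is
  separate.\<close>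

lemma two_power_val_le:
  assumes r: "r \<in> TO" and K: "2 ^ card N \<le> card TO ^ 2"
  shows "2 ^ val r \<le> card TO ^ 13"
proof (cases "N = {}")
  case True
  have "card TO \<noteq> 0" using r finite_TO by auto
  moreover have "val r = 0" unfolding val_def using True by simp
  ultimately show ?thesis by simp
next
  case False
  define T where "T = card TO"
  define c where "c = card N"
  have cN: "1 \<le> c" using False finite_N by (simp add: Suc_le_eq card_gt_0_iff c_def)
  have K: "2 ^ c \<le> T ^ 2" using K by (simp add: T_def c_def)
  have "2 ^ val r = (\<Prod>v\<in>N. 2 ^ Suc (blen (stay r v)))" by (simp only: val_def power_sum)
  also have "\<dots> \<le> (\<Prod>v\<in>N. 4 * stay r v)"
  proof (rule prod_mono)
    fix v
    show "0 \<le> (2::nat) ^ Suc (blen (stay r v)) \<and> 2 ^ Suc (blen (stay r v)) \<le> 4 * stay r v"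
      using two_power_blen_le[OF stay_pos[OF r, of v]] by simp
  qed
  also have "\<dots> = 4 ^ c * (\<Prod>v\<in>N. stay r v)" by (simp only: prod.distrib prod_constant c_def)
  finally have "2 ^ val r \<le> 4 ^ c * (\<Prod>v\<in>N. stay r v)" .
  moreover have "4 ^ c * (\<Prod>v\<in>N. stay r v) \<le> 4 ^ c * (T * 2 ^ (3 * c + 1))"
    unfolding T_def c_def using prod_stay_le[OF r] by (rule mult_left_mono) simp
  moreover have "4 ^ c * (T * 2 ^ (3 * c + 1)) = T * (2 ^ c) ^ 5 * 2"
  proof -
    have "(4::nat) ^ c = 2 ^ (2 * c)" by (simp only: power_mult) simp
    moreover have "((2::nat) ^ c) ^ 5 = 2 ^ (c * 5)" by (simp only: power_mult)
    moreover have "(2::nat) ^ (2 * c) * 2 ^ (3 * c + 1) = 2 ^ (c * 5) * 2"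
      by (simp add: power_add[symmetric])
    ultimately show ?thesis by (simp only: mult.assoc mult.left_commute[of _ T])
  qed
  moreover have "T * (2 ^ c) ^ 5 * 2 \<le> T * (T ^ 2) ^ 5 * T ^ 2"
  proof -
    have "2 \<le> (2::nat) ^ c" using power_increasing[of 1 c "2::nat"] cN by simp
    then have "2 \<le> T ^ 2" using K by (rule order_trans)
    then show ?thesis using K by (intro mult_le_mono power_mono order_refl) simp_all
  qed
  moreover have "T ^ 13 = T * (T ^ 2) ^ 5 * T ^ 2"
  proof -
    have "T ^ 13 = T ^ (1 + 2 * 5 + 2)" by simp
    then show ?thesis by (simp only: power_add power_one_right power_mult)
  qed
  ultimately have "2 ^ val r \<le> T ^ 13" by linarith
  then show ?thesis by (simp only: T_def)
qed

end

section \<open>Weakest preconditions for deterministic programs\<close>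

text \<open>One final state must serve every sampler and every sampling cost. So the notion
  describes total correctness of the deterministic code before and after the single call of the
  sampler.\<close>

definition wp :: "nat \<Rightarrow> com \<Rightarrow> (state \<Rightarrow> bool) \<Rightarrow> state \<Rightarrow> bool" where
  "wp W c Q s \<longleftrightarrow> (\<exists>s'. (\<forall>p t. exec W p t c s (return_pmf s')) \<and> Q s')"

section \<open>Frame conditions and proof rules\<close>

primrec wregs :: "com \<Rightarrow> nat set" where
  "wregs Skip = {}"
| "wregs (Assign x e) = {x}"
| "wregs (Store a i e) = {}"
| "wregs Sample = {}"
| "wregs (Compare x e1 e2) = {x}"
| "wregs (Seq c1 c2) = wregs c1 \<union> wregs c2"
| "wregs (Cond b c1 c2) = wregs c1 \<union> wregs c2"
| "wregs (Loop b c) = wregs c"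

primrec warrs :: "com \<Rightarrow> nat set" where
  "warrs Skip = {}"
| "warrs (Assign x e) = {}"
| "warrs (Store a i e) = {a}"
| "warrs Sample = {}"
| "warrs (Compare x e1 e2) = {}"
| "warrs (Seq c1 c2) = warrs c1 \<union> warrs c2"
| "warrs (Cond b c1 c2) = warrs c1 \<union> warrs c2"
| "warrs (Loop b c) = warrs c"

primrec sample_free :: "com \<Rightarrow> bool" where
  "sample_free Skip = True"
| "sample_free (Assign x e) = True"
| "sample_free (Store a i e) = True"
| "sample_free Sample = False"
| "sample_free (Compare x e1 e2) = True"
| "sample_free (Seq c1 c2) = (sample_free c1 \<and> sample_free c2)"
| "sample_free (Cond b c1 c2) = (sample_free c1 \<and> sample_free c2)"
| "sample_free (Loop b c) = sample_free c"

text \<open>Branching code whose final state is computed by \<open>run\<close>;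
  \<open>Sample\<close> is excluded along with loops because its outcome is random.\<close>

primrec loop_free :: "com \<Rightarrow> bool" where
  "loop_free Skip = True"
| "loop_free (Assign x e) = True"
| "loop_free (Store a i e) = True"
| "loop_free Sample = False"
| "loop_free (Compare x e1 e2) = True"
| "loop_free (Seq c1 c2) = (loop_free c1 \<and> loop_free c2)"
| "loop_free (Cond b c1 c2) = (loop_free c1 \<and> loop_free c2)"
| "loop_free (Loop b c) = False"

text \<open>The value at \<open>Sample\<close> and \<open>Loop\<close> is irrelevant.\<close>

primrec run :: "nat \<Rightarrow> com \<Rightarrow> state \<Rightarrow> state" where
  "run W Skip s = tick 1 s"
| "run W (Assign x e) s = tick 1 (set_reg x (expr_val W s e) s)"
| "run W (Store a i e) s = tick 1 (set_arr a (expr_val W s i) (expr_val W s e) s)"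
| "run W Sample s = s"
| "run W (Compare x e1 e2) s = tick 1 (do_compare x (expr_val W s e1) (expr_val W s e2) s)"
| "run W (Seq c1 c2) s = run W c2 (run W c1 s)"
| "run W (Cond b c1 c2) s =
    (if expr_val W s b \<noteq> 0 then run W c1 (tick 1 s) else run W c2 (tick 1 s))"
| "run W (Loop b c) s = s"

lemma state_simps [simp]:
  "regs (tick d s) = regs s" "arrs (tick d s) = arrs s" "sampled (tick d s) = sampled s"
  "time (tick d s) = time s + d" "comparisons (tick d s) = comparisons s"
  "regs (set_reg x v s) = (regs s)(x := v)" "arrs (set_reg x v s) = arrs s"
  "sampled (set_reg x v s) = sampled s" "time (set_reg x v s) = time s"
  "comparisons (set_reg x v s) = comparisons s"
  "regs (set_arr a i v s) = regs s" "arrs (set_arr a i v s) = (arrs s)(a := (arrs s a)(i := v))"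
  "sampled (set_arr a i v s) = sampled s" "time (set_arr a i v s) = time s"
  "comparisons (set_arr a i v s) = comparisons s"
  "regs (do_compare x u w s) = (regs s)(x := of_bool ((u, w) \<in> sampled s))"
  "arrs (do_compare x u w s) = arrs s"
  "sampled (do_compare x u w s) = sampled s" "time (do_compare x u w s) = time s"
  "comparisons (do_compare x u w s) = Suc (comparisons s)"
  by (simp_all add: tick_def set_reg_def set_arr_def do_compare_def)

lemma exec_run:
  "loop_free c \<Longrightarrow> exec W p t c s (return_pmf (run W c s))"
proof (induction c arbitrary: s)
  case (Seq c1 c2)
  have "exec W p t (Seq c1 c2) s (bind_pmf (return_pmf (run W c1 s)) (\<lambda>s. return_pmf (run W c2 s)))"
    using Seq by (intro exec.Seq) auto
  then show ?case by (simp add: bind_return_pmf)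
next
  case (Cond b c1 c2)
  then show ?case by (auto intro: exec.CondTrue exec.CondFalse simp del: One_nat_def)
qed (auto intro: exec.intros simp del: One_nat_def)

lemma wp_run: "loop_free c \<Longrightarrow> Q (run W c s) \<Longrightarrow> wp W c Q s"
  unfolding wp_def using exec_run by blast

lemma wp_conseq: "wp W c Q s \<Longrightarrow> (\<And>s'. Q s' \<Longrightarrow> Q' s') \<Longrightarrow> wp W c Q' s"
  unfolding wp_def by blast

lemma wp_Seq:
  assumes "wp W c1 (wp W c2 Q) s"
  shows "wp W (Seq c1 c2) Q s"
proof -
  obtain s1 s2 where *: "\<And>p t. exec W p t c1 s (return_pmf s1)"
    "\<And>p t. exec W p t c2 s1 (return_pmf s2)" "Q s2"
    using assms unfolding wp_def by blast
  have "exec W p t (Seq c1 c2) s (bind_pmf (return_pmf s1) (\<lambda>_. return_pmf s2))" for p t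
    using * by (intro exec.Seq) auto
  then show ?thesis using *(3) unfolding wp_def by (auto simp: bind_return_pmf)
qed

lemma wp_Cond:
  assumes "expr_val W s b \<noteq> 0 \<Longrightarrow> wp W c1 Q (tick 1 s)"
    and "expr_val W s b = 0 \<Longrightarrow> wp W c2 Q (tick 1 s)"
  shows "wp W (Cond b c1 c2) Q s"
  using assms unfolding wp_def
  by (cases "expr_val W s b = 0") (blast intro: exec.CondTrue exec.CondFalse)+

lemma wp_Loop:
  fixes m :: "state \<Rightarrow> nat"
  assumes "I s"
    and step: "\<And>s. I s \<Longrightarrow> expr_val W s b \<noteq> 0 \<Longrightarrow> wp W c (\<lambda>s'. I s' \<and> m s' < m s) (tick 1 s)"
    and exit: "\<And>s. I s \<Longrightarrow> expr_val W s b = 0 \<Longrightarrow> Q (tick 1 s)"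
  shows "wp W (Loop b c) Q s"
  using \<open>I s\<close>
proof (induction "m s" arbitrary: s rule: less_induct)
  case less
  show ?case
  proof (cases "expr_val W s b = 0")
    case True
    then show ?thesis using exit[OF less.prems] unfolding wp_def by (blast intro: exec.LoopFalse)
  next
    case False
    then obtain s1 where s1: "\<And>p t. exec W p t c (tick 1 s) (return_pmf s1)" "I s1" "m s1 < m s"
      using step[OF less.prems] unfolding wp_def by blast
    then obtain s2 where s2: "\<And>p t. exec W p t (Loop b c) s1 (return_pmf s2)" "Q s2"
      using less.hyps unfolding wp_def by blast
    have "exec W p t (Loop b c) s (bind_pmf (return_pmf s1) (\<lambda>_. return_pmf s2))" for p t
      using s1 s2 False by (intro exec.LoopTrue) auto
    then show ?thesis using s2(2) unfolding wp_def by (auto simp: bind_return_pmf)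
  qed
qed

text \<open>A comparison takes one step, so comparisons never grow faster than time. Through the
  last conjunct a time bound for code that is charged to \<open>N\<close> also bounds its
  comparisons.\<close>

lemma exec_frame:
  assumes "exec W p t c s D" and "s' \<in> set_pmf D"
  shows "(\<forall>x. x \<notin> wregs c \<longrightarrow> regs s' x = regs s x) \<and> (\<forall>a. a \<notin> warrs c \<longrightarrow> arrs s' a = arrs s a)
    \<and> (sample_free c \<longrightarrow> sampled s' = sampled s)
    \<and> time s \<le> time s' \<and> comparisons s \<le> comparisons s' \<and> comparisons s' + time s \<le> comparisons s + time s'"
  using assms
proof (induction arbitrary: s' rule: exec.induct)
  case (Seq c1 s D c2 E)
  from Seq.prems obtain s1 where s1: "s1 \<in> set_pmf D" "s' \<in> set_pmf (E s1)" by auto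
  from Seq.IH(1)[OF s1(1)] Seq.IH(2) s1 show ?case by fastforce
next
  case (LoopTrue s b c D E)
  from LoopTrue.prems obtain s1 where s1: "s1 \<in> set_pmf D" "s' \<in> set_pmf (E s1)" by auto
  from LoopTrue.IH(1)[OF s1(1)] LoopTrue.IH(2) s1 show ?case by fastforce
next
  case (CondTrue s b c1 D c2)
  from CondTrue.IH[OF CondTrue.prems] show ?case by auto
next
  case (CondFalse s b c2 D c1)
  from CondFalse.IH[OF CondFalse.prems] show ?case by auto
qed auto

lemma wp_frame:
  assumes "wp W c Q s" and "sample_free c"
    and "\<And>s'. Q s' \<Longrightarrow> (\<And>x. x \<notin> wregs c \<Longrightarrow> regs s' x = regs s x) \<Longrightarrow>
      (\<And>a. a \<notin> warrs c \<Longrightarrow> arrs s' a = arrs s a) \<Longrightarrow> sampled s' = sampled s \<Longrightarrow>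
      comparisons s' + time s \<le> comparisons s + time s' \<Longrightarrow> Q' s'"
  shows "wp W c Q' s"
proof -
  obtain s' where s': "\<And>p t. exec W p t c s (return_pmf s')" "Q s'"
    using assms(1) unfolding wp_def by blast
  show ?thesis unfolding wp_def
    using s'(1) exec_frame[OF s'(1)[of "return_pmf {}" 0], of s'] assms(2) s'(2)
    by (intro exI[of _ s'] conjI assms(3)) auto
qed

section \<open>A heap with the working-set bound\<close>

text \<open>A positive number is an odd number times a power of two in only one way. So all levels
  of the tree share one array without collisions, and the indices stay linear in the number of
  leaves.\<close>

lemma node_inj:
  fixes i i' :: nat
  shows "(2 * i + 1) * 2 ^ j = (2 * i' + 1) * 2 ^ j' \<Longrightarrow> i = i' \<and> j = j'"
proof (induction j arbitrary: j')
  case 0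
  then show ?case
  proof (cases j')
    case (Suc k)
    with 0 have "2 * i + 1 = 2 * ((2 * i' + 1) * 2 ^ k)" by simp
    then show ?thesis by presburger
  qed simp
next
  case (Suc j)
  show ?case
  proof (cases j')
    case 0
    with Suc.prems have "2 * ((2 * i + 1) * 2 ^ j) = 2 * i' + 1" by simp
    then show ?thesis by presburger
  next
    case (Suc k)
    then have "(2 * i + 1) * 2 ^ j = (2 * i' + 1) * 2 ^ k" using Suc.prems by simp
    then show ?thesis using Suc.IH Suc by blast
  qed
qed

lemma div_power_Suc: "(x::nat) div 2 ^ Suc k = x div 2 ^ k div 2"
  by (simp only: power_Suc2 div_mult2_eq)

context
  fixes r :: "nat rel"
begin

text \<open>Vertices are stored as successors, so that \<open>0\<close> stands for the minimum of the empty set.\<close>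

definition is_min :: "nat \<Rightarrow> nat set \<Rightarrow> bool" where
  "is_min x S \<longleftrightarrow> (x = 0 \<and> S = {}) \<or> (\<exists>v\<in>S. x = Suc v \<and> (\<forall>u\<in>S. u = v \<or> (v, u) \<in> r))"

lemma is_min_empty [simp]: "is_min x {} \<longleftrightarrow> x = 0"
  by (auto simp: is_min_def)

lemma is_min_0 [simp]: "is_min 0 S \<longleftrightarrow> S = {}"
  by (auto simp: is_min_def)

lemma is_min_Suc: "is_min (Suc v) S \<longleftrightarrow> v \<in> S \<and> (\<forall>u\<in>S. u = v \<or> (v, u) \<in> r)"
  by (auto simp: is_min_def)

definition segm :: "(nat \<Rightarrow> nat) \<Rightarrow> nat set \<Rightarrow> nat \<Rightarrow> nat \<Rightarrow> nat set" where
  "segm idx A j i = {v\<in>A. idx v div 2 ^ j = i}"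

text \<open>Node \<open>i\<close> of level \<open>k\<close> exists if and only if
  \<open>i + 2 \<le> Suc c div 2 ^ k\<close>. So these are the elements below the existing nodes of
  level \<open>k\<close>, that is, on trees of height at least \<open>k\<close>.\<close>

definition prefx :: "(nat \<Rightarrow> nat) \<Rightarrow> nat set \<Rightarrow> nat \<Rightarrow> nat \<Rightarrow> nat set" where
  "prefx idx A c k = {v\<in>A. idx v < (Suc c div 2 ^ k - 1) * 2 ^ k}"

text \<open>
  The alive elements \<open>A\<close>, numbered by \<open>idx\<close> in order of insertion, are the leaves of a segment tree.
  Only the nodes with \<open>(i + 2) * 2 ^ j \<le> c + 1\<close> exist, where \<open>c\<close> is the number of insertions so far:
  the lag ensures that an element on a tree of height \<open>j\<close> was inserted at least \<open>2 ^ j\<close> insertions ago.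
  The maximal nodes form a forest, and \<open>M k\<close> is the minimum over its trees of height at least \<open>k\<close>.
\<close>

definition tree_ok :: "nat \<Rightarrow> (nat \<Rightarrow> nat) \<Rightarrow> nat set \<Rightarrow> (nat \<Rightarrow> nat) \<Rightarrow> bool" where
  "tree_ok c idx A T \<longleftrightarrow>
     (\<forall>j i. (i + 2) * 2 ^ j \<le> Suc c \<longrightarrow> is_min (T ((2 * i + 1) * 2 ^ j)) (segm idx A j i))"

definition mins_ok :: "nat \<Rightarrow> nat \<Rightarrow> (nat \<Rightarrow> nat) \<Rightarrow> nat set \<Rightarrow> (nat \<Rightarrow> nat) \<Rightarrow> bool" where
  "mins_ok k c idx A M \<longleftrightarrow> (\<forall>j\<ge>k. is_min (M j) (prefx idx A c j))"

lemma prefx_0: "prefx idx A c 0 = {v\<in>A. idx v < c}"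
  by (simp add: prefx_def)

lemma less_mult_iff_div: "0 < (b::nat) \<Longrightarrow> x < a * b \<longleftrightarrow> x div b < a"
  by (simp add: div_less_iff_less_mult)

text \<open>With \<open>q = Suc c div 2 ^ k\<close>, the nodes of level \<open>k\<close> are those
  with index up to \<open>q - 2\<close>. Level \<open>k + 1\<close> covers all but the last one if
  \<open>q\<close> is even and all but the last two if \<open>q\<close> is odd. In the even case the
  node \<open>q - 3\<close> is covered twice, which leaves a minimum unchanged; for
  \<open>q = 2\<close> truncated subtraction makes both nodes equal to node 0.\<close>

lemma prefx_step:
  assumes "2 \<le> Suc c div 2 ^ k"
  shows "prefx idx A c k = prefx idx A c (Suc k) \<union> segm idx A k (Suc c div 2 ^ k - 3)
    \<union> segm idx A k (Suc c div 2 ^ k - 2)"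
proof -
  define q where "q = Suc c div 2 ^ k"
  have q': "Suc c div 2 ^ Suc k = q div 2" unfolding q_def by (rule div_power_Suc)
  have "v \<in> prefx idx A c k \<longleftrightarrow> v \<in> prefx idx A c (Suc k) \<union> segm idx A k (q - 3) \<union> segm idx A k (q - 2)" for v
  proof -
    define y where "y = idx v div 2 ^ k"
    have y': "idx v div 2 ^ Suc k = y div 2" unfolding y_def by (rule div_power_Suc)
    have "v \<in> prefx idx A c k \<longleftrightarrow> v \<in> A \<and> y < q - 1"
      unfolding prefx_def by (simp add: less_mult_iff_div q_def[symmetric] y_def[symmetric])
    moreover have "v \<in> prefx idx A c (Suc k) \<longleftrightarrow> v \<in> A \<and> y div 2 < q div 2 - 1"
      unfolding prefx_def mem_Collect_eq q'
      using less_mult_iff_div[of "2 ^ Suc k" "idx v" "q div 2 - 1"] unfolding y' by simp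
    moreover have "y < q - 1 \<longleftrightarrow> y div 2 < q div 2 - 1 \<or> y = q - 3 \<or> y = q - 2"
      using assms unfolding q_def[symmetric]
      by (cases "even q"; cases "even y"; elim evenE oddE; clarsimp; linarith)
    ultimately show ?thesis unfolding segm_def by (auto simp: y_def[symmetric])
  qed
  then show ?thesis by (auto simp: q_def)
qed

lemma segm_step: "segm idx A (Suc j) i = segm idx A j (2 * i) \<union> segm idx A j (2 * i + 1)"
proof -
  have "idx v div 2 ^ Suc j = i \<longleftrightarrow> idx v div 2 ^ j = 2 * i \<or> idx v div 2 ^ j = 2 * i + 1" for v
  proof -
    have "idx v div 2 ^ Suc j = idx v div 2 ^ j div 2" by (rule div_power_Suc)
    moreover have "y div 2 = i \<longleftrightarrow> y = 2 * i \<or> y = 2 * i + 1" for y by presburger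
    ultimately show ?thesis by simp
  qed
  then show ?thesis by (auto simp: segm_def)
qed

lemma segm_idx_less:
  assumes "(i + 2) * 2 ^ j \<le> Suc c" "v \<in> segm idx A j i"
  shows "idx v + 2 ^ j \<le> c"
proof -
  have "idx v < (i + 1) * 2 ^ j"
    using assms(2) less_mult_iff_div[of "2 ^ j" "idx v" "i + 1"] by (simp add: segm_def)
  then have "idx v + 2 ^ j < (i + 2) * 2 ^ j" by simp
  with assms(1) show ?thesis by linarith
qed

end

text \<open>
  This is the sum of \<open>x div 2 ^ k\<close> over \<open>k \<ge> 1\<close>: the potential for the number of tree nodes created by
  insertions.
\<close>

fun halving_sum :: "nat \<Rightarrow> nat" where
  "halving_sum x = (if x = 0 then 0 else x div 2 + halving_sum (x div 2))"

declare halving_sum.simps [simp del]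

lemma halving_sum_0 [simp]: "halving_sum 0 = 0"
  by (simp add: halving_sum.simps)

lemma halving_sum_pos: "0 < x \<Longrightarrow> halving_sum x = x div 2 + halving_sum (x div 2)"
  by (subst halving_sum.simps) simp

lemma halving_sum_less: "0 < x \<Longrightarrow> halving_sum x < x"
proof (induction x rule: halving_sum.induct)
  case (1 x)
  show ?case
  proof (cases "x div 2 = 0")
    case True
    then show ?thesis using 1(2) by (simp add: halving_sum_pos)
  next
    case False
    then have "halving_sum (x div 2) < x div 2" using 1 by simp
    then show ?thesis using halving_sum_pos[OF 1(2)] by linarith
  qed
qed

text \<open>By Legendre's formula \<open>halving_sum x\<close> is the exponent of 2 in the factorial
  of \<open>x\<close>, so passing to \<open>Suc x\<close> adds the exponent of 2 in
  \<open>Suc x\<close>.\<close>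

lemma halving_sum_Suc: "2 ^ j dvd Suc x \<Longrightarrow> halving_sum x + j \<le> halving_sum (Suc x)"
proof (induction j arbitrary: x)
  case 0
  show ?case
  proof (induction x rule: less_induct)
    case (less x)
    have S: "halving_sum (Suc x) = Suc x div 2 + halving_sum (Suc x div 2)" by (rule halving_sum_pos) simp
    show ?case
    proof (cases "x = 0")
      case False
      then have x: "halving_sum x = x div 2 + halving_sum (x div 2)" by (intro halving_sum_pos) simp
      show ?thesis
      proof (cases "even x")
        case True
        then have "Suc x div 2 = x div 2" by presburger
        then show ?thesis using S x by simp
      next
        case odd: False
        then have e: "Suc x div 2 = Suc (x div 2)" by presburger
        have "x div 2 < x" using False by simp
        then have "halving_sum (x div 2) + 0 \<le> halving_sum (Suc (x div 2))" using less by blast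
        then show ?thesis using S x e by simp
      qed
    qed simp
  qed
next
  case (Suc j)
  then obtain y where "Suc x = 2 ^ Suc j * y" by (auto elim: dvdE)
  then have y: "Suc x = 2 * (2 ^ j * y)" by simp
  then have pos: "0 < 2 ^ j * y" by (metis Suc_neq_Zero bot_nat_0.not_eq_extremum mult_0_right)
  then obtain z where z: "2 ^ j * y = Suc z" by (metis gr0_implies_Suc)
  have x: "x = 2 * z + 1" "Suc x = 2 * Suc z" using y z by simp_all
  have "halving_sum z + j \<le> halving_sum (Suc z)" using Suc.IH[of z] z by (metis dvd_triv_left)
  moreover have "halving_sum x = z + halving_sum z" using halving_sum_pos[of x] x by simp
  moreover have "halving_sum (Suc x) = Suc z + halving_sum (Suc z)" using halving_sum_pos[of "Suc x"] x(2) by simp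
  ultimately show ?case by linarith
qed

abbreviation add_expr (infixl "+\<^sub>e" 65) where "e +\<^sub>e f \<equiv> Bin Plus e f"
abbreviation sub_expr (infixl "-\<^sub>e" 65) where "e -\<^sub>e f \<equiv> Bin Minus e f"
abbreviation mul_expr (infixl "*\<^sub>e" 70) where "e *\<^sub>e f \<equiv> Bin Times e f"
abbreviation div_expr (infixl "div\<^sub>e" 70) where "e div\<^sub>e f \<equiv> Bin Divide e f"
abbreviation mod_expr (infixl "mod\<^sub>e" 70) where "e mod\<^sub>e f \<equiv> Bin Modulo e f"
abbreviation less_expr (infix "<\<^sub>e" 50) where "e <\<^sub>e f \<equiv> Bin Less e f"
abbreviation eq_expr (infix "=\<^sub>e" 50) where "e =\<^sub>e f \<equiv> Bin Equal e f"
abbreviation seq_com (infixr ";;" 60) where "c ;; d \<equiv> Seq c d"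

lemma wp_Seq': "wp W c1 P s \<Longrightarrow> (\<And>s'. P s' \<Longrightarrow> wp W c2 Q s') \<Longrightarrow> wp W (c1 ;; c2) Q s"
  by (rule wp_Seq, erule wp_conseq, blast)

text \<open>
  Registers: 2 loop counter; 3, 4 end and start of the queue; 5 length of the path; 6 removed vertex;
  7 position in an adjacency list; 8 vertex being released; 10 number of path vertices removed;
  11 number of insertions; 13 the estimate; 14 removal time of the last vertex; 15 number of vertices
  removed; 16 minimum of the heap; 18 result of galloping; 21, 22 a tree level \<open>j\<close> and \<open>2 ^ j\<close>; the
  others are temporary.
  Arrays: 2, 3 first and next arcs of the adjacency lists; 4, 5 indegrees; 6 queue; 7 membership in
  \<open>N\<close>; 8 path; 9 removal time of the last predecessor; 10 number of path vertices before a vertex;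
  11 insertion number; 12 tree nodes, with node \<open>i\<close> of level \<open>j\<close> at index \<open>(2 * i + 1) * 2 ^ j\<close>; 13 the
  minima \<open>M\<close>.
\<close>

definition min2 :: com where
  "min2 = Cond (Reg 25)
     (Cond (Reg 24 =\<^sub>e Const 0)
       (Assign 24 (Reg 25))
       (Compare 20 (Reg 25 -\<^sub>e Const 1) (Reg 24 -\<^sub>e Const 1) ;; Cond (Reg 20) (Assign 24 (Reg 25)) Skip))
     Skip"

text \<open>Register 23 holds \<open>i\<close> and register 22 holds \<open>2 ^ j\<close>. The
  children have numbers \<open>2 * i\<close> and \<open>2 * i + 1\<close> on level
  \<open>j - 1\<close>, hence indices \<open>4 * i + 1\<close> and \<open>4 * i + 3\<close> times
  \<open>2 ^ (j - 1)\<close>.\<close>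

definition node :: com where
  "node =
     (Assign 24 (Arr 12 ((Const 4 *\<^sub>e Reg 23 +\<^sub>e Const 1) *\<^sub>e (Reg 22 div\<^sub>e Const 2))) ;;
     Assign 25 (Arr 12 ((Const 4 *\<^sub>e Reg 23 +\<^sub>e Const 3) *\<^sub>e (Reg 22 div\<^sub>e Const 2)))) ;;
     min2 ;;
     Store 12 ((Const 2 *\<^sub>e Reg 23 +\<^sub>e Const 1) *\<^sub>e Reg 22) (Reg 24)"

text \<open>One level of the recurrence \<open>prefx_step\<close>, with its quotient
  \<open>q\<close> in register 23: the minimum of the level above is combined with the nodes
  \<open>q - 3\<close> and \<open>q - 2\<close>, whatever the parity of \<open>q\<close>.\<close>

definition mins_body :: com where
  "mins_body =
     (Assign 21 (Reg 21 -\<^sub>e Const 1) ;;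
      Assign 23 ((Reg 11 +\<^sub>e Const 1) div\<^sub>e Reg 22) ;;
      Assign 24 (Arr 13 (Reg 21 +\<^sub>e Const 1)) ;;
      Assign 25 (Arr 12 ((Const 2 *\<^sub>e (Reg 23 -\<^sub>e Const 3) +\<^sub>e Const 1) *\<^sub>e Reg 22))) ;;
      min2 ;;
      Assign 25 (Arr 12 ((Const 2 *\<^sub>e (Reg 23 -\<^sub>e Const 2) +\<^sub>e Const 1) *\<^sub>e Reg 22)) ;;
      min2 ;;
      (Store 13 (Reg 21) (Reg 24) ;;
      Assign 22 (Reg 22 div\<^sub>e Const 2))"

definition mins :: com where
  "mins = Assign 21 (Reg 21 +\<^sub>e Const 1) ;; Loop (Reg 21) mins_body"

text \<open>When \<open>c\<close> has just been increased, the nodes that come into existence are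
  those with \<open>(i + 2) * 2 ^ j = c + 1\<close>: one on each level for which
  \<open>2 ^ j\<close> divides \<open>c + 1\<close> with quotient at least 2. The strict inequality
  in the loop condition excludes quotient 1.\<close>

definition push :: com where
  "push =
     (Store 11 (Reg 8) (Reg 11) ;;
     Store 12 (Const 2 *\<^sub>e Reg 11 +\<^sub>e Const 1) (Reg 8 +\<^sub>e Const 1) ;;
     Assign 11 (Reg 11 +\<^sub>e Const 1) ;;
     Assign 21 (Const 0) ;;
     Assign 22 (Const 1)) ;;
     Loop (((Reg 11 +\<^sub>e Const 1) mod\<^sub>e (Const 2 *\<^sub>e Reg 22) =\<^sub>e Const 0) *\<^sub>e
           (Const 2 *\<^sub>e Reg 22 <\<^sub>e Reg 11 +\<^sub>e Const 1))
       ((Assign 21 (Reg 21 +\<^sub>e Const 1) ;;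
        Assign 22 (Const 2 *\<^sub>e Reg 22) ;;
        Assign 23 ((Reg 11 +\<^sub>e Const 1) div\<^sub>e Reg 22 -\<^sub>e Const 2)) ;;
        node) ;;
     mins"

text \<open>Only existing ancestors of the leaf are recomputed; the loop condition tests
  \<open>(i + 2) * 2 ^ j \<le> c + 1\<close> for the parent. An element with few insertions after it
  has few existing ancestors, which is the source of the working-set bound.\<close>

definition pop :: com where
  "pop =
     (Assign 23 (Arr 11 (Reg 6)) ;;
     Assign 21 (Const 0) ;;
     Assign 22 (Const 1) ;;
     Store 12 (Const 2 *\<^sub>e Reg 23 +\<^sub>e Const 1) (Const 0)) ;;
     Loop ((Reg 23 div\<^sub>e Const 2 +\<^sub>e Const 2) *\<^sub>e (Const 2 *\<^sub>e Reg 22) <\<^sub>e Reg 11 +\<^sub>e Const 2)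
       ((Assign 21 (Reg 21 +\<^sub>e Const 1) ;;
        Assign 22 (Const 2 *\<^sub>e Reg 22) ;;
        Assign 23 (Reg 23 div\<^sub>e Const 2)) ;;
        node) ;;
     mins"

lemma syntax_min2 [simp]:
  "loop_free min2" "sample_free min2" "wregs min2 = {20, 24}" "warrs min2 = {}"
  by (auto simp: min2_def)

lemma syntax_node [simp]:
  "loop_free node" "sample_free node" "wregs node = {20, 24, 25}" "warrs node = {12}"
  by (auto simp: node_def)

lemma syntax_mins_body [simp]:
  "sample_free mins_body" "wregs mins_body = {20, 21, 22, 23, 24, 25}" "warrs mins_body = {13}"
  by (auto simp: mins_body_def)

lemma syntax_mins [simp]:
  "sample_free mins" "wregs mins = {20, 21, 22, 23, 24, 25}" "warrs mins = {13}"
  by (auto simp: mins_def)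

lemma syntax_push [simp]:
  "sample_free push" "wregs push = {11, 20, 21, 22, 23, 24, 25}" "warrs push = {11, 12, 13}"
  by (auto simp: push_def)

lemma syntax_pop [simp]:
  "sample_free pop" "wregs pop = {20, 21, 22, 23, 24, 25}" "warrs pop = {12, 13}"
  by (auto simp: pop_def)

lemma of_bool_nat_eq_0 [simp]: "of_bool P = (0::nat) \<longleftrightarrow> \<not> P"
  by simp

text \<open>The bound on \<open>W\<close> keeps the tree indices, the loop conditions of the heap
  and the probe positions of the galloping search from wrapping around.\<close>

locale ram_order =
  fixes W n :: nat and r :: "nat rel"
  assumes W_ge: "8 * n + 16 \<le> W"
    and total: "u < n \<Longrightarrow> v < n \<Longrightarrow> u \<noteq> v \<Longrightarrow> (u, v) \<in> r \<or> (v, u) \<in> r"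
    and trans: "(u, v) \<in> r \<Longrightarrow> (v, w) \<in> r \<Longrightarrow> (u, w) \<in> r"
begin

lemma is_min_le: "is_min r x A \<Longrightarrow> A \<subseteq> {..<n} \<Longrightarrow> x \<le> n"
  by (auto simp: is_min_def)

lemma wp_min2:
  assumes a: "is_min r (regs s 24) A" and b: "is_min r (regs s 25) B"
    and sub: "A \<subseteq> {..<n}" "B \<subseteq> {..<n}" and smp: "sampled s = r"
  shows "wp W min2 (\<lambda>s'. is_min r (regs s' 24) (A \<union> B) \<and> time s' \<le> time s + 5) s"
proof (rule wp_run)
  have le: "regs s 24 \<le> n" "regs s 25 \<le> n" using is_min_le a b sub by auto
  have W: "regs s 24 < W" "regs s 25 < W" "regs s 24 - Suc 0 < W" "regs s 25 - Suc 0 < W" "Suc 0 < W"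
    using le W_ge by auto
  show "is_min r (regs (run W min2 s) 24) (A \<union> B) \<and> time (run W min2 s) \<le> time s + 5"
  proof (cases "regs s 25 = 0 \<or> regs s 24 = 0")
    case True
    then show ?thesis using a b W by (auto simp: min2_def)
  next
    case False
    then obtain u v where uv: "regs s 24 = Suc u" "regs s 25 = Suc v"
      by (cases "regs s 24"; cases "regs s 25") auto
    have u: "u \<in> A" "\<forall>x\<in>A. x = u \<or> (u, x) \<in> r" and v: "v \<in> B" "\<forall>x\<in>B. x = v \<or> (v, x) \<in> r"
      using a b unfolding uv is_min_Suc by blast+
    have W': "u < W" "v < W" using W uv by auto
    have n: "u < n" "v < n" using u(1) v(1) sub by blast+
    show ?thesis
    proof (cases "(v, u) \<in> r")
      case True
      have "x = v \<or> (v, x) \<in> r" if "x \<in> A \<union> B" for x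
        using that u(2) v(2) trans[OF True, of x] True by (elim UnE) auto
      then have "is_min r (Suc v) (A \<union> B)" using v(1) unfolding is_min_Suc by blast
      with True show ?thesis using uv W W' smp by (simp add: min2_def)
    next
      case vu: False
      have uv': "(u, v) \<in> r \<or> u = v" using total[OF n] vu by blast
      have "x = u \<or> (u, x) \<in> r" if "x \<in> A \<union> B" for x
        using that u(2) v(2) trans[of u v x] uv' by (elim UnE) auto
      then have "is_min r (Suc u) (A \<union> B)" using u(1) unfolding is_min_Suc by blast
      with vu show ?thesis using uv W W' smp by (simp add: min2_def)
    qed
  qed
qed simp

lemma wp_node:
  assumes i: "regs s 23 = i" and w: "regs s 22 = 2 ^ Suc j" and built: "(i + 2) * 2 ^ Suc j \<le> Suc c" "c \<le> n"
    and l: "is_min r (arrs s 12 ((2 * (2 * i) + 1) * 2 ^ j)) (segm idx A j (2 * i))"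
    and rt: "is_min r (arrs s 12 ((2 * (2 * i + 1) + 1) * 2 ^ j)) (segm idx A j (2 * i + 1))"
    and A: "A \<subseteq> {..<n}" and smp: "sampled s = r"
  shows "wp W node (\<lambda>s'. \<exists>x. is_min r x (segm idx A (Suc j) i) \<and>
     arrs s' 12 = (arrs s 12)((2 * i + 1) * 2 ^ Suc j := x) \<and> time s' \<le> time s + 8) s"
proof -
  define P where "P = (2::nat) ^ j"
  have P: "1 \<le> P" by (simp add: P_def)
  have "2 * (i * P) + 4 * P \<le> n + 1" using built by (simp add: P_def algebra_simps)
  moreover have "i \<le> i * P" using P by simp
  ultimately have b: "4 * (i * P) + 3 * P < W" "4 * i + 3 < W" "2 * P < W" "P < W" "4 < W"
    using W_ge P by - linarith+
  have bs: "4 * i < W" "Suc (4 * i) < W" "4 * i + 3 < W" "2 * i < W" "Suc (2 * i) < W"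
    "Suc (4 * i) * P < W" "(4 * i + 3) * P < W" "Suc (2 * i) * (2 * P) < W" "2 < W" "3 < W" "Suc 0 < W" "4 < W" "P < W" "2 * P < W"
    using b by (simp_all add: algebra_simps)
  have idx: "(2 * (2 * i) + 1) * 2 ^ j = Suc (4 * i) * P" "(2 * (2 * i + 1) + 1) * 2 ^ j = (4 * i + 3) * P"
    "(2 * i + 1) * 2 ^ Suc j = Suc (2 * i) * (2 * P)"
    by (simp_all add: P_def algebra_simps)
  have w: "regs s 22 = 2 * P" using w by (simp add: P_def)
  have sub: "segm idx A k l \<subseteq> {..<n}" for k l using A by (auto simp: segm_def)
  let ?P1 = "\<lambda>s'. regs s' 24 = arrs s 12 (Suc (4 * i) * P) \<and> regs s' 25 = arrs s 12 ((4 * i + 3) * P)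
    \<and> regs s' 23 = i \<and> regs s' 22 = 2 * P \<and> arrs s' 12 = arrs s 12 \<and> sampled s' = r \<and> time s' = time s + 2"
  let ?P2 = "\<lambda>s'. is_min r (regs s' 24) (segm idx A (Suc j) i) \<and> regs s' 23 = i
    \<and> regs s' 22 = 2 * P \<and> arrs s' 12 = arrs s 12 \<and> time s' \<le> time s + 7"
  show ?thesis unfolding node_def
  proof (rule wp_Seq'[where P = ?P1], goal_cases)
    case 1
    show ?case by (rule wp_run; use i w smp bs in simp)
  next
    case (2 s1)
    show ?case
    proof (rule wp_Seq'[where P = ?P2], goal_cases)
      case 1
      have "is_min r (regs s1 24) (segm idx A j (2 * i))" "is_min r (regs s1 25) (segm idx A j (2 * i + 1))"
        using 2 l rt unfolding idx by simp_all
      then show ?case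
        by (rule wp_frame[OF wp_min2]) (use 2 sub in \<open>auto simp: segm_step\<close>)
    next
      case (2 s2)
      then show ?case
        unfolding idx by (intro wp_run) (use bs in auto)
    qed
  qed
qed

lemma wp_mins:
  assumes k: "regs s 21 = k" "regs s 22 = 2 ^ k" "regs s 11 = c" "2 \<le> Suc c div 2 ^ k" "c \<le> n"
    and T: "tree_ok r c idx A (arrs s 12)" and M: "mins_ok r (Suc k) c idx A (arrs s 13)"
    and A: "A \<subseteq> {..<n}" and smp: "sampled s = r"
  shows "wp W mins (\<lambda>s'. mins_ok r 0 c idx A (arrs s' 13) \<and> time s' \<le> time s + 30 * k + 40) s"
proof -
  have pk: "k < 2 ^ k" by simp
  have "2 * 2 ^ k \<le> Suc c" using k(4) by (metis div_le_mono le_trans nonzero_mult_div_cancel_right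
      less_eq_div_iff_mult_less_eq zero_less_numeral zero_less_power)
  then have kn: "2 * 2 ^ k \<le> n + 1" "2 * k < n + 1" using k(5) pk by linarith+
  \<comment> \<open>Register 21 holds the lowest level whose minimum is already correct, and
    register 22 the size of the nodes one level below it.\<close>
  define I where "I s' \<longleftrightarrow> regs s' 21 \<le> Suc k \<and> (0 < regs s' 21 \<longrightarrow> regs s' 22 = 2 ^ (regs s' 21 - 1))
     \<and> regs s' 11 = c \<and> arrs s' 12 = arrs s 12 \<and> sampled s' = r
     \<and> mins_ok r (regs s' 21) c idx A (arrs s' 13)
     \<and> time s' + 30 * regs s' 21 \<le> time s + 1 + 30 * Suc k" for s' :: state
  have W1: "Suc k < W" "Suc 0 < W" "2 < W" "3 < W" "Suc c < W" using kn W_ge k(5) by - linarith+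
  show ?thesis unfolding mins_def
  proof (rule wp_Seq'[where P = I], goal_cases)
    case 1
    show ?case by (rule wp_run; use k M smp W1 in \<open>simp add: I_def\<close>)
  next
    case (2 s1)
    show ?case
    proof (rule wp_Loop[where I = I and m = "\<lambda>s. regs s 21"], goal_cases)
      case 1
      show ?case using 2 .
    next
      case (3 s')
      then show ?case by (simp add: I_def)
    next
      case (2 s')
      then obtain j where j: "regs s' 21 = Suc j" by (cases "regs s' 21") auto
      define P where "P = (2::nat) ^ j"
      define q where "q = Suc c div P"
      have I: "j \<le> k" "regs s' 22 = P" "regs s' 11 = c" "arrs s' 12 = arrs s 12" "sampled s' = r"
        "mins_ok r (Suc j) c idx A (arrs s' 13)" "time s' + 30 * Suc j \<le> time s + 1 + 30 * Suc k"
        using 2 j by (auto simp: I_def P_def)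
      have P: "1 \<le> P" by (simp add: P_def)
      \<comment> \<open>The quotient only grows towards lower levels, so \<open>prefx_step\<close>
        applies on all of them.\<close>
      have q2: "2 \<le> q"
      proof -
        have "P \<le> 2 ^ k" unfolding P_def using I(1) by (intro power_increasing) auto
        then have "Suc c div 2 ^ k \<le> q" unfolding q_def using P by (intro div_le_mono2) auto
        with k(4) show ?thesis by simp
      qed
      have qP: "q * P \<le> Suc c" by (simp add: q_def)
      have qle: "q \<le> q * P" using P by simp
      have built: "(q - 2 + 2) * 2 ^ j \<le> Suc c" "(q - 3 + 2) * 2 ^ j \<le> Suc c"
        by (rule order_trans[OF mult_le_mono1 qP[unfolded P_def]]; use q2 in linarith)+
      have bnd: "Suc (2 * (q - 2)) * P < W" "Suc (2 * (q - 3)) * P < W" "Suc (2 * (q - 2)) < W"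
        "Suc (2 * (q - 3)) < W" "2 * (q - 2) < W" "2 * (q - 3) < W" "q < W" "Suc j < W" "P < W" "j < W"
      proof -
        have 1: "2 * (q * P) < W" using qP k(5) W_ge by linarith
        have "Suc (2 * (q - 2)) * P \<le> (2 * q) * P" "Suc (2 * (q - 3)) * P \<le> (2 * q) * P"
          using q2 by (intro mult_le_mono1; linarith)+
        with 1 show "Suc (2 * (q - 2)) * P < W" "Suc (2 * (q - 3)) * P < W" by - (simp; linarith)+
        have "2 * q < W" using 1 qle by linarith
        then show "Suc (2 * (q - 2)) < W" "Suc (2 * (q - 3)) < W" "2 * (q - 2) < W" "2 * (q - 3) < W" "q < W"
          using q2 by - linarith+
        have "P \<le> q * P" using q2 by simp
        then show "P < W" using 1 by linarith
        show "Suc j < W" "j < W" using I(1) W1 by - linarith+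
      qed
      have sub: "segm idx A x y \<subseteq> {..<n}" "prefx idx A x y \<subseteq> {..<n}" for x y
        using A by (auto simp: segm_def prefx_def)
      have t1: "is_min r (arrs s 12 (Suc (2 * (q - 3)) * P)) (segm idx A j (q - 3))"
        and t2: "is_min r (arrs s 12 (Suc (2 * (q - 2)) * P)) (segm idx A j (q - 2))"
        using T built unfolding tree_ok_def P_def by simp_all
      have m: "is_min r (arrs s' 13 (Suc j)) (prefx idx A c (Suc j))"
        using I(6) by (simp add: mins_ok_def)
      let ?F = "\<lambda>t s1. regs s1 21 = j \<and> regs s1 22 = P \<and> regs s1 11 = c \<and> arrs s1 12 = arrs s 12
        \<and> sampled s1 = r \<and> arrs s1 13 = arrs s' 13 \<and> regs s1 23 = q \<and> time s1 \<le> time s' + t"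
      show ?case unfolding mins_body_def
      proof (rule wp_Seq'[where P = "\<lambda>s1. ?F 5 s1 \<and> regs s1 24 = arrs s' 13 (Suc j)
          \<and> regs s1 25 = arrs s 12 (Suc (2 * (q - 3)) * P)"], goal_cases)
        case 1
        show ?case by (rule wp_run; use I j bnd W1 in \<open>simp add: q_def\<close>)
      next
        case (2 s1)
        show ?case
        proof (rule wp_Seq'[where P = "\<lambda>s1. ?F 10 s1 \<and>
            is_min r (regs s1 24) (prefx idx A c (Suc j) \<union> segm idx A j (q - 3))"], goal_cases)
          case 1
          show ?case
            by (rule wp_frame[OF wp_min2[of s1 "prefx idx A c (Suc j)" "segm idx A j (q - 3)"]])
              (use 2 m t1 sub in auto)
        next
          case (2 s2)
          show ?case
          proof (rule wp_Seq'[where P = "\<lambda>s1. ?F 11 s1 \<and> regs s1 25 = arrs s 12 (Suc (2 * (q - 2)) * P) \<and>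
              is_min r (regs s1 24) (prefx idx A c (Suc j) \<union> segm idx A j (q - 3))"], goal_cases)
            case 1
            show ?case by (rule wp_run; use 2 bnd W1 in simp)
          next
            case (2 s3)
            show ?case
            proof (rule wp_Seq'[where P = "\<lambda>s1. ?F 16 s1 \<and>
                is_min r (regs s1 24) (prefx idx A c j)"], goal_cases)
              case 1
              have "prefx idx A c j = (prefx idx A c (Suc j) \<union> segm idx A j (q - 3)) \<union> segm idx A j (q - 2)"
                using prefx_step[of c j idx A] q2 unfolding q_def P_def by simp
              then show ?case
                by (intro wp_frame[OF wp_min2[of s3 "prefx idx A c (Suc j) \<union> segm idx A j (q - 3)" "segm idx A j (q - 2)"]])
                  (use 2 t2 sub in auto)
            next
              case (2 s4)
              have "mins_ok r j c idx A ((arrs s' 13)(j := regs s4 24))"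
                unfolding mins_ok_def
              proof (intro allI impI)
                fix l assume "j \<le> l"
                then show "is_min r (((arrs s' 13)(j := regs s4 24)) l) (prefx idx A c l)"
                  using 2 I(6) by (cases "l = j") (auto simp: mins_ok_def)
              qed
              moreover have "0 < j \<longrightarrow> P div 2 = 2 ^ (j - 1)" unfolding P_def by (cases j) auto
              ultimately show ?case
                by (intro wp_run; use 2 I(1,7) j bnd W1 in \<open>auto simp: I_def\<close>)
            qed
          qed
        qed
      qed
    qed
  qed
qed

end

text \<open>When an ancestor of a leaf exists, so do all nodes between it and the leaf. Hence a
  climb may stop at the first missing ancestor.\<close>

lemma built_antimono:
  fixes x :: nat
  assumes "(x div 2 ^ k + 2) * 2 ^ k \<le> c" "j \<le> k"
  shows "(x div 2 ^ j + 2) * 2 ^ j \<le> c"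
  using assms(2,1)
proof (induction rule: dec_induct)
  case (step l)
  have "x div 2 ^ l + 2 \<le> (x div 2 ^ Suc l + 2) * 2"
  proof -
    have "z + 2 \<le> (z div 2 + 2) * 2" for z :: nat by presburger
    then show ?thesis unfolding div_power_Suc .
  qed
  then have "(x div 2 ^ l + 2) * 2 ^ l \<le> (x div 2 ^ Suc l + 2) * 2 * 2 ^ l" by (rule mult_le_mono1)
  also have "\<dots> = (x div 2 ^ Suc l + 2) * 2 ^ Suc l" by (simp only: power_Suc mult.assoc)
  finally have "(x div 2 ^ l + 2) * 2 ^ l \<le> c" using step.prems by linarith
  then show ?case by (rule step.IH)
qed

context ram_order
begin

text \<open>The highest level \<open>j\<close> of a new node satisfies
  \<open>2 ^ j dvd Suc (Suc c)\<close>, so the increase of \<open>halving_sum\<close> pays for it: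
  per level, 12 steps build the node and 30 recompute the minimum.\<close>

lemma wp_push:
  assumes z: "regs s 8 = z" "z < n" "z \<notin> A" and c: "regs s 11 = c" "c < n"
    and idx: "arrs s 11 = idx" "\<And>v. v \<in> A \<Longrightarrow> idx v < c"
    and T: "tree_ok r c idx A (arrs s 12)" and M: "mins_ok r 0 c idx A (arrs s 13)"
    and A: "A \<subseteq> {..<n}" and smp: "sampled s = r"
  shows "wp W push (\<lambda>s'. regs s' 11 = Suc c \<and> arrs s' 11 = idx(z := c)
     \<and> tree_ok r (Suc c) (idx(z := c)) (insert z A) (arrs s' 12)
     \<and> mins_ok r 0 (Suc c) (idx(z := c)) (insert z A) (arrs s' 13)
     \<and> time s' + 42 * halving_sum (Suc c) \<le> time s + 42 * halving_sum (Suc (Suc c)) + 46) s"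
proof -
  define idx' where "idx' = idx(z := c)"
  define B where "B = insert z A"
  have B: "B \<subseteq> {..<n}" using A z by (simp add: B_def)
  \<comment> \<open>Because of the lag, the new leaf \<open>c\<close> lies below no node that
    existed before, so the old nodes remain correct.\<close>
  have segm_eq: "segm idx' B j i = segm idx A j i" if "(i + 2) * 2 ^ j \<le> Suc c" for j i
  proof -
    have "c div 2 ^ j \<noteq> i" using segm_idx_less[OF that, of c "\<lambda>x. x" "{c}"] by (auto simp: segm_def)
    moreover have "idx' v = idx v" if "v \<in> A" for v using z that by (auto simp: idx'_def)
    ultimately show ?thesis using z(3) by (auto simp: segm_def B_def idx'_def)
  qed
  \<comment> \<open>Correctness during the climb: all nodes that existed before, and of the new ones
    those up to level \<open>j\<close>.\<close>
  define tr where "tr j T \<longleftrightarrow> (\<forall>k i. (i + 2) * 2 ^ k \<le> Suc (Suc c) \<and> ((i + 2) * 2 ^ k \<le> Suc c \<or> k \<le> j)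
     \<longrightarrow> is_min r (T ((2 * i + 1) * 2 ^ k)) (segm idx' B k i))" for j and T :: "nat \<Rightarrow> nat"
  define I where "I s' \<longleftrightarrow> regs s' 22 = 2 ^ regs s' 21 \<and> 2 ^ regs s' 21 dvd Suc (Suc c)
     \<and> 2 * 2 ^ regs s' 21 \<le> Suc (Suc c) \<and> regs s' 11 = Suc c \<and> arrs s' 11 = idx'
     \<and> arrs s' 13 = arrs s 13 \<and> sampled s' = r \<and> tr (regs s' 21) (arrs s' 12)
     \<and> time s' \<le> time s + 5 + 12 * regs s' 21" for s' :: state
  have W1: "0 < W" "Suc (2 * c) < W" "2 * c < W" "Suc z < W" "Suc (Suc c) < W" "Suc c < W" "Suc 0 < W" "2 < W" "c < W" "z < W"
    using c z W_ge by - linarith+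
  show ?thesis unfolding push_def idx'_def[symmetric] B_def[symmetric]
  proof (rule wp_Seq'[where P = I], goal_cases)
    case 1
    have "tr 0 ((arrs s 12)(Suc (2 * c) := Suc z))"
      unfolding tr_def
    proof (intro allI impI)
      fix k i assume ki: "(i + 2) * 2 ^ k \<le> Suc (Suc c) \<and> ((i + 2) * 2 ^ k \<le> Suc c \<or> k \<le> 0)"
      show "is_min r (((arrs s 12)(Suc (2 * c) := Suc z)) ((2 * i + 1) * 2 ^ k)) (segm idx' B k i)"
      proof (cases "k = 0 \<and> i = c")
        case True
        then have "segm idx' B k i = {z}" using idx(2) by (force simp: segm_def B_def idx'_def)
        with True show ?thesis by (simp add: is_min_Suc)
      next
        case False
        then have "(2 * i + 1) * 2 ^ k \<noteq> (2 * c + 1) * 2 ^ 0" using node_inj[of i k c 0] by blast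
        moreover have le: "(i + 2) * 2 ^ k \<le> Suc c"
        proof (cases "k = 0")
          case True
          with False have "i \<noteq> c" by simp
          with True ki show ?thesis by simp
        qed (use ki in simp)
        ultimately show ?thesis using T unfolding tree_ok_def segm_eq[OF le] by simp
      qed
    qed
    then show ?case
      by (intro wp_run; use z c idx smp W1 in \<open>simp add: I_def idx'_def\<close>)
  next
    case (2 s1)
    let ?Q = "\<lambda>s'. I s' \<and> tree_ok r (Suc c) idx' B (arrs s' 12) \<and> mins_ok r (Suc (regs s' 21)) (Suc c) idx' B (arrs s' 13)"
    let ?P = "\<lambda>s'. \<exists>s0. ?Q s0 \<and> s' = tick 1 s0"
    show ?case
    proof (rule wp_Seq'[where P = ?P], goal_cases)
      case 1
      show ?case
      proof (rule wp_Loop[where I = I and m = "\<lambda>s. Suc (Suc c) - regs s 22"], goal_cases)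
        case 1
        show ?case using 2 .
      next
        case (3 s')
        define j where "j = regs s' 21"
        have I: "regs s' 22 = 2 ^ j" "2 ^ j dvd Suc (Suc c)" "2 * 2 ^ j \<le> Suc (Suc c)" "regs s' 11 = Suc c"
          "arrs s' 13 = arrs s 13" "tr j (arrs s' 12)" using 3(1) by (simp_all add: I_def j_def)
        have w: "2 * 2 ^ j < W" using I(3) W1 by linarith
        have ex: "\<not> (2 ^ Suc j dvd Suc (Suc c) \<and> 2 * 2 ^ j < Suc (Suc c))"
        proof
          assume *: "2 ^ Suc j dvd Suc (Suc c) \<and> 2 * 2 ^ j < Suc (Suc c)"
          then have "Suc (Suc c) mod (2 * 2 ^ j) = 0" by (simp add: dvd_eq_mod_eq_0)
          with 3(2) I W1 w * show False by (simp add: mod_less)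
        qed
        have t: "tree_ok r (Suc c) idx' B (arrs s' 12)" unfolding tree_ok_def
        proof (intro allI impI)
          fix k i assume le: "(i + 2) * 2 ^ k \<le> Suc (Suc c)"
          have "(i + 2) * 2 ^ k \<le> Suc c \<or> k \<le> j"
          proof (rule ccontr)
            assume "\<not> ?thesis"
            then have e: "(i + 2) * 2 ^ k = Suc (Suc c)" and k: "Suc j \<le> k" using le by auto
            have "(2::nat) ^ Suc j dvd 2 ^ k" using k by (rule le_imp_power_dvd)
            then have "2 ^ Suc j dvd Suc (Suc c)" unfolding e[symmetric] by (rule dvd_mult)
            moreover have "(2::nat) ^ Suc j \<le> 2 ^ k" using k by (intro power_increasing) auto
            then have "2 * 2 ^ j < Suc (Suc c)" unfolding e[symmetric]
              using zero_less_power[of "2::nat" k] by (simp add: algebra_simps; linarith)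
            ultimately show False using ex by blast
          qed
          then show "is_min r (arrs s' 12 ((2 * i + 1) * 2 ^ k)) (segm idx' B k i)"
            using I(6) le unfolding tr_def by blast
        qed
        have m: "mins_ok r (Suc j) (Suc c) idx' B (arrs s' 13)" unfolding mins_ok_def
        proof (intro allI impI)
          fix k assume k: "Suc j \<le> k"
          have old: "is_min r (arrs s' 13 k) (prefx idx A c k)" using M I(5) by (simp add: mins_ok_def)
          have pk: "(1::nat) \<le> 2 ^ k" by simp
          show "is_min r (arrs s' 13 k) (prefx idx' B (Suc c) k)"
          \<comment> \<open>Above the last level built, the quotient that defines
            \<open>prefx\<close> changes only if \<open>Suc (Suc c)\<close> is \<open>2 ^ k\<close>
            itself. Then it rises from 0 to 1, and no node of level \<open>k\<close> exists before
            or after.\<close>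
          proof (cases "2 ^ k dvd Suc (Suc c)")
            case True
            have "(2::nat) ^ Suc j dvd 2 ^ k" using k by (rule le_imp_power_dvd)
            then have "2 ^ Suc j dvd Suc (Suc c)" using True by (rule dvd_trans)
            then have "Suc (Suc c) \<le> 2 ^ Suc j" using ex by auto
            moreover have "(2::nat) ^ Suc j \<le> 2 ^ k" using k by (intro power_increasing) auto
            moreover have "2 ^ k \<le> Suc (Suc c)" using True by (rule dvd_imp_le) simp
            ultimately have e: "Suc (Suc c) = 2 ^ k" by linarith
            then have "Suc (Suc c) div 2 ^ k = 1" "Suc c div 2 ^ k = 0" by simp_all
            with old show ?thesis by (simp add: prefx_def)
          next
            case False
            then have d: "Suc (Suc c) div 2 ^ k = Suc c div 2 ^ k"
              by (simp add: div_Suc dvd_eq_mod_eq_0)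
            define q where "q = Suc c div 2 ^ k"
            have "q * 2 ^ k \<le> Suc c" by (simp add: q_def)
            then have "q * 2 ^ k - 2 ^ k \<le> Suc c - 1"
              by (rule order_trans[OF diff_le_mono2[OF pk] diff_le_mono])
            then have "(q - 1) * 2 ^ k \<le> c" by (simp add: diff_mult_distrib)
            moreover have "idx' v = idx v" if "v \<in> A" for v using z that by (auto simp: idx'_def)
            ultimately have "prefx idx' B (Suc c) k = prefx idx A c k"
              using z(3) by (auto simp: prefx_def d q_def[symmetric] B_def idx'_def)
            with old show ?thesis by simp
          qed
        qed
        show ?case using 3(1) t m unfolding j_def by blast
      next
        case (2 s')
        define j where "j = regs s' 21"
        define P where "P = (2::nat) ^ j"
        define d where "d = Suc (Suc c) div (2 * P)"
        have I: "regs s' 22 = P" "2 * P \<le> Suc (Suc c)" "regs s' 11 = Suc c"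
          "arrs s' 11 = idx'" "sampled s' = r"
          "arrs s' 13 = arrs s 13" "tr j (arrs s' 12)" "time s' \<le> time s + 5 + 12 * j" "regs s' 21 = j"
          using 2(1) by (simp_all add: I_def j_def P_def)
        have P: "1 \<le> P" by (simp add: P_def)
        have jP: "j < P" by (simp add: P_def)
        have w: "2 * P < W" "j < W" "Suc j < W" using I(2) W1 jP by - linarith+
        have "Suc (Suc c) mod (2 * P) \<le> Suc (Suc c)" by (rule mod_less_eq_dividend)
        then have mW: "Suc (Suc c) mod (2 * P) < W" using W1 by linarith
        have cond: "Suc (Suc c) mod (2 * P) = 0" "2 * P < Suc (Suc c)"
          using 2(2) I(1-3) W1 w mW by (auto split: if_splits)
        have dP: "d * (2 * P) = Suc (Suc c)" using cond(1) unfolding d_def by (simp add: mod_eq_0_iff_dvd)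
        have d2: "2 \<le> d"
        proof (rule ccontr)
          assume "\<not> 2 \<le> d"
          then have "d \<le> 1" by simp
          then have "d * (2 * P) \<le> 1 * (2 * P)" by (rule mult_le_mono1)
          with dP cond(2) show False by simp
        qed
        define i where "i = d - 2"
        have i: "d = i + 2" using d2 by (simp add: i_def)
        have "d \<le> d * (2 * P)" using P by simp
        then have dW: "d < W" using dP W1 by linarith
        have iP: "(i + 2) * 2 ^ Suc j = Suc (Suc c)" using dP i by (simp add: P_def)
        \<comment> \<open>The lag again: both children of a new node existed before this insertion,
          so they are already correct.\<close>
        have ch: "(2 * i + 2) * 2 ^ j \<le> Suc c" "(2 * i + 1 + 2) * 2 ^ j \<le> Suc c"
        proof -
          have "2 * (i * P) + 4 * P = Suc (Suc c)" using iP by (simp add: P_def algebra_simps)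
          moreover have "(2 * i + 2) * P = 2 * (i * P) + 2 * P" "(2 * i + 1 + 2) * P = 2 * (i * P) + 3 * P"
            by (simp_all add: algebra_simps)
          ultimately show "(2 * i + 2) * 2 ^ j \<le> Suc c" "(2 * i + 1 + 2) * 2 ^ j \<le> Suc c"
            unfolding P_def[symmetric] using P by - linarith+
        qed
        have l: "is_min r (arrs s' 12 ((2 * (2 * i) + 1) * 2 ^ j)) (segm idx' B j (2 * i))"
          using I(7) ch unfolding tr_def by (meson le_SucI)
        have rt: "is_min r (arrs s' 12 ((2 * (2 * i + 1) + 1) * 2 ^ j)) (segm idx' B j (2 * i + 1))"
          using I(7) ch unfolding tr_def by (meson le_SucI)
        show ?case
        proof (rule wp_Seq'[where P = "\<lambda>s1. regs s1 21 = Suc j \<and> regs s1 22 = 2 ^ Suc j \<and> regs s1 23 = i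
            \<and> regs s1 11 = Suc c \<and> arrs s1 11 = idx' \<and> sampled s1 = r \<and> arrs s1 13 = arrs s 13
            \<and> arrs s1 12 = arrs s' 12 \<and> time s1 = time s' + 4"], goal_cases)
          case 1
          show ?case
            by (rule wp_run; use I W1 w i dW in \<open>simp add: P_def d_def\<close>)
        next
          case (2 s1)
          have nd: "wp W node (\<lambda>s'a. \<exists>x. is_min r x (segm idx' B (Suc j) i) \<and>
              arrs s'a 12 = (arrs s1 12)((2 * i + 1) * 2 ^ Suc j := x) \<and> time s'a \<le> time s1 + 8) s1"
            by (rule wp_node[where c = "Suc c"]) (use 2 iP c l rt B in simp_all)
          show ?case
          proof (rule wp_frame[OF nd], goal_cases)
            case (2 s2)
            then obtain x where x: "is_min r x (segm idx' B (Suc j) i)"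
              "arrs s2 12 = (arrs s' 12)((2 * i + 1) * 2 ^ Suc j := x)" "time s2 \<le> time s1 + 8"
              using \<open>regs s1 21 = Suc j \<and> _\<close> by auto
            have t: "tr (Suc j) (arrs s2 12)" unfolding tr_def
            proof (intro allI impI)
              fix k i' assume ki: "(i' + 2) * 2 ^ k \<le> Suc (Suc c) \<and> ((i' + 2) * 2 ^ k \<le> Suc c \<or> k \<le> Suc j)"
              show "is_min r (arrs s2 12 ((2 * i' + 1) * 2 ^ k)) (segm idx' B k i')"
              proof (cases "i' = i \<and> k = Suc j")
                case True
                from True x(1) show ?thesis unfolding x(2) by (simp only: fun_upd_same)
              next
                case False
                then have ne: "(2 * i' + 1) * 2 ^ k \<noteq> (2 * i + 1) * 2 ^ Suc j"
                  using node_inj[of i' k i "Suc j"] by blast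
                have "(i' + 2) * 2 ^ k \<le> Suc c \<or> k \<le> j"
                proof (rule ccontr)
                  assume "\<not> ?thesis"
                  then have *: "\<not> (i' + 2) * 2 ^ k \<le> Suc c" "\<not> k \<le> j" by blast+
                  with ki have "k \<le> Suc j" by blast
                  with * have "k = Suc j" by linarith
                  moreover have "(i' + 2) * 2 ^ k = Suc (Suc c)" using ki * by linarith
                  ultimately have "k = Suc j" "(i' + 2) * 2 ^ k = Suc (Suc c)" .
                  then have "(i' + 2) * 2 ^ k = (i + 2) * 2 ^ k" using iP by simp
                  then have "i' = i" by simp
                  with False \<open>k = Suc j\<close> show False by simp
                qed
                then have "is_min r (arrs s' 12 ((2 * i' + 1) * 2 ^ k)) (segm idx' B k i')"
                  using I(7) ki unfolding tr_def by blast
                then show ?thesis unfolding x(2) fun_upd_other[OF ne] .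
              qed
            qed
            have "2 ^ Suc j dvd Suc (Suc c)" unfolding iP[symmetric] by simp
            moreover have "2 * 2 ^ Suc j \<le> Suc (Suc c)" unfolding iP[symmetric] by simp
            ultimately have "I s2" using 2 x t I(8) \<open>regs s1 21 = Suc j \<and> _\<close> by (simp add: I_def)
            moreover have "Suc (Suc c) - regs s2 22 < Suc (Suc c) - regs s' 22"
            proof -
              have "regs s2 22 = 2 * P" using 2 \<open>regs s1 21 = Suc j \<and> _\<close> by (simp add: P_def)
              then show ?thesis unfolding I(1) using cond(2) P by linarith
            qed
            ultimately show ?case by simp
          qed simp
        qed
      qed
    next
      case (2 s1)
      then obtain s0 where s0: "?Q s0" "s1 = tick 1 s0" by blast
      define j where "j = regs s0 21"
      have I: "regs s1 21 = j" "regs s1 22 = 2 ^ j" "2 ^ j dvd Suc (Suc c)" "2 * 2 ^ j \<le> Suc (Suc c)"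
        "regs s1 11 = Suc c" "arrs s1 11 = idx'" "sampled s1 = r" "time s1 \<le> time s + 6 + 12 * j"
        "tree_ok r (Suc c) idx' B (arrs s1 12)" "mins_ok r (Suc j) (Suc c) idx' B (arrs s1 13)"
        using s0 by (auto simp: I_def j_def)
      have "halving_sum (Suc c) + j \<le> halving_sum (Suc (Suc c))" using I(3) by (rule halving_sum_Suc)
      moreover have "2 \<le> Suc (Suc c) div 2 ^ j" using I(4) by (simp add: less_eq_div_iff_mult_less_eq)
      ultimately show ?case
        using I c B
        by (intro wp_frame[OF wp_mins[where k = j and c = "Suc c" and idx = idx' and A = B]]) auto
    qed
  qed
qed

text \<open>If the climb ends at level \<open>j\<close>, then the ancestor on that level exists, and
  \<open>segm_idx_less\<close> shows that at least \<open>2 ^ j\<close> insertions took place from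
  that of \<open>v\<close> on.\<close>

lemma wp_pop:
  assumes v: "regs s 6 = v" "v \<in> A" and c: "regs s 11 = c" "c \<le> n"
    and idx: "arrs s 11 = idx" "\<And>v. v \<in> A \<Longrightarrow> idx v < c" "inj_on idx A"
    and T: "tree_ok r c idx A (arrs s 12)" and M: "mins_ok r 0 c idx A (arrs s 13)"
    and A: "A \<subseteq> {..<n}" and smp: "sampled s = r"
  shows "wp W pop (\<lambda>s'. tree_ok r c idx (A - {v}) (arrs s' 12)
     \<and> mins_ok r 0 c idx (A - {v}) (arrs s' 13)
     \<and> (\<exists>j. 2 ^ j \<le> c - idx v \<and> time s' \<le> time s + 42 * j + 45)) s"
proof -
  define B where "B = A - {v}"
  define y where "y = idx v"
  have B: "B \<subseteq> {..<n}" using A by (auto simp: B_def)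
  have y: "y < c" using idx v by (simp add: y_def)
  have segm_eq: "segm idx B j i = segm idx A j i" if "i \<noteq> y div 2 ^ j" for j i
    using that by (auto simp: segm_def B_def y_def)
  \<comment> \<open>The nodes still to be repaired are the ancestors of leaf \<open>y\<close> above
    level \<open>j\<close>.\<close>
  define tr where "tr j T \<longleftrightarrow> (\<forall>k i. (i + 2) * 2 ^ k \<le> Suc c \<and> \<not> (j < k \<and> i = y div 2 ^ k)
     \<longrightarrow> is_min r (T ((2 * i + 1) * 2 ^ k)) (segm idx B k i))" for j and T :: "nat \<Rightarrow> nat"
  define I where "I s' \<longleftrightarrow> regs s' 22 = 2 ^ regs s' 21 \<and> regs s' 23 = y div 2 ^ regs s' 21
     \<and> (y div 2 ^ regs s' 21 + 2) * 2 ^ regs s' 21 \<le> Suc c \<and> regs s' 11 = c \<and> arrs s' 11 = idx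
     \<and> arrs s' 13 = arrs s 13 \<and> sampled s' = r \<and> tr (regs s' 21) (arrs s' 12)
     \<and> time s' \<le> time s + 4 + 12 * regs s' 21" for s' :: state
  have vn: "v < n" using v A by auto
  have W1: "0 < W" "Suc (2 * y) < W" "2 * y < W" "Suc (Suc c) < W" "Suc c < W" "Suc 0 < W" "2 < W" "c < W" "v < W" "y < W"
    using c y vn W_ge by - linarith+
  show ?thesis unfolding pop_def B_def[symmetric]
  proof (rule wp_Seq'[where P = I], goal_cases)
    case 1
    have "tr 0 ((arrs s 12)(Suc (2 * y) := 0))"
      unfolding tr_def
    proof (intro allI impI)
      fix k i assume ki: "(i + 2) * 2 ^ k \<le> Suc c \<and> \<not> (0 < k \<and> i = y div 2 ^ k)"
      show "is_min r (((arrs s 12)(Suc (2 * y) := 0)) ((2 * i + 1) * 2 ^ k)) (segm idx B k i)"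
      proof (cases "k = 0 \<and> i = y")
        case True
        then have "segm idx B k i = {}" using idx(3) v by (auto simp: segm_def B_def y_def inj_on_def)
        with True show ?thesis by simp
      next
        case False
        then have "(2 * i + 1) * 2 ^ k \<noteq> (2 * y + 1) * 2 ^ 0" using node_inj[of i k y 0] by blast
        moreover have "segm idx B k i = segm idx A k i" using False ki by (intro segm_eq) auto
        ultimately show ?thesis using T ki unfolding tree_ok_def by simp
      qed
    qed
    then show ?case
      by (intro wp_run; use v c idx(1) y smp W1 in \<open>simp add: I_def y_def\<close>)
  next
    case (2 s1)
    let ?Q = "\<lambda>s'. I s' \<and> tree_ok r c idx B (arrs s' 12) \<and> mins_ok r (Suc (regs s' 21)) c idx B (arrs s' 13)"
    let ?P = "\<lambda>s'. \<exists>s0. ?Q s0 \<and> s' = tick 1 s0"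
    have bnd: "(x div 2 + 2) * (2 * P) < W" "2 * P < W" "x div 2 + 2 < W" "x < W"
      if "(x + 2) * P \<le> Suc c" "1 \<le> P" for x P :: nat
    proof -
      have "x div 2 * 2 * P \<le> x * P" by (rule mult_le_mono1) simp
      then have 1: "(x div 2 + 2) * (2 * P) \<le> x * P + 4 * P" by (simp add: algebra_simps)
      have 2: "x * P + 2 * P \<le> Suc c" using that(1) by (simp add: algebra_simps)
      have 3: "x \<le> x * P" using that(2) by simp
      show "(x div 2 + 2) * (2 * P) < W" "2 * P < W" "x < W" using 1 2 3 c W_ge by - linarith+
      show "x div 2 + 2 < W" using 2 3 c W_ge by linarith
    qed
    show ?case
    proof (rule wp_Seq'[where P = ?P], goal_cases)
      case 1
      show ?case
      proof (rule wp_Loop[where I = I and m = "\<lambda>s. Suc (Suc c) - regs s 22"], goal_cases)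
        case 1
        show ?case using 2 .
      next
        case (3 s')
        define j where "j = regs s' 21"
        have I: "regs s' 22 = 2 ^ j" "regs s' 23 = y div 2 ^ j" "(y div 2 ^ j + 2) * 2 ^ j \<le> Suc c" "regs s' 11 = c"
          "arrs s' 13 = arrs s 13" "tr j (arrs s' 12)" using 3(1) by (simp_all add: I_def j_def)
        have ex: "\<not> (y div 2 ^ Suc j + 2) * 2 ^ Suc j \<le> Suc c"
          using 3(2) I(1,2,4) W1 bnd[OF I(3)] unfolding div_power_Suc by simp
        have nb: "\<not> (y div 2 ^ k + 2) * 2 ^ k \<le> Suc c" if "j < k" for k
          using built_antimono[of y k "Suc c" "Suc j"] ex that by auto
        have t: "tree_ok r c idx B (arrs s' 12)" unfolding tree_ok_def
          using I(6) nb unfolding tr_def by blast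
        have m: "mins_ok r (Suc j) c idx B (arrs s' 13)" unfolding mins_ok_def
        proof (intro allI impI)
          fix k assume k: "Suc j \<le> k"
          have old: "is_min r (arrs s' 13 k) (prefx idx A c k)" using M I(5) by (simp add: mins_ok_def)
          have "\<not> y < (Suc c div 2 ^ k - 1) * 2 ^ k"
          proof
            assume "y < (Suc c div 2 ^ k - 1) * 2 ^ k"
            then have "y div 2 ^ k < Suc c div 2 ^ k - 1" by (simp add: less_mult_iff_div)
            then have "y div 2 ^ k + 2 \<le> Suc c div 2 ^ k" by linarith
            then have "(y div 2 ^ k + 2) * 2 ^ k \<le> Suc c div 2 ^ k * 2 ^ k" by (rule mult_le_mono1)
            also have "\<dots> \<le> Suc c" by simp
            finally show False using nb k by simp
          qed
          then have "prefx idx B c k = prefx idx A c k" by (auto simp: prefx_def B_def y_def)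
          with old show "is_min r (arrs s' 13 k) (prefx idx B c k)" by simp
        qed
        show ?case using 3(1) t m unfolding j_def by blast
      next
        case (2 s')
        define j where "j = regs s' 21"
        define P where "P = (2::nat) ^ j"
        define x where "x = y div P"
        have I: "regs s' 22 = P" "regs s' 23 = x" "(x + 2) * P \<le> Suc c" "regs s' 11 = c"
          "arrs s' 11 = idx" "sampled s' = r"
          "arrs s' 13 = arrs s 13" "tr j (arrs s' 12)" "time s' \<le> time s + 4 + 12 * j" "regs s' 21 = j"
          using 2(1) by (simp_all add: I_def j_def P_def x_def)
        have P: "1 \<le> P" by (simp add: P_def)
        have jP: "j < P" by (simp add: P_def)
        note b = bnd[OF I(3) P]
        have w: "j < W" "Suc j < W" using b(2) jP by - linarith+
        have cond: "(x div 2 + 2) * (2 * P) \<le> Suc c" using 2(2) I(1,2,4) W1 b by (auto split: if_splits)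
        define i where "i = x div 2"
        have iy: "i = y div 2 ^ Suc j" unfolding i_def x_def P_def div_power_Suc ..
        have iP: "(i + 2) * 2 ^ Suc j \<le> Suc c" using cond by (simp add: P_def i_def)
        have ch: "(2 * i + 2) * 2 ^ j \<le> Suc c" "(2 * i + 1 + 2) * 2 ^ j \<le> Suc c"
          using iP by (simp_all add: algebra_simps)
        have l: "is_min r (arrs s' 12 ((2 * (2 * i) + 1) * 2 ^ j)) (segm idx B j (2 * i))"
          using I(8) ch unfolding tr_def by blast
        have rt: "is_min r (arrs s' 12 ((2 * (2 * i + 1) + 1) * 2 ^ j)) (segm idx B j (2 * i + 1))"
          using I(8) ch unfolding tr_def by blast
        have PW: "4 * P \<le> Suc c" using cond P by (simp add: algebra_simps)
        show ?case
        proof (rule wp_Seq'[where P = "\<lambda>s1. regs s1 21 = Suc j \<and> regs s1 22 = 2 ^ Suc j \<and> regs s1 23 = i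
            \<and> regs s1 11 = c \<and> arrs s1 11 = idx \<and> sampled s1 = r \<and> arrs s1 13 = arrs s 13
            \<and> arrs s1 12 = arrs s' 12 \<and> time s1 = time s' + 4"], goal_cases)
          case 1
          show ?case
            by (rule wp_run; use I W1 w b in \<open>simp add: P_def i_def\<close>)
        next
          case (2 s1)
          have nd: "wp W node (\<lambda>s'a. \<exists>x. is_min r x (segm idx B (Suc j) i) \<and>
              arrs s'a 12 = (arrs s1 12)((2 * i + 1) * 2 ^ Suc j := x) \<and> time s'a \<le> time s1 + 8) s1"
            by (rule wp_node[where c = c]) (use 2 iP c l rt B in simp_all)
          show ?case
          proof (rule wp_frame[OF nd], goal_cases)
            case (2 s2)
            then obtain x where x: "is_min r x (segm idx B (Suc j) i)"
              "arrs s2 12 = (arrs s' 12)((2 * i + 1) * 2 ^ Suc j := x)" "time s2 \<le> time s1 + 8"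
              using \<open>regs s1 21 = Suc j \<and> _\<close> by auto
            have t: "tr (Suc j) (arrs s2 12)" unfolding tr_def
            proof (intro allI impI)
              fix k i' assume ki: "(i' + 2) * 2 ^ k \<le> Suc c \<and> \<not> (Suc j < k \<and> i' = y div 2 ^ k)"
              show "is_min r (arrs s2 12 ((2 * i' + 1) * 2 ^ k)) (segm idx B k i')"
              proof (cases "i' = i \<and> k = Suc j")
                case True
                from True x(1) show ?thesis unfolding x(2) by (simp only: fun_upd_same)
              next
                case False
                then have ne: "(2 * i' + 1) * 2 ^ k \<noteq> (2 * i + 1) * 2 ^ Suc j"
                  using node_inj[of i' k i "Suc j"] by blast
                have "\<not> (j < k \<and> i' = y div 2 ^ k)"
                proof
                  assume *: "j < k \<and> i' = y div 2 ^ k"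
                  with ki have "k = Suc j" by auto
                  with * False iy show False by simp
                qed
                then have "is_min r (arrs s' 12 ((2 * i' + 1) * 2 ^ k)) (segm idx B k i')"
                  using I(8) ki unfolding tr_def by blast
                then show ?thesis unfolding x(2) fun_upd_other[OF ne] .
              qed
            qed
            have "I s2" using 2 x t I(9) iP iy \<open>regs s1 21 = Suc j \<and> _\<close> by (simp add: I_def)
            moreover have "Suc (Suc c) - regs s2 22 < Suc (Suc c) - regs s' 22"
            proof -
              have "regs s2 22 = 2 * P" using 2 \<open>regs s1 21 = Suc j \<and> _\<close> by (simp add: P_def)
              then show ?thesis unfolding I(1) using PW P by linarith
            qed
            ultimately show ?case by simp
          qed simp
        qed
      qed
    next
      case (2 s1)
      then obtain s0 where s0: "?Q s0" "s1 = tick 1 s0" by blast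
      define j where "j = regs s0 21"
      have I: "regs s1 21 = j" "regs s1 22 = 2 ^ j" "(y div 2 ^ j + 2) * 2 ^ j \<le> Suc c"
        "regs s1 11 = c" "arrs s1 11 = idx" "sampled s1 = r" "time s1 \<le> time s + 5 + 12 * j"
        "tree_ok r c idx B (arrs s1 12)" "mins_ok r (Suc j) c idx B (arrs s1 13)"
        using s0 by (auto simp: I_def j_def)
      have "y + 2 ^ j \<le> c" using segm_idx_less[OF I(3), of y "\<lambda>x. x" "{y}"] by (simp add: segm_def)
      then have "2 ^ j \<le> c - idx v" by (simp add: y_def)
      moreover have "2 \<le> Suc c div 2 ^ j"
      proof -
        have "2 * 2 ^ j \<le> (y div 2 ^ j + 2) * 2 ^ j" by (rule mult_le_mono1) simp
        then have "2 * 2 ^ j \<le> Suc c" using I(3) by (rule order_trans)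
        then show ?thesis by (simp add: less_eq_div_iff_mult_less_eq)
      qed
      ultimately show ?case
        using I c B
        by (intro wp_frame[OF wp_mins[where k = j and c = c and idx = idx and A = B]]) (auto intro!: exI[of _ j])
    qed
  qed
qed

end

section \<open>Galloping search and adjacency lists\<close>

text \<open>With \<open>lo\<close> and \<open>d\<close> in registers 18 and 19, this asks whether at
  least \<open>lo + d\<close> path vertices precede the vertex, so the last of them, at index
  \<open>lo + d - 1\<close>, is compared. Beyond the end of the path the answer is no.\<close>

definition probe :: com where
  "probe = Cond (Reg 18 +\<^sub>e Reg 19 -\<^sub>e Const 1 <\<^sub>e Reg 5)
     (Compare 20 (Arr 8 (Reg 18 +\<^sub>e Reg 19 -\<^sub>e Const 1)) (Reg 8))
     (Assign 20 (Const 0))"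

text \<open>Steps are doubled while the probes succeed and halved afterwards. The cost is
  logarithmic in the distance from the start to the answer, not in the length of the path.\<close>

definition gallop :: com where
  "gallop =
     ((Assign 18 (Reg 10) ;; Assign 19 (Const 1)) ;; probe) ;;
     Loop (Reg 20) ((Assign 18 (Reg 18 +\<^sub>e Reg 19) ;; Assign 19 (Reg 19 *\<^sub>e Const 2)) ;; probe) ;;
     Loop (Reg 19) (probe ;; (Cond (Reg 20) (Assign 18 (Reg 18 +\<^sub>e Reg 19)) Skip ;;
       Assign 19 (Reg 19 div\<^sub>e Const 2)))"

lemma syntax_probe [simp]:
  "loop_free probe" "sample_free probe" "wregs probe = {20}" "warrs probe = {}"
  by (auto simp: probe_def)

lemma syntax_gallop [simp]:
  "sample_free gallop" "wregs gallop = {18, 19, 20}" "warrs gallop = {}"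
  by (auto simp: gallop_def)

context ram_order
begin

lemma wp_probe:
  assumes a: "regs s 18 = lo" "regs s 19 = d" "1 \<le> d" "lo + d < W" "regs s 5 = l" "l < W" "regs s 8 = z"
    and g: "\<And>k. k < l \<Longrightarrow> (arrs s 8 k, z) \<in> r \<longleftrightarrow> k < g" "g \<le> l" and smp: "sampled s = r"
  shows "wp W probe (\<lambda>s'. (regs s' 20 \<noteq> 0 \<longleftrightarrow> lo + d \<le> g) \<and> time s' = time s + 2) s"
proof (rule wp_run)
  have W: "Suc 0 < W" "lo + d - 1 < W" using a W_ge by - linarith+
  have e: "expr_val W s (Reg 18 +\<^sub>e Reg 19 -\<^sub>e Const 1) = lo + d - 1" using a W by simp
  show "(regs (run W probe s) 20 \<noteq> 0 \<longleftrightarrow> lo + d \<le> g) \<and> time (run W probe s) = time s + 2"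
  proof (cases "lo + d - 1 < l")
    case True
    have "lo + d - 1 < g \<longleftrightarrow> lo + d \<le> g" using a(3) by linarith
    with g(1)[OF True] True a W smp show ?thesis by (simp add: probe_def)
  next
    case False
    then have "\<not> lo + d \<le> g" using g(2) a(3) by linarith
    with False a W show ?thesis by (simp add: probe_def)
  qed
qed simp

lemma wp_gallop:
  assumes a: "regs s 10 = lo" "regs s 5 = l" "l \<le> n" "regs s 8 = z"
    and g: "\<And>k. k < l \<Longrightarrow> (arrs s 8 k, z) \<in> r \<longleftrightarrow> k < g" "g \<le> l" "lo \<le> g" and smp: "sampled s = r"
  shows "wp W gallop (\<lambda>s'. regs s' 18 = g \<and> (\<exists>j. 2 ^ j \<le> g - lo + 1 \<and> time s' \<le> time s + 11 * j + 12)) s"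
proof -
  have bnd: "x + y < W" "x + y + y < W" "y * 2 < W" "y < W" "x < W" if "x \<le> g" "y \<le> 2 * g + 2" for x y
    using that g a W_ge by - linarith+
  have W1: "Suc 0 < W" "2 < W" "l < W" using a W_ge by - linarith+
  let ?F = "\<lambda>s'. regs s' 5 = l \<and> regs s' 8 = z \<and> arrs s' 8 = arrs s 8 \<and> sampled s' = r"
  let ?B = "\<lambda>s' i. regs s' 18 + 1 = lo + 2 ^ i \<and> regs s' 19 = 2 ^ i \<and> regs s' 18 \<le> g"
  define I where "I s' \<longleftrightarrow> ?F s' \<and> (\<exists>i. ?B s' i \<and> (regs s' 20 \<noteq> 0 \<longleftrightarrow> regs s' 18 + 2 ^ i \<le> g)
     \<and> time s' \<le> time s + 4 + 5 * i)" for s' :: state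
  have pb: "wp W probe (\<lambda>s'. I s' \<and> P s') s1"
    if s1: "?F s1" "?B s1 i" "time s1 \<le> time s + 2 + 5 * i"
      "\<And>s'. regs s' 18 = regs s1 18 \<Longrightarrow> regs s' 19 = regs s1 19 \<Longrightarrow> P s'" for s1 i P
  proof -
    have "2 ^ i \<le> 2 * g + 2" using s1(2) by linarith
    note b = bnd[OF _ this, of "regs s1 18"]
    have "wp W probe (\<lambda>s'. (regs s' 20 \<noteq> 0 \<longleftrightarrow> regs s1 18 + 2 ^ i \<le> g) \<and> time s' = time s1 + 2) s1"
      by (rule wp_probe) (use s1(1,2) b W1 g smp in simp_all)
    then show ?thesis
      by (rule wp_frame) (use s1 in \<open>auto simp: I_def intro!: exI[of _ i]\<close>)
  qed
  \<comment> \<open>In the halving phase the answer \<open>g\<close> lies at most two steps beyond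
    register 18, exclusively. The number \<open>i\<close> of doublings is retained because it bounds
    the cost of both phases.\<close>
  define J where "J i s' \<longleftrightarrow> ?F s' \<and> regs s' 18 \<le> g \<and> 2 ^ i \<le> g - lo + 1 \<and>
     ((regs s' 19 = 0 \<and> regs s' 18 = g \<and> time s' \<le> time s + 5 + 5 * i + 6 * i + 6) \<or>
      (\<exists>k\<le>i. regs s' 19 = 2 ^ k \<and> g < regs s' 18 + 2 * 2 ^ k \<and> time s' + 6 * k + 6 \<le> time s + 5 + 5 * i + 6 * i + 6))"
    for i and s' :: state
  show ?thesis unfolding gallop_def
  proof (rule wp_Seq'[where P = I], goal_cases)
    case 1
    show ?case
    proof (rule wp_Seq'[where P = "\<lambda>s1. ?F s1 \<and> ?B s1 0 \<and> time s1 = time s + 2"], goal_cases)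
      case 1
      show ?case by (rule wp_run; use a g smp W1 in simp)
    next
      case (2 s1)
      show ?case by (rule wp_conseq[OF pb[of _ 0 "\<lambda>_. True"]]) (use 2 in auto)
    qed
  next
    case (2 s1)
    show ?case
    proof (rule wp_Seq'[where P = "\<lambda>s'. \<exists>i. J i s'"], goal_cases)
      case 1
      show ?case
      proof (rule wp_Loop[where I = I and m = "\<lambda>s. g - regs s 18"], goal_cases)
        case 1
        show ?case using 2 .
      next
        case (3 s')
        then obtain i where i: "?F s'" "?B s' i" "\<not> regs s' 18 + 2 ^ i \<le> g" "time s' \<le> time s + 4 + 5 * i"
          by (auto simp: I_def)
        then have "2 ^ i \<le> g - lo + 1" by linarith
        moreover have "g < regs s' 18 + 2 * 2 ^ i" using i(3) by linarith
        ultimately have "J i (tick 1 s')" using i unfolding J_def by auto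
        then show ?case by blast
      next
        case (2 s')
        then obtain i where i: "?F s'" "?B s' i" "regs s' 18 + 2 ^ i \<le> g" "time s' \<le> time s + 4 + 5 * i"
          by (auto simp: I_def)
        have "2 ^ i \<le> 2 * g + 2" using i(3) by linarith
        note b = bnd[OF _ this, of "regs s' 18"]
        show ?case
        proof (rule wp_Seq'[where P = "\<lambda>s1. ?F s1 \<and> ?B s1 (Suc i) \<and> regs s1 18 = regs s' 18 + 2 ^ i
            \<and> time s1 = time s' + 3"], goal_cases)
          case 1
          show ?case by (rule wp_run; use i b W1 in simp)
        next
          case (2 s1)
          have "(0::nat) < 2 ^ i" by simp
          then have less: "g - (regs s' 18 + 2 ^ i) < g - regs s' 18" using i(3) by linarith
          show ?case
            by (rule pb[of _ "Suc i"]) (use 2 i less in auto)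
        qed
      qed
    next
      case (2 s1)
      then obtain i where Ji: "J i s1" by blast
      show ?case
      proof (rule wp_Loop[where I = "J i" and m = "\<lambda>s. regs s 19"], goal_cases)
        case 1
        show ?case using Ji .
      next
        case (3 s')
        then show ?case unfolding J_def by (auto intro!: exI[of _ i])
      next
        case (2 s')
        then obtain k where k: "?F s'" "regs s' 18 \<le> g" "k \<le> i" "regs s' 19 = 2 ^ k" "g < regs s' 18 + 2 * 2 ^ k"
          "time s' + 6 * k + 6 \<le> time s + 5 + 5 * i + 6 * i + 6" "2 ^ i \<le> g - lo + 1"
          unfolding J_def by auto
        have "(2::nat) ^ k \<le> 2 ^ i" using k(3) by (intro power_increasing) auto
        then have "2 ^ k \<le> 2 * g + 2" using k(7) by linarith
        note b = bnd[OF k(2) this]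
        show ?case
        proof (rule wp_Seq'[where P = "\<lambda>s1. ?F s1 \<and> regs s1 18 = regs s' 18 \<and> regs s1 19 = 2 ^ k
            \<and> (regs s1 20 \<noteq> 0 \<longleftrightarrow> regs s' 18 + 2 ^ k \<le> g) \<and> time s1 = time s' + 3"], goal_cases)
          case 1
          have "wp W probe (\<lambda>s1. (regs s1 20 \<noteq> 0 \<longleftrightarrow> regs s' 18 + 2 ^ k \<le> g) \<and> time s1 = time (tick 1 s') + 2) (tick 1 s')"
            by (rule wp_probe) (use k b W1 g smp in simp_all)
          then show ?case by (rule wp_frame) (use k in auto)
        next
          case (2 s1)
          define lo' where "lo' = (if regs s' 18 + 2 ^ k \<le> g then regs s' 18 + 2 ^ k else regs s' 18)"
          have lo': "lo' \<le> g" "g < lo' + 2 ^ k" using k(2,5) unfolding lo'_def by auto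
          have J': "J i s2" if "?F s2" "regs s2 18 = lo'" "regs s2 19 = 2 ^ k div 2" "time s2 \<le> time s1 + 3" for s2
          proof (cases k)
            case 0
            then show ?thesis using that 2 lo' k unfolding J_def by simp
          next
            case (Suc k')
            then have "regs s2 19 = 2 ^ k' \<and> k' \<le> i \<and> g < regs s2 18 + 2 * 2 ^ k'
              \<and> time s2 + 6 * k' + 6 \<le> time s + 5 + 5 * i + 6 * i + 6"
              using that 2 lo' k by simp
            then show ?thesis using that lo' k(7) unfolding J_def by blast
          qed
          have "(0::nat) < 2 ^ k" by simp
          then have less: "(2::nat) ^ k div 2 < 2 ^ k" by linarith
          have mods: "2 mod W = 2" "2 ^ k div 2 mod W = 2 ^ k div 2"
            "(regs s' 18 + 2 ^ k) mod W = regs s' 18 + 2 ^ k"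
            using mod_less[OF W1(2)] mod_less[OF order.strict_trans[OF less b(4)]] mod_less[OF b(1)]
            by (simp_all only:)
          have "wp W (Cond (Reg 20) (Assign 18 (Reg 18 +\<^sub>e Reg 19)) Skip ;; Assign 19 (Reg 19 div\<^sub>e Const 2))
            (\<lambda>s2. ?F s2 \<and> regs s2 18 = lo' \<and> regs s2 19 = 2 ^ k div 2 \<and> time s2 \<le> time s1 + 3) s1"
            by (rule wp_run; use 2 in \<open>auto simp: lo'_def mods\<close>)
          then show ?case by (rule wp_conseq) (use J' less k(4) in simp)
        qed
      qed
    qed
  qed
qed

end

text \<open>The link fields of the adjacency lists: the last arc before arc \<open>i\<close> with
  tail \<open>v\<close>. Arc \<open>e\<close> is represented by \<open>Suc e\<close>, so that 0 ends
  a list.\<close>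

primrec last_arc :: "(nat \<Rightarrow> nat) \<Rightarrow> nat \<Rightarrow> nat \<Rightarrow> nat" where
  "last_arc ta v 0 = 0"
| "last_arc ta v (Suc i) = (if ta i = v then Suc i else last_arc ta v i)"

lemma last_arc_le: "last_arc ta v i \<le> i"
  by (induction i) auto

lemma last_arc_none: "last_arc ta v i \<le> e \<Longrightarrow> e < i \<Longrightarrow> ta e \<noteq> v"
  by (induction i) (auto split: if_splits simp: less_Suc_eq)

lemma last_arc_Suc: "last_arc ta v i = Suc e \<Longrightarrow> ta e = v \<and> e < i"
  by (induction i) (auto split: if_splits)

text \<open>The arcs leaving \<open>w\<close> form a linked list, traversed in decreasing order.\<close>

lemma wp_adjacency_loop:
  assumes J: "J D0 s" and p: "regs s 7 = last_arc ta w m"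
    and D0: "\<And>e. e < m \<Longrightarrow> ta e = w \<Longrightarrow> e \<notin> D0"
    and step: "\<And>D e s. J D s \<Longrightarrow> regs s 7 = Suc e \<Longrightarrow> e < m \<Longrightarrow> ta e = w \<Longrightarrow> e \<notin> D \<Longrightarrow>
      wp W body (\<lambda>s'. J (insert e D) s' \<and> regs s' 7 = last_arc ta w e) (tick 1 s)"
  shows "wp W (Loop (Reg 7) body) (\<lambda>s'. \<exists>s0. J (D0 \<union> {e. e < m \<and> ta e = w}) s0 \<and> s' = tick 1 s0) s"
proof -
  \<comment> \<open>When register 7 holds \<open>p\<close>, the next arc is \<open>p - 1\<close>,
    and the arcs of \<open>w\<close> from \<open>p\<close> on have been handled.\<close>
  define Dp where "Dp p = D0 \<union> {e. e < m \<and> ta e = w \<and> p \<le> e}" for p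
  define I where "I s' \<longleftrightarrow> J (Dp (regs s' 7)) s' \<and> (\<exists>i\<le>m. regs s' 7 = last_arc ta w i)" for s'
  show ?thesis
  proof (rule wp_Loop[where I = I and m = "\<lambda>s. regs s 7"], goal_cases)
    case 1
    have "Dp (last_arc ta w m) = D0" using last_arc_none[of ta w m] by (auto simp: Dp_def)
    then show ?case using J p unfolding I_def by auto
  next
    case (3 s')
    then have "J (Dp 0) s'" by (simp add: I_def)
    then show ?case by (auto simp: Dp_def)
  next
    case (2 s')
    then obtain e i where e: "regs s' 7 = Suc e" "i \<le> m" "last_arc ta w i = Suc e"
      unfolding I_def by (cases "regs s' 7") auto
    have te: "ta e = w" "e < m" using last_arc_Suc[OF e(3)] e(2) by auto
    have "e \<notin> Dp (Suc e)" using D0 te by (auto simp: Dp_def)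
    then have st: "wp W body (\<lambda>s'. J (insert e (Dp (Suc e))) s' \<and> regs s' 7 = last_arc ta w e) (tick 1 s')"
      using 2(1) te e(1) by (intro step) (auto simp: I_def)
    have "insert e (Dp (Suc e)) = Dp (last_arc ta w e)"
    proof -
      have "last_arc ta w e \<le> x \<longleftrightarrow> x = e \<or> Suc e \<le> x" if "ta x = w" for x
        using last_arc_none[of ta w e x] last_arc_le[of ta w e] that by (cases x e rule: linorder_cases) auto
      then show ?thesis using te by (auto simp: Dp_def)
    qed
    with st have "wp W body (\<lambda>s'. J (Dp (last_arc ta w e)) s' \<and> regs s' 7 = last_arc ta w e) (tick 1 s')"
      by (simp only:)
    then show ?case
      by (rule wp_conseq) (use te e last_arc_le[of ta w e] in \<open>auto simp: I_def intro!: exI[of _ e]\<close>)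
  qed
qed

section \<open>Splitting off a path\<close>

text \<open>The indegrees are stored twice because Kahn's algorithm consumes them and runs twice:
  array 4 serves the run with the queue, array 5 the run driven by the sampled order.\<close>

definition build :: com where
  "build = Assign 2 (Const 0) ;;
     Loop (Reg 2 <\<^sub>e Reg 1)
       (Store 3 (Reg 2 +\<^sub>e Const 1) (Arr 2 (Arr 0 (Reg 2))) ;;
        Store 2 (Arr 0 (Reg 2)) (Reg 2 +\<^sub>e Const 1) ;;
        Store 4 (Arr 1 (Reg 2)) (Arr 4 (Arr 1 (Reg 2)) +\<^sub>e Const 1) ;;
        Store 5 (Arr 1 (Reg 2)) (Arr 5 (Arr 1 (Reg 2)) +\<^sub>e Const 1) ;;
        Assign 2 (Reg 2 +\<^sub>e Const 1))"

definition init_queue :: com where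
  "init_queue = Assign 2 (Const 0) ;;
     Loop (Reg 2 <\<^sub>e Reg 0)
       (Cond (Arr 4 (Reg 2) =\<^sub>e Const 0) (Store 6 (Reg 3) (Reg 2) ;; Assign 3 (Reg 3 +\<^sub>e Const 1)) Skip ;;
        Assign 2 (Reg 2 +\<^sub>e Const 1))"

definition arc_step :: com where
  "arc_step = Assign 8 (Arr 1 (Reg 7 -\<^sub>e Const 1)) ;;
     Store 4 (Reg 8) (Arr 4 (Reg 8) -\<^sub>e Const 1) ;;
     Cond (Arr 4 (Reg 8) =\<^sub>e Const 0) (Store 6 (Reg 3) (Reg 8) ;; Assign 3 (Reg 3 +\<^sub>e Const 1)) Skip ;;
     Assign 7 (Arr 3 (Reg 7))"

text \<open>The pointers to the start and the end of the queue coincide after the removal exactly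
  when the vertex was alone.\<close>

definition dequeue :: com where
  "dequeue = Assign 6 (Arr 6 (Reg 4)) ;;
     Assign 4 (Reg 4 +\<^sub>e Const 1) ;;
     Cond (Reg 4 =\<^sub>e Reg 3)
       (Store 8 (Reg 5) (Reg 6) ;; Assign 5 (Reg 5 +\<^sub>e Const 1))
       (Store 7 (Reg 6) (Const 1)) ;;
     Assign 7 (Arr 2 (Reg 6))"

definition kahn :: com where
  "kahn = Loop (Reg 4 <\<^sub>e Reg 3)
     (dequeue ;; Loop (Reg 7) arc_step)"

definition split_vertices :: com where
  "split_vertices = build ;; init_queue ;; kahn"

lemma syntax_split_vertices [simp]:
  "sample_free split_vertices" "wregs split_vertices = {2, 3, 4, 5, 6, 7, 8}"
  "warrs split_vertices = {2, 3, 4, 5, 6, 7, 8}"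
  by (auto simp: split_vertices_def build_def init_queue_def kahn_def dequeue_def arc_step_def)

lemma syntax_kahn_parts [simp]:
  "sample_free build" "wregs build = {2}" "warrs build = {2, 3, 4, 5}"
  "sample_free init_queue" "wregs init_queue = {2, 3}" "warrs init_queue = {6}"
  "loop_free arc_step" "loop_free dequeue"
  by (auto simp: dequeue_def build_def init_queue_def arc_step_def)

locale arc_list =
  fixes W n :: nat and xs :: "(nat \<times> nat) list"
  assumes W_n: "8 * n + 16 \<le> W" and W_xs: "length xs + 2 < W"
    and xs_sub: "set xs \<subseteq> {..<n} \<times> {..<n}" and xs_acyclic: "acyclic (set xs)"
begin

sublocale dag_on n "set xs"
  using xs_sub xs_acyclic by unfold_locales

definition m :: nat where "m = length xs"
definition ta :: "nat \<Rightarrow> nat" where "ta e = (if e < length xs then fst (xs ! e) else 0)"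
definition he :: "nat \<Rightarrow> nat" where "he e = (if e < length xs then snd (xs ! e) else 0)"
definition indeg :: "nat set \<Rightarrow> nat \<Rightarrow> nat" where "indeg D v = card {e. e < m \<and> he e = v \<and> e \<notin> D}"

lemma arc_iff: "(u, v) \<in> set xs \<longleftrightarrow> (\<exists>e<m. ta e = u \<and> he e = v)"
  unfolding ta_def he_def m_def in_set_conv_nth by (metis fst_conv prod.collapse snd_conv)

lemma ta_he_less: "e < m \<Longrightarrow> ta e < n" "e < m \<Longrightarrow> he e < n"
  using xs_sub arc_iff by blast+

lemma indeg_le: "indeg D v \<le> m"
proof -
  have "indeg D v \<le> card {..<m}" unfolding indeg_def by (intro card_mono) auto
  then show ?thesis by simp
qed

lemma indeg_0_iff: "indeg D v = 0 \<longleftrightarrow> (\<forall>e<m. he e = v \<longrightarrow> e \<in> D)"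
  unfolding indeg_def by (subst card_0_eq) auto

lemma indeg_insert:
  assumes "e < m" "e \<notin> D"
  shows "indeg (insert e D) = (indeg D)(he e := indeg D (he e) - 1)"
proof
  fix v
  show "indeg (insert e D) v = ((indeg D)(he e := indeg D (he e) - 1)) v"
  proof (cases "v = he e")
    case True
    have "{e'. e' < m \<and> he e' = v \<and> e' \<notin> insert e D} = {e'. e' < m \<and> he e' = v \<and> e' \<notin> D} - {e}" by auto
    then show ?thesis using True assms by (simp add: indeg_def)
  next
    case False
    then have "{e'. e' < m \<and> he e' = v \<and> e' \<notin> insert e D} = {e'. e' < m \<and> he e' = v \<and> e' \<notin> D}" by auto
    then show ?thesis using False by (simp add: indeg_def)
  qed
qed

section \<open>Invariants of Kahn's algorithm with the queue\<close>

definition static :: "state \<Rightarrow> bool" where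
  "static s \<longleftrightarrow> regs s 0 = n \<and> arrs s 1 = he \<and> arrs s 2 = (\<lambda>v. last_arc ta v m)
     \<and> (\<forall>e<m. arrs s 3 (Suc e) = last_arc ta (ta e) e)"

definition cnt :: "nat \<Rightarrow> nat \<Rightarrow> nat" where "cnt k v = card {e. e < k \<and> he e = v}"

lemma cnt_0: "cnt 0 = (\<lambda>_. 0)"
  by (simp add: cnt_def fun_eq_iff)

lemma cnt_Suc: "cnt (Suc k) = (cnt k)(he k := Suc (cnt k (he k)))"
proof
  fix v
  show "cnt (Suc k) v = ((cnt k)(he k := Suc (cnt k (he k)))) v"
  proof (cases "v = he k")
    case True
    have "{e. e < Suc k \<and> he e = v} = insert k {e. e < k \<and> he e = v}" using True by (auto simp: less_Suc_eq)
    then show ?thesis using True by (simp add: cnt_def)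
  next
    case False
    have "{e. e < Suc k \<and> he e = v} = {e. e < k \<and> he e = v}" using False by (auto simp: less_Suc_eq)
    then show ?thesis using False by (simp add: cnt_def)
  qed
qed

lemma cnt_le: "cnt k v \<le> k"
proof -
  have "cnt k v \<le> card {..<k}" unfolding cnt_def by (intro card_mono) auto
  then show ?thesis by simp
qed

lemma wp_build:
  assumes "regs s 0 = n" "regs s 1 = m" "arrs s 0 = ta" "arrs s 1 = he" "arrs s 2 = (\<lambda>_. 0)"
    "arrs s 4 = (\<lambda>_. 0)" "arrs s 5 = (\<lambda>_. 0)" "comparisons s = 0" "time s = 0"
  shows "wp W build (\<lambda>s'. static s' \<and> arrs s' 4 = indeg {} \<and> arrs s' 5 = indeg {}
    \<and> comparisons s' = 0 \<and> time s' \<le> 6 * m + 2) s"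
proof -
  define I where "I s' \<longleftrightarrow> regs s' 0 = n \<and> regs s' 1 = m \<and> arrs s' 0 = ta \<and> arrs s' 1 = he \<and>
    regs s' 2 \<le> m \<and> arrs s' 2 = (\<lambda>v. last_arc ta v (regs s' 2)) \<and>
    (\<forall>e<regs s' 2. arrs s' 3 (Suc e) = last_arc ta (ta e) e) \<and>
    arrs s' 4 = cnt (regs s' 2) \<and> arrs s' 5 = cnt (regs s' 2) \<and>
    comparisons s' = 0 \<and> time s' \<le> 6 * regs s' 2 + 1" for s' :: state
  have W1: "0 < W" "Suc 0 < W" "Suc m < W" using W_n W_xs by (simp_all add: m_def)
  show ?thesis unfolding build_def
  proof (rule wp_Seq'[where P = I], goal_cases)
    case 1
    show ?case by (rule wp_run; use assms in \<open>simp add: I_def cnt_0\<close>)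
  next
    case (2 s1)
    show ?case
    proof (rule wp_Loop[where I = I and m = "\<lambda>s. m - regs s 2"], goal_cases)
      case 1
      show ?case using 2 .
    next
      case (3 s')
      then have "regs s' 2 = m" using W1 by (auto simp: I_def)
      with 3(1) show ?case by (auto simp: I_def static_def cnt_def indeg_def)
    next
      case (2 s')
      define k where "k = regs s' 2"
      have k: "k < m" using 2(2) 2(1) W1 by (auto simp: I_def k_def split: if_splits)
      have I: "regs s' 0 = n" "regs s' 1 = m" "arrs s' 0 = ta" "arrs s' 1 = he" "regs s' 2 = k"
        "arrs s' 2 = (\<lambda>v. last_arc ta v k)" "\<forall>e<k. arrs s' 3 (Suc e) = last_arc ta (ta e) e"
        "arrs s' 4 = cnt k" "arrs s' 5 = cnt k" "comparisons s' = 0" "time s' \<le> 6 * k + 1"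
        using 2(1) by (simp_all add: I_def k_def)
      have mods: "1 mod W = 1" "Suc 0 mod W = Suc 0" "Suc k mod W = Suc k" "Suc (cnt k v) mod W = Suc (cnt k v)" for v
        using W1 k cnt_le[of k v] by simp_all
      have la: "(\<lambda>v. last_arc ta v (Suc k)) = (\<lambda>v. last_arc ta v k)(ta k := Suc k)"
        by (auto simp: fun_eq_iff)
      show ?case
        by (rule wp_run; use I k W1 in \<open>auto simp: I_def mods cnt_Suc la less_Suc_eq\<close>)
    qed
  qed
qed

definition topo :: "nat list \<Rightarrow> bool" where
  "topo \<sigma> \<longleftrightarrow> distinct \<sigma> \<and> set \<sigma> \<subseteq> {..<n} \<and>
     (\<forall>j<length \<sigma>. \<forall>e<m. he e = \<sigma> ! j \<longrightarrow> (\<exists>i<j. ta e = \<sigma> ! i))"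

definition enq :: "nat set \<Rightarrow> nat list \<Rightarrow> bool" where
  "enq D \<sigma> \<longleftrightarrow> (\<forall>v<n. v \<in> set \<sigma> \<longleftrightarrow> (\<forall>e<m. he e = v \<longrightarrow> e \<in> D))"

text \<open>A vertex that was alone in the queue reaches every later one, since all later entries
  descend from it. A vertex that was not alone had its successor in the queue beside it, and a
  vertex enters the queue only after all its incoming arcs have been processed, so there is no arc
  between the two.\<close>

definition flags :: "nat list \<Rightarrow> nat \<Rightarrow> (nat \<Rightarrow> nat) \<Rightarrow> bool" where
  "flags \<sigma> q F \<longleftrightarrow> (\<forall>t<q. F (\<sigma> ! t) = 0 \<longrightarrow> (\<forall>u. t < u \<and> u < length \<sigma> \<longrightarrow> (\<sigma> ! t, \<sigma> ! u) \<in> (set xs)\<^sup>+))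
    \<and> (\<forall>t<q. F (\<sigma> ! t) \<noteq> 0 \<longrightarrow> F (\<sigma> ! t) = 1 \<and> Suc t < length \<sigma> \<and> (\<sigma> ! t, \<sigma> ! Suc t) \<notin> set xs)
    \<and> (\<forall>v. v \<notin> set (take q \<sigma>) \<longrightarrow> F v = 0)"

lemma enqD: "enq D \<sigma> \<Longrightarrow> v < n \<Longrightarrow> v \<in> set \<sigma> \<Longrightarrow> e < m \<Longrightarrow> he e = v \<Longrightarrow> e \<in> D"
  by (simp add: enq_def)

lemma flagsD1:
  assumes "flags \<sigma> q F" "t < q" "F (\<sigma> ! t) = 0" "t < u" "u < length \<sigma>"
  shows "(\<sigma> ! t, \<sigma> ! u) \<in> (set xs)\<^sup>+"
proof -
  have "\<forall>t<q. F (\<sigma> ! t) = 0 \<longrightarrow> (\<forall>u. t < u \<and> u < length \<sigma> \<longrightarrow> (\<sigma> ! t, \<sigma> ! u) \<in> (set xs)\<^sup>+)"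
    using assms(1) unfolding flags_def by (elim conjE)
  then show ?thesis using assms(2-5) by simp
qed

lemma flagsD2:
  assumes "flags \<sigma> q F" "t < q" "F (\<sigma> ! t) \<noteq> 0"
  shows "F (\<sigma> ! t) = 1 \<and> Suc t < length \<sigma> \<and> (\<sigma> ! t, \<sigma> ! Suc t) \<notin> set xs"
proof -
  have "\<forall>t<q. F (\<sigma> ! t) \<noteq> 0 \<longrightarrow> F (\<sigma> ! t) = 1 \<and> Suc t < length \<sigma> \<and> (\<sigma> ! t, \<sigma> ! Suc t) \<notin> set xs"
    using assms(1) unfolding flags_def by (elim conjE)
  then show ?thesis using assms(2,3) by simp
qed

lemma flagsD3: "flags \<sigma> q F \<Longrightarrow> v \<notin> set (take q \<sigma>) \<Longrightarrow> F v = 0"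
  by (simp add: flags_def)

lemma flagsI:
  assumes "\<And>t u. t < q \<Longrightarrow> F (\<sigma> ! t) = 0 \<Longrightarrow> t < u \<Longrightarrow> u < length \<sigma> \<Longrightarrow> (\<sigma> ! t, \<sigma> ! u) \<in> (set xs)\<^sup>+"
    and "\<And>t. t < q \<Longrightarrow> F (\<sigma> ! t) \<noteq> 0 \<Longrightarrow> F (\<sigma> ! t) = 1 \<and> Suc t < length \<sigma> \<and> (\<sigma> ! t, \<sigma> ! Suc t) \<notin> set xs"
    and "\<And>v. v \<notin> set (take q \<sigma>) \<Longrightarrow> F v = 0"
  shows "flags \<sigma> q F"
proof -
  have "\<forall>t<q. F (\<sigma> ! t) = 0 \<longrightarrow> (\<forall>u. t < u \<and> u < length \<sigma> \<longrightarrow> (\<sigma> ! t, \<sigma> ! u) \<in> (set xs)\<^sup>+)"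
    by (intro allI impI; elim conjE; rule assms(1); assumption)
  moreover have "\<forall>t<q. F (\<sigma> ! t) \<noteq> 0 \<longrightarrow> F (\<sigma> ! t) = 1 \<and> Suc t < length \<sigma> \<and> (\<sigma> ! t, \<sigma> ! Suc t) \<notin> set xs"
    by (intro allI impI; rule assms(2); assumption)
  moreover have "\<forall>v. v \<notin> set (take q \<sigma>) \<longrightarrow> F v = 0"
    by (intro allI impI; rule assms(3); assumption)
  ultimately show ?thesis unfolding flags_def by (intro conjI)
qed

text \<open>The list \<sigma> is the whole history of the queue, of which the first \<open>q\<close>
  entries have been removed; \<open>D\<close> is the set of processed arcs.\<close>

definition kinv :: "nat set \<Rightarrow> nat list \<Rightarrow> nat \<Rightarrow> state \<Rightarrow> bool" where
  "kinv D \<sigma> q s \<longleftrightarrow> static s \<and> arrs s 4 = indeg D \<and> arrs s 5 = indeg {} \<and> comparisons s = 0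
     \<and> regs s 3 = length \<sigma> \<and> regs s 4 = q \<and> (\<forall>k<length \<sigma>. arrs s 6 k = \<sigma> ! k)
     \<and> topo \<sigma> \<and> enq D \<sigma> \<and> q \<le> length \<sigma> \<and> (\<forall>e\<in>D. e < m \<and> ta e \<in> set (take q \<sigma>))
     \<and> flags \<sigma> q (arrs s 7)
     \<and> regs s 5 = length (filter (\<lambda>v. arrs s 7 v = 0) (take q \<sigma>))
     \<and> (\<forall>k<regs s 5. arrs s 8 k = filter (\<lambda>v. arrs s 7 v = 0) (take q \<sigma>) ! k)"

lemma topo_length: "topo \<sigma> \<Longrightarrow> length \<sigma> \<le> n"
proof -
  assume "topo \<sigma>"
  then have "card (set \<sigma>) = length \<sigma>" "set \<sigma> \<subseteq> {..<n}" by (simp_all add: topo_def distinct_card)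
  then show ?thesis using card_mono[of "{..<n}" "set \<sigma>"] by simp
qed

lemma wp_init_queue:
  assumes s: "static s" "arrs s 4 = indeg {}" "arrs s 5 = indeg {}" "comparisons s = 0"
    and z: "regs s 3 = 0" "regs s 4 = 0" "regs s 5 = 0" "arrs s 7 = (\<lambda>_. 0)"
  shows "wp W init_queue (\<lambda>s'. (\<exists>\<sigma>. kinv {} \<sigma> 0 s') \<and> time s' \<le> time s + 5 * n + 2) s"
proof -
  define \<tau> where "\<tau> k = filter (\<lambda>v. indeg {} v = 0) [0..<k]" for k
  define I where "I s' \<longleftrightarrow> static s' \<and> arrs s' 4 = indeg {} \<and> arrs s' 5 = indeg {} \<and> comparisons s' = 0
    \<and> regs s' 4 = 0 \<and> regs s' 5 = 0 \<and> arrs s' 7 = (\<lambda>_. 0) \<and> regs s' 2 \<le> n \<and>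
    regs s' 3 = length (\<tau> (regs s' 2)) \<and> (\<forall>k<regs s' 3. arrs s' 6 k = \<tau> (regs s' 2) ! k)
    \<and> time s' \<le> time s + 5 * regs s' 2 + 1" for s' :: state
  have W1: "0 < W" "Suc 0 < W" "Suc n < W" using W_n by simp_all
  show ?thesis unfolding init_queue_def
  proof (rule wp_Seq'[where P = I], goal_cases)
    case 1
    show ?case by (rule wp_run; use s z in \<open>simp add: I_def \<tau>_def static_def\<close>)
  next
    case (2 s1)
    show ?case
    proof (rule wp_Loop[where I = I and m = "\<lambda>s. n - regs s 2"], goal_cases)
      case 1
      show ?case using 2 .
    next
      case (3 s')
      then have n: "regs s' 2 = n" using W1 by (auto simp: I_def static_def)
      have "topo (\<tau> n)" by (auto simp: topo_def \<tau>_def indeg_0_iff dest!: nth_mem)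
      moreover have "enq {} (\<tau> n)" by (auto simp: enq_def \<tau>_def indeg_0_iff)
      ultimately have "kinv {} (\<tau> n) 0 (tick 1 s')"
        using 3(1) n by (auto simp: I_def kinv_def flags_def static_def)
      with 3(1) n show ?case by (auto simp: I_def)
    next
      case (2 s')
      define k where "k = regs s' 2"
      have I: "static s'" "arrs s' 4 = indeg {}" "arrs s' 5 = indeg {}" "comparisons s' = 0"
        "regs s' 4 = 0" "regs s' 5 = 0" "arrs s' 7 = (\<lambda>_. 0)" "regs s' 2 = k" "k \<le> n"
        "regs s' 3 = length (\<tau> k)" "\<forall>l<length (\<tau> k). arrs s' 6 l = \<tau> k ! l" "time s' \<le> time s + 5 * k + 1" "regs s' 0 = n"
        using 2(1) by (simp_all add: I_def k_def static_def)
      have k: "k < n" using 2(2) I(8,9,13) W1 by (auto split: if_splits)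
      have "length (\<tau> k) \<le> k" unfolding \<tau>_def by (metis length_filter_le length_upt minus_nat.diff_0)
      then have mods: "Suc 0 mod W = Suc 0" "Suc k mod W = Suc k" "Suc (length (\<tau> k)) mod W = Suc (length (\<tau> k))"
        using W1 k by simp_all
      have t: "\<tau> (Suc k) = (if indeg {} k = 0 then \<tau> k @ [k] else \<tau> k)" by (simp add: \<tau>_def)
      show ?case
        by (rule wp_run; use I k W1 in \<open>simp add: I_def mods t static_def nth_append\<close>) auto
    qed
  qed
qed

text \<open>A vertex enters the queue through an arc from the last removed vertex, at position
  \<open>q - 1\<close>. Every unflagged earlier vertex is that vertex or reaches it, hence reaches
  the new entry too.\<close>

lemma kinv_arc:
  assumes K: "kinv D \<sigma> q s" and e: "e < m" "e \<notin> D" and q: "0 < q" and w: "ta e = \<sigma> ! (q - 1)"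
  shows "topo (if indeg (insert e D) (he e) = 0 then \<sigma> @ [he e] else \<sigma>)" (is "topo ?\<sigma>")
    and "enq (insert e D) (if indeg (insert e D) (he e) = 0 then \<sigma> @ [he e] else \<sigma>)"
    and "flags (if indeg (insert e D) (he e) = 0 then \<sigma> @ [he e] else \<sigma>) q (arrs s 7)"
proof -
  have K': "topo \<sigma>" "enq D \<sigma>" "q \<le> length \<sigma>" "\<forall>e\<in>D. e < m \<and> ta e \<in> set (take q \<sigma>)" "flags \<sigma> q (arrs s 7)"
    using K by (auto simp: kinv_def)
  have hn: "he e < n" using e ta_he_less by simp
  have new: "he e \<notin> set \<sigma>" using K'(2) hn e by (auto simp: enq_def)
  have w': "ta e \<in> set (take q \<sigma>)" unfolding w using q K'(3)
    by (metis One_nat_def Suc_pred diff_less le_trans length_take lessI min.absorb2 nth_mem nth_take zero_less_one not_less)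
  show "topo ?\<sigma>"
  proof (cases "indeg (insert e D) (he e) = 0")
    case True
    have "\<exists>i<length \<sigma>. ta e' = \<sigma> ! i" if "e' < m" "he e' = he e" for e'
    proof -
      have "e' = e \<or> e' \<in> D" using True that by (auto simp: indeg_0_iff)
      then have "ta e' \<in> set (take q \<sigma>)" using w' K'(4) by auto
      then have "ta e' \<in> set \<sigma>" by (rule in_set_takeD)
      then show ?thesis by (metis in_set_conv_nth)
    qed
    then show ?thesis using True K'(1) new hn unfolding topo_def
      by (auto simp: nth_append less_Suc_eq) (metis order.strict_trans)+
  next
    case False
    with K'(1) show ?thesis by simp
  qed
  show "enq (insert e D) ?\<sigma>"
  proof (cases "indeg (insert e D) (he e) = 0")
    case True
    then show ?thesis using K'(2) by (auto simp: enq_def indeg_0_iff)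
  next
    case False
    then show ?thesis using K'(2) new hn by (auto simp: enq_def indeg_0_iff)
  qed
  show "flags ?\<sigma> q (arrs s 7)"
  proof (cases "indeg (insert e D) (he e) = 0")
    case True
    have *: "(\<sigma> ! t, he e) \<in> (set xs)\<^sup>+" if t: "t < q" "arrs s 7 (\<sigma> ! t) = 0" for t
    proof -
      have arc: "(\<sigma> ! (q - 1), he e) \<in> set xs" using e w arc_iff by blast
      show ?thesis
      proof (cases "t = q - 1")
        case True
        with arc show ?thesis by auto
      next
        case False
        then have "(\<sigma> ! t, \<sigma> ! (q - 1)) \<in> (set xs)\<^sup>+"
          using t K'(3) by (intro flagsD1[OF K'(5)]) auto
        then show ?thesis using arc by (rule trancl_into_trancl)
      qed
    qed
    note fl0 = flagsD1[OF K'(5)] and fl1 = flagsD2[OF K'(5)] and fl2 = flagsD3[OF K'(5)]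
    have nt: "(\<sigma> @ [he e]) ! t = \<sigma> ! t" if "t < length \<sigma>" for t using that by (simp add: nth_append)
    have "flags (\<sigma> @ [he e]) q (arrs s 7)"
    proof (rule flagsI)
      fix t u assume t: "t < q" "arrs s 7 ((\<sigma> @ [he e]) ! t) = 0" "t < u" "u < length (\<sigma> @ [he e])"
      have t': "t < length \<sigma>" using t(1) K'(3) by simp
      show "((\<sigma> @ [he e]) ! t, (\<sigma> @ [he e]) ! u) \<in> (set xs)\<^sup>+"
      proof (cases "u = length \<sigma>")
        case True
        with t * nt[OF t'] show ?thesis by simp
      next
        case False
        then have u: "u < length \<sigma>" using t(4) by simp
        show ?thesis unfolding nt[OF t'] nt[OF u]
          using t(1) t(2)[unfolded nt[OF t']] t(3) u by (rule fl0)
      qed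
    next
      fix t assume t: "t < q" "arrs s 7 ((\<sigma> @ [he e]) ! t) \<noteq> 0"
      have t': "t < length \<sigma>" using t(1) K'(3) by simp
      note f = fl1[OF t(1) t(2)[unfolded nt[OF t']]]
      then have "Suc t < length \<sigma>" by blast
      note nt' = nt[OF t'] nt[OF this]
      show "arrs s 7 ((\<sigma> @ [he e]) ! t) = 1 \<and> Suc t < length (\<sigma> @ [he e]) \<and>
        ((\<sigma> @ [he e]) ! t, (\<sigma> @ [he e]) ! Suc t) \<notin> set xs"
        unfolding nt' using f by simp
    next
      fix v assume "v \<notin> set (take q (\<sigma> @ [he e]))"
      then show "arrs s 7 v = 0" using K'(3) by (intro fl2) simp
    qed
    with True show ?thesis by simp
  next
    case False
    with K'(5) show ?thesis by simp
  qed
qed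

definition split_ok :: "nat set \<Rightarrow> nat list \<Rightarrow> state \<Rightarrow> bool" where
  "split_ok N P s \<longleftrightarrow> static s \<and> N \<subseteq> {..<n} \<and> distinct P \<and> set P = {..<n} - N
     \<and> sorted_wrt (\<lambda>u v. (u, v) \<in> (set xs)\<^sup>+) P \<and> 2 ^ card N \<le> card TO ^ 2 \<and> TO \<noteq> {}
     \<and> arrs s 5 = indeg {} \<and> arrs s 7 = (\<lambda>v. of_bool (v \<in> N))
     \<and> regs s 5 = length P \<and> (\<forall>k<length P. arrs s 8 k = P ! k) \<and> comparisons s = 0"

text \<open>By induction along the arcs every vertex has entered the queue, so \<sigma> is a
  topological order. In it each vertex of \<open>N\<close> is followed by one to which it has no
  arc, as \<open>two_power_card_le\<close> demands.\<close>

lemma kinv_final: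
  assumes K: "kinv {e. e < m \<and> ta e \<in> set \<sigma>} \<sigma> (length \<sigma>) s"
  shows "\<exists>N P. split_ok N P s"
proof -
  let ?F = "arrs s 7"
  have K': "topo \<sigma>" "enq {e. e < m \<and> ta e \<in> set \<sigma>} \<sigma>" "flags \<sigma> (length \<sigma>) ?F"
    using K by (auto simp: kinv_def)
  have dist: "distinct \<sigma>" and sub: "set \<sigma> \<subseteq> {..<n}" using K'(1) by (auto simp: topo_def)
  have wf: "wf (set xs)" using xs_acyclic by (intro finite_acyclic_wf) auto
  have all: "v \<in> set \<sigma>" if "v < n" for v
    using wf that
  proof (induction v rule: wf_induct_rule)
    case (less v)
    have "ta e \<in> set \<sigma>" if "e < m" "he e = v" for e
    proof -
      have "(ta e, v) \<in> set xs" using that arc_iff by blast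
      then show ?thesis using less.IH ta_he_less that by blast
    qed
    then show ?case using K'(2) less.prems unfolding enq_def by blast
  qed
  then have set: "set \<sigma> = {..<n}" using sub by auto
  then have len: "length \<sigma> = n" using dist by (metis card_lessThan distinct_card)
  define N where "N = {v\<in>{..<n}. ?F v \<noteq> 0}"
  define P where "P = filter (\<lambda>v. ?F v = 0) \<sigma>"
  define I where "I = {t. t < n \<and> ?F (\<sigma> ! t) \<noteq> 0}"
  have topo: "i < j" if ij: "i < n" "j < n" "(\<sigma> ! i, \<sigma> ! j) \<in> set xs" for i j
  proof -
    obtain e where e: "e < m" "ta e = \<sigma> ! i" "he e = \<sigma> ! j" using ij arc_iff by blast
    then obtain i' where "i' < j" "ta e = \<sigma> ! i'" using K'(1) ij len unfolding topo_def by blast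
    then have "i' = i" using e dist ij len by (simp add: nth_eq_iff_index_eq)
    with \<open>i' < j\<close> show ?thesis by simp
  qed
  have "bij_betw ((!) \<sigma>) I N"
  proof (rule bij_betw_imageI)
    show "inj_on ((!) \<sigma>) I" using dist len by (auto simp: inj_on_def I_def nth_eq_iff_index_eq)
    have "v \<in> (!) \<sigma> ` I" if v: "v \<in> N" for v
    proof -
      have "v \<in> set \<sigma>" using v set by (auto simp: N_def)
      then obtain t where "t < n" "v = \<sigma> ! t" using len by (metis in_set_conv_nth)
      with v show ?thesis by (auto simp: N_def I_def)
    qed
    moreover have "\<sigma> ! t \<in> N" if "t \<in> I" for t
    proof -
      have "\<sigma> ! t \<in> set \<sigma>" using that len by (auto simp: I_def)
      with that set show ?thesis by (auto simp: N_def I_def)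
    qed
    ultimately show "(!) \<sigma> ` I = N" by blast
  qed
  then have cN: "card I = card N" by (rule bij_betw_same_card)
  have I: "Suc t < n \<and> (\<sigma> ! t, \<sigma> ! Suc t) \<notin> set xs" if "t \<in> I" for t
    using that flagsD2[OF K'(3), of t] len by (simp add: I_def)
  have pow: "2 ^ card N \<le> card TO ^ 2"
    unfolding cN[symmetric] by (rule two_power_card_le[OF len dist set topo I])
  \<comment> \<open>With no swaps at all, the lemma still says that a topological order
    exists.\<close>
  have "2 ^ card ({}::nat set) \<le> card TO"
    by (rule two_power_card_swaps_le[OF len dist set topo]) simp_all
  then have ne: "TO \<noteq> {}" by auto
  have "sorted_wrt (\<lambda>u v. ?F u = 0 \<longrightarrow> (u, v) \<in> (set xs)\<^sup>+) \<sigma>"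
    unfolding sorted_wrt_iff_nth_less using flagsD1[OF K'(3)] by (meson order.strict_trans)
  then have "sorted_wrt (\<lambda>u v. ?F u = 0 \<longrightarrow> (u, v) \<in> (set xs)\<^sup>+) P"
    unfolding P_def by (rule sorted_wrt_filter)
  then have srt: "sorted_wrt (\<lambda>u v. (u, v) \<in> (set xs)\<^sup>+) P"
    by (rule sorted_wrt_mono_rel[rotated]) (auto simp: P_def)
  have F: "?F v = of_bool (v \<in> N)" for v
  proof (cases "v < n")
    case True
    then obtain t where "t < n" "v = \<sigma> ! t" using all len by (metis in_set_conv_nth)
    then show ?thesis using flagsD2[OF K'(3), of t] True len by (cases "?F v = 0") (simp_all add: N_def)
  next
    case False
    then show ?thesis using flagsD3[OF K'(3), of v] set by (simp add: N_def)
  qed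
  have st: "static s" "arrs s 5 = indeg {}" "comparisons s = 0"
    "regs s 5 = length P" "\<forall>k<regs s 5. arrs s 8 k = P ! k"
    using K by (simp_all add: kinv_def P_def)
  have sP: "set P = {..<n} - N" "distinct P" "N \<subseteq> {..<n}"
    unfolding P_def N_def set_filter set using dist by auto
  have "arrs s 7 = (\<lambda>v. of_bool (v \<in> N))" using F by (rule ext)
  then have "split_ok N P s" unfolding split_ok_def
    using st sP srt pow ne by simp
  then show ?thesis by blast
qed

lemma wp_kahn:
  assumes s: "kinv {} \<sigma>0 0 s"
  shows "wp W kahn (\<lambda>s'. (\<exists>N P. split_ok N P s') \<and> time s' \<le> time s + 9 * n + 7 * m + 1) s"
proof -
  have W1: "0 < W" "Suc 0 < W" "Suc n < W" "Suc (Suc n) < W" "m < W" "Suc m < W" using W_n W_xs by (simp_all add: m_def)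
  define DD where "DD q \<sigma> = {e. e < m \<and> ta e \<in> set (take q \<sigma>)}" for q \<sigma>
  have cD: "card D \<le> m" if "D \<subseteq> {..<m}" for D using card_mono[OF _ that] by simp
  define I where "I s' \<longleftrightarrow> (\<exists>\<sigma>. kinv (DD (regs s' 4) \<sigma>) \<sigma> (regs s' 4) s'
    \<and> time s' \<le> time s + 9 * regs s' 4 + 7 * card (DD (regs s' 4) \<sigma>))" for s'
  show ?thesis unfolding kahn_def
  proof (rule wp_Loop[where I = I and m = "\<lambda>s. n - regs s 4"], goal_cases)
    case 1
    have "DD 0 \<sigma>0 = {}" by (simp add: DD_def)
    with s show ?case unfolding I_def by (auto simp: kinv_def intro!: exI[of _ \<sigma>0])
  next
    case (3 s')
    then obtain \<sigma> where K: "kinv (DD (regs s' 4) \<sigma>) \<sigma> (regs s' 4) s'"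
      "time s' \<le> time s + 9 * regs s' 4 + 7 * card (DD (regs s' 4) \<sigma>)" unfolding I_def by blast
    have q: "regs s' 4 = length \<sigma>" using 3(2) K(1) W1 by (auto simp: kinv_def split: if_splits)
    have "length \<sigma> \<le> n" using K(1) by (auto simp: kinv_def intro: topo_length)
    moreover have "card (DD (regs s' 4) \<sigma>) \<le> m" by (rule cD) (auto simp: DD_def)
    moreover have "kinv {e. e < m \<and> ta e \<in> set \<sigma>} \<sigma> (length \<sigma>) (tick 1 s')"
      using K(1) unfolding q DD_def by (simp add: kinv_def static_def)
    then have "\<exists>N P. split_ok N P (tick 1 s')" by (rule kinv_final)
    ultimately show ?case using K(2) q by simp
  next
    case (2 s')
    define q where "q = regs s' 4"
    obtain \<sigma> where K: "kinv (DD q \<sigma>) \<sigma> q s'" "time s' \<le> time s + 9 * q + 7 * card (DD q \<sigma>)"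
      using 2(1) unfolding I_def q_def by blast
    have K': "topo \<sigma>" "enq (DD q \<sigma>) \<sigma>" "flags \<sigma> q (arrs s' 7)" "static s'" "regs s' 3 = length \<sigma>"
      "regs s' 4 = q" "\<forall>k<length \<sigma>. arrs s' 6 k = \<sigma> ! k"
      "regs s' 5 = length (filter (\<lambda>v. arrs s' 7 v = 0) (take q \<sigma>))"
      "\<forall>k<regs s' 5. arrs s' 8 k = filter (\<lambda>v. arrs s' 7 v = 0) (take q \<sigma>) ! k"
      "arrs s' 4 = indeg (DD q \<sigma>)" "arrs s' 5 = indeg {}" "comparisons s' = 0"
      using K(1) by (simp_all add: kinv_def)
    define L where "L = filter (\<lambda>v. arrs s' 7 v = 0) (take q \<sigma>)"
    have L: "regs s' 5 = length L" "\<forall>k<length L. arrs s' 8 k = L ! k" using K'(8,9) by (simp_all add: L_def)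
    have ql: "q < length \<sigma>" using 2(2) K'(5,6) W1 by (auto split: if_splits)
    have ln: "length \<sigma> \<le> n" using K'(1) by (rule topo_length)
    have dist: "distinct \<sigma>" using K'(1) by (simp add: topo_def)
    define w where "w = \<sigma> ! q"
    have wn: "w < n" using K'(1) ql nth_mem unfolding topo_def w_def by blast
    have tk: "take (Suc q) \<sigma> = take q \<sigma> @ [w]" using ql by (simp add: w_def take_Suc_conv_app_nth)
    have wnew: "w \<notin> set (take q \<sigma>)" using dist ql unfolding w_def
      by (metis distinct_take tk w_def distinct_append disjoint_iff list.set_intros(1))
    have Fw: "arrs s' 7 w = 0" using K'(3) wnew by (simp add: flags_def)
    define J where "J D s1 \<longleftrightarrow> (\<exists>\<sigma>'. kinv D \<sigma>' (Suc q) s1 \<and> take (Suc q) \<sigma>' = take (Suc q) \<sigma>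
      \<and> time s1 \<le> time s + 9 * q + 8 + 7 * card D)" for D s1
    show ?case
    proof (rule wp_Seq'[where P = "\<lambda>s1. J (DD q \<sigma>) s1 \<and> regs s1 7 = last_arc ta w m"], goal_cases)
      case 1
      have "length L \<le> n"
        using length_filter_le[of "\<lambda>v. arrs s' 7 v = 0" "take q \<sigma>"] ql ln by (simp add: L_def)
      then have mods: "Suc 0 mod W = Suc 0" "1 mod W = 1" "Suc q mod W = Suc q" "Suc (length L) mod W = Suc (length L)"
        using W1 ql ln by simp_all
      have sw: "arrs s' 6 q = w" using K'(7) ql by (simp add: w_def)
      have st: "static s3" if "regs s3 0 = regs s' 0" "arrs s3 1 = arrs s' 1" "arrs s3 2 = arrs s' 2" "arrs s3 3 = arrs s' 3" for s3
        using that K'(4) by (simp add: static_def)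
      have a2: "arrs s' 2 w = last_arc ta w m" using K'(4) by (simp add: static_def)
      have Dq: "\<forall>e\<in>DD q \<sigma>. e < m \<and> ta e \<in> set (take (Suc q) \<sigma>)" by (auto simp: DD_def tk)
      let ?s = "run W dequeue (tick 1 s')"
      show ?case
      proof (cases "Suc q = length \<sigma>")
        case True
        have fl: "flags \<sigma> (Suc q) (arrs s' 7)"
        proof (rule flagsI)
          fix t u assume t: "t < Suc q" "arrs s' 7 (\<sigma> ! t) = 0" "t < u" "u < length \<sigma>"
          then have "t < q" using True by linarith
          then show "(\<sigma> ! t, \<sigma> ! u) \<in> (set xs)\<^sup>+" using t(2-4) by (rule flagsD1[OF K'(3)])
        next
          fix t assume t: "t < Suc q" "arrs s' 7 (\<sigma> ! t) \<noteq> 0"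
          then have "t \<noteq> q" using Fw by (auto simp: w_def)
          then have "t < q" using t(1) by linarith
          then show "arrs s' 7 (\<sigma> ! t) = 1 \<and> Suc t < length \<sigma> \<and> (\<sigma> ! t, \<sigma> ! Suc t) \<notin> set xs"
            using t(2) by (rule flagsD2[OF K'(3)])
        next
          fix v assume "v \<notin> set (take (Suc q) \<sigma>)"
          then show "arrs s' 7 v = 0" using tk by (intro flagsD3[OF K'(3)]) simp
        qed
        have fil: "filter (\<lambda>v. arrs s' 7 v = 0) (take (Suc q) \<sigma>) = L @ [w]" using Fw by (simp add: tk L_def)
        have r: "static ?s" "arrs ?s 4 = indeg (DD q \<sigma>)" "arrs ?s 5 = indeg {}" "comparisons ?s = 0"
          "regs ?s 3 = length \<sigma>" "regs ?s 4 = Suc q" "arrs ?s 6 = arrs s' 6" "arrs ?s 7 = arrs s' 7"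
          "regs ?s 5 = Suc (length L)" "arrs ?s 8 = (arrs s' 8)(length L := w)"
          "regs ?s 7 = last_arc ta w m" "time ?s \<le> time s' + 7"
          using K'(5,6,10-12) L(1) True[symmetric] sw a2 W1
          by (simp_all add: dequeue_def mods st)
        have "\<forall>k<Suc (length L). ((arrs s' 8)(length L := w)) k = (L @ [w]) ! k"
          using L(2) by (simp add: nth_append less_Suc_eq)
        then have "kinv (DD q \<sigma>) \<sigma> (Suc q) ?s"
          unfolding kinv_def r fil using K'(1,2,7) r(1) fl ql Dq by simp
        then have "J (DD q \<sigma>) ?s" using r(12) K(2) unfolding J_def by (intro exI[of _ \<sigma>]) simp
        with r(11) show ?thesis by (intro wp_run) simp_all
      next
        case False
        define F where "F = (arrs s' 7)(w := 1)"
        \<comment> \<open>The next vertex was in the queue before \<open>w\<close> was removed, so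
          all its incoming arcs leave vertices removed before \<open>w\<close>.\<close>
        have narc: "(w, \<sigma> ! Suc q) \<notin> set xs"
        proof
          assume "(w, \<sigma> ! Suc q) \<in> set xs"
          then obtain e where e: "e < m" "ta e = w" "he e = \<sigma> ! Suc q" using arc_iff by blast
          have "\<sigma> ! Suc q \<in> set \<sigma>" using False ql by simp
          moreover have "\<sigma> ! Suc q < n" using ta_he_less(2)[OF e(1)] e(3) by simp
          ultimately have "e \<in> DD q \<sigma>" using enqD[OF K'(2) _ _ e(1,3)] by blast
          then show False using e wnew by (simp add: DD_def)
        qed
        have ne: "\<sigma> ! t \<noteq> w" if "t < q" for t
          using that dist ql by (simp add: w_def nth_eq_iff_index_eq)
        have fl: "flags \<sigma> (Suc q) F"
        proof (rule flagsI)
          fix t u assume t: "t < Suc q" "F (\<sigma> ! t) = 0" "t < u" "u < length \<sigma>"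
          then have "t \<noteq> q" by (auto simp: F_def w_def)
          then have tq: "t < q" using t(1) by linarith
          then have "arrs s' 7 (\<sigma> ! t) = 0" using t(2) ne by (simp add: F_def)
          from flagsD1[OF K'(3) tq this t(3,4)] show "(\<sigma> ! t, \<sigma> ! u) \<in> (set xs)\<^sup>+" .
        next
          fix t assume t: "t < Suc q" "F (\<sigma> ! t) \<noteq> 0"
          show "F (\<sigma> ! t) = 1 \<and> Suc t < length \<sigma> \<and> (\<sigma> ! t, \<sigma> ! Suc t) \<notin> set xs"
          proof (cases "t = q")
            case True
            then show ?thesis using narc False ql by (simp add: F_def w_def)
          next
            case False
            then have "t < q" using t by simp
            with t flagsD2[OF K'(3), of t] ne[of t] show ?thesis by (simp add: F_def)
          qed
        next
          fix v assume v: "v \<notin> set (take (Suc q) \<sigma>)"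
          then have "arrs s' 7 v = 0" using tk by (intro flagsD3[OF K'(3)]) simp
          with v tk show "F v = 0" by (simp add: F_def)
        qed
        have "filter (\<lambda>v. F v = 0) (take q \<sigma>) = L"
          unfolding L_def using wnew by (intro filter_cong) (auto simp: F_def)
        then have fil: "filter (\<lambda>v. F v = 0) (take (Suc q) \<sigma>) = L" by (simp add: tk F_def)
        have r: "static ?s" "arrs ?s 4 = indeg (DD q \<sigma>)" "arrs ?s 5 = indeg {}" "comparisons ?s = 0"
          "regs ?s 3 = length \<sigma>" "regs ?s 4 = Suc q" "arrs ?s 6 = arrs s' 6" "arrs ?s 7 = F"
          "regs ?s 5 = length L" "arrs ?s 8 = arrs s' 8"
          "regs ?s 7 = last_arc ta w m" "time ?s \<le> time s' + 7"
          using K'(5,6,10-12) L(1) False sw a2 W1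
          by (simp_all add: dequeue_def mods st F_def)
        have "kinv (DD q \<sigma>) \<sigma> (Suc q) ?s"
          unfolding kinv_def r fil using K'(1,2,7) r(1) fl ql Dq L(2) by simp
        then have "J (DD q \<sigma>) ?s" using r(12) K(2) unfolding J_def by (intro exI[of _ \<sigma>]) simp
        with r(11) show ?thesis by (intro wp_run) simp_all
      qed
    next
      case (2 s1)
      have "wp W (Loop (Reg 7) arc_step) (\<lambda>s'. \<exists>s0. J (DD q \<sigma> \<union> {e. e < m \<and> ta e = w}) s0 \<and> s' = tick 1 s0) s1"
      proof (rule wp_adjacency_loop)
        show "J (DD q \<sigma>) s1" "regs s1 7 = last_arc ta w m" using 2 by simp_all
        show "e \<notin> DD q \<sigma>" if "e < m" "ta e = w" for e using that wnew by (simp add: DD_def)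
        fix D e s2
        assume s2: "J D s2" "regs s2 7 = Suc e" "e < m" "ta e = w" "e \<notin> D"
        then obtain \<sigma>' where L: "kinv D \<sigma>' (Suc q) s2" "take (Suc q) \<sigma>' = take (Suc q) \<sigma>"
          "time s2 \<le> time s + 9 * q + 8 + 7 * card D" unfolding J_def by blast
        have lq: "Suc q \<le> length \<sigma>'" "topo \<sigma>'" "D \<subseteq> {..<m}" using L(1) by (auto simp: kinv_def)
        have w: "ta e = \<sigma>' ! (Suc q - 1)"
        proof -
          have "\<sigma>' ! q = take (Suc q) \<sigma>' ! q" by simp
          also have "\<dots> = w" unfolding L(2) by (simp add: w_def)
          finally show ?thesis using s2(4) by simp
        qed
        note step = kinv_arc[OF L(1) s2(3,5) _ w]
        define \<sigma>'' where "\<sigma>'' = (if indeg (insert e D) (he e) = 0 then \<sigma>' @ [he e] else \<sigma>')"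
        have st: "topo \<sigma>''" "enq (insert e D) \<sigma>''" "flags \<sigma>'' (Suc q) (arrs s2 7)"
          using step unfolding \<sigma>''_def by simp_all
        have tk'': "take (Suc q) \<sigma>'' = take (Suc q) \<sigma>'" using lq by (simp add: \<sigma>''_def)
        have fin: "finite D" using lq(3) finite_subset by blast
        have Dm: "\<forall>e'\<in>insert e D. e' < m \<and> ta e' \<in> set (take (Suc q) \<sigma>')"
        proof -
          have "\<forall>e'\<in>D. e' < m \<and> ta e' \<in> set (take (Suc q) \<sigma>')"
            using L(1) unfolding kinv_def by (elim conjE)
          then show ?thesis using s2(3,4) unfolding L(2) tk by simp
        qed
        have L': "static s2" "arrs s2 4 = indeg D" "arrs s2 5 = indeg {}" "comparisons s2 = 0"
          "regs s2 3 = length \<sigma>'" "regs s2 4 = Suc q" "\<forall>k<length \<sigma>'. arrs s2 6 k = \<sigma>' ! k"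
          "regs s2 5 = length (filter (\<lambda>v. arrs s2 7 v = 0) (take (Suc q) \<sigma>'))"
          "\<forall>k<regs s2 5. arrs s2 8 k = filter (\<lambda>v. arrs s2 7 v = 0) (take (Suc q) \<sigma>') ! k"
          using L(1) by (simp_all add: kinv_def)
        have ind: "indeg (insert e D) = (indeg D)(he e := indeg D (he e) - 1)" using s2 by (intro indeg_insert)
        have ll: "length \<sigma>' \<le> n" using lq by (intro topo_length)
        have mods: "Suc 0 mod W = Suc 0" "1 mod W = 1" "e mod W = e" "(indeg D (he e) - 1) mod W = indeg D (he e) - 1"
          "(indeg D (he e) - Suc 0) mod W = indeg D (he e) - Suc 0"
          "Suc (length \<sigma>') mod W = Suc (length \<sigma>')"
          using W1 s2(3) indeg_le[of D "he e"] ll by simp_all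
        have ex: "kinv (insert e D) \<sigma>'' (Suc q) s3"
          if "static s3" "arrs s3 4 = indeg (insert e D)" "arrs s3 5 = indeg {}" "comparisons s3 = 0"
            "regs s3 3 = length \<sigma>''" "regs s3 4 = Suc q" "\<forall>k<length \<sigma>''. arrs s3 6 k = \<sigma>'' ! k"
            "arrs s3 7 = arrs s2 7" "arrs s3 8 = arrs s2 8" "regs s3 5 = regs s2 5" for s3
          using that st lq Dm L'(8,9) unfolding kinv_def tk'' by (simp add: \<sigma>''_def)
        show "wp W arc_step (\<lambda>s'. J (insert e D) s' \<and> regs s' 7 = last_arc ta w e) (tick 1 s2)"
        proof (rule wp_run)
          let ?s = "run W arc_step (tick 1 s2)"
          have d: "indeg (insert e D) (he e) = indeg D (he e) - 1" by (simp add: ind)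
          have S: "arrs s2 1 = he" "arrs s2 3 (Suc e) = last_arc ta w e"
            using L'(1) s2(3,4) by (simp_all add: static_def)
          have st: "static s3" if "regs s3 0 = regs s2 0" "arrs s3 1 = arrs s2 1" "arrs s3 2 = arrs s2 2" "arrs s3 3 = arrs s2 3" for s3
            using that L'(1) by (simp add: static_def)
          have a: "static ?s" "arrs ?s 4 = indeg (insert e D)" "arrs ?s 5 = indeg {}" "comparisons ?s = 0"
            "regs ?s 3 = length \<sigma>''" "regs ?s 4 = Suc q" "\<forall>k<length \<sigma>''. arrs ?s 6 k = \<sigma>'' ! k"
            "arrs ?s 7 = arrs s2 7" "arrs ?s 8 = arrs s2 8" "regs ?s 5 = regs s2 5"
            "regs ?s 7 = last_arc ta w e" "time ?s \<le> time s2 + 7"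
          proof -
            have b: "static ?s" "arrs ?s 4 = indeg (insert e D)" "arrs ?s 5 = indeg {}" "comparisons ?s = 0"
              "regs ?s 4 = Suc q" "arrs ?s 7 = arrs s2 7" "arrs ?s 8 = arrs s2 8" "regs ?s 5 = regs s2 5"
              "regs ?s 7 = last_arc ta w e" "time ?s \<le> time s2 + 7"
              using L'(2-6) s2(2) S W1 unfolding ind
              by (cases "indeg D (he e) - 1 = 0"; simp add: arc_step_def mods st)+
            have c: "regs ?s 3 = length \<sigma>'' \<and> (\<forall>k<length \<sigma>''. arrs ?s 6 k = \<sigma>'' ! k)"
            proof (cases "indeg D (he e) - 1 = 0")
              case True
              then have e: "\<sigma>'' = \<sigma>' @ [he e]" by (simp add: \<sigma>''_def d)
              have "regs ?s 3 = Suc (length \<sigma>')" "arrs ?s 6 = (arrs s2 6)(length \<sigma>' := he e)"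
                using True L'(2-6) s2(2) S W1 by (simp_all add: arc_step_def mods)
              then show ?thesis using L'(7) unfolding e by (simp add: nth_append less_Suc_eq)
            next
              case False
              then have e: "\<sigma>'' = \<sigma>'" by (simp add: \<sigma>''_def d)
              have "regs ?s 3 = length \<sigma>'" "arrs ?s 6 = arrs s2 6"
                using False L'(2-6) s2(2) S W1 by (simp_all add: arc_step_def mods)
              then show ?thesis using L'(7) unfolding e by simp
            qed
            show "static ?s" "arrs ?s 4 = indeg (insert e D)" "arrs ?s 5 = indeg {}" "comparisons ?s = 0"
              "regs ?s 3 = length \<sigma>''" "regs ?s 4 = Suc q" "\<forall>k<length \<sigma>''. arrs ?s 6 k = \<sigma>'' ! k"
              "arrs ?s 7 = arrs s2 7" "arrs ?s 8 = arrs s2 8" "regs ?s 5 = regs s2 5"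
              "regs ?s 7 = last_arc ta w e" "time ?s \<le> time s2 + 7"
              by (fact b c[THEN conjunct1] c[THEN conjunct2])+
          qed
          have "kinv (insert e D) \<sigma>'' (Suc q) ?s" by (rule ex) (fact a)+
          moreover have "take (Suc q) \<sigma>'' = take (Suc q) \<sigma>" using tk'' L(2) by simp
          moreover have "time ?s \<le> time s + 9 * q + 8 + 7 * card (insert e D)"
            using a(12) L(3) s2(5) fin by simp
          ultimately show "J (insert e D) ?s \<and> regs ?s 7 = last_arc ta w e"
            unfolding J_def using a(11) by blast
        qed (simp add: arc_step_def)
      qed
      then show ?case
      proof (rule wp_conseq)
        fix s3 assume "\<exists>s0. J (DD q \<sigma> \<union> {e. e < m \<and> ta e = w}) s0 \<and> s3 = tick 1 s0"
        then obtain s0 \<sigma>' where s0: "kinv (DD q \<sigma> \<union> {e. e < m \<and> ta e = w}) \<sigma>' (Suc q) s0"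
          "take (Suc q) \<sigma>' = take (Suc q) \<sigma>"
          "time s0 \<le> time s + 9 * q + 8 + 7 * card (DD q \<sigma> \<union> {e. e < m \<and> ta e = w})" "s3 = tick 1 s0"
          unfolding J_def by blast
        have D: "DD q \<sigma> \<union> {e. e < m \<and> ta e = w} = DD (Suc q) \<sigma>'"
          unfolding DD_def s0(2) tk by auto
        have "kinv (DD (Suc q) \<sigma>') \<sigma>' (Suc q) s3" using s0(1,4) unfolding D by (simp add: kinv_def static_def)
        moreover from this have "regs s3 4 = Suc q" by (simp add: kinv_def)
        ultimately show "I s3 \<and> n - regs s3 4 < n - regs s' 4"
          using s0(3,4) ql ln unfolding I_def D K'(6) by auto
      qed
    qed
  qed
qed

lemma wp_split_vertices:
  assumes "regs s = (\<lambda>_. 0)(0 := n, 1 := m)" "arrs s = (\<lambda>_ _. 0)(0 := ta, 1 := he)"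
    "comparisons s = 0" "time s = 0"
  shows "wp W split_vertices (\<lambda>s'. (\<exists>N P. split_ok N P s') \<and> time s' \<le> 14 * n + 13 * m + 5) s"
  unfolding split_vertices_def
proof (rule wp_Seq'[where P = "\<lambda>s'. static s' \<and> arrs s' 4 = indeg {} \<and> arrs s' 5 = indeg {}
    \<and> comparisons s' = 0 \<and> time s' \<le> 6 * m + 2 \<and> regs s' 3 = 0 \<and> regs s' 4 = 0 \<and> regs s' 5 = 0
    \<and> arrs s' 7 = (\<lambda>_. 0)"], goal_cases)
  case 1
  have "wp W build (\<lambda>s'. static s' \<and> arrs s' 4 = indeg {} \<and> arrs s' 5 = indeg {}
    \<and> comparisons s' = 0 \<and> time s' \<le> 6 * m + 2) s"
    by (rule wp_build) (use assms in simp_all)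
  then show ?case by (rule wp_frame) (use assms in auto)
next
  case (2 s1)
  show ?case
  proof (rule wp_Seq'[OF wp_init_queue], goal_cases)
    case (9 s2)
    then obtain \<sigma> where "kinv {} \<sigma> 0 s2" by blast
    from wp_kahn[OF this] show ?case by (rule wp_conseq) (use 2 9 in auto)
  qed (use 2 in simp_all)
qed

end

section \<open>Sorting the sampled order\<close>

text \<open>Path vertices never enter the heap: their order is known. For a vertex of
  \<open>N\<close>, register 14 holds the removal time of its last predecessor, and the search
  starts at the number of path vertices already removed.\<close>

definition release :: com where
  "release = Cond (Arr 7 (Reg 8))
     (Store 9 (Reg 8) (Reg 14) ;; gallop ;; Store 10 (Reg 8) (Reg 18) ;; push) Skip"

definition init_sources :: com where
  "init_sources = Assign 2 (Const 0) ;;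
     Loop (Reg 2 <\<^sub>e Reg 0)
       (Cond (Arr 5 (Reg 2) =\<^sub>e Const 0) (Assign 8 (Reg 2) ;; release) Skip ;;
        Assign 2 (Reg 2 +\<^sub>e Const 1))"

text \<open>Removals and releases so far, plus one for the present removal, give
  \<open>btime\<close>. The difference from the stored \<open>atime\<close> is the stay, whose bits
  the final loop counts.\<close>

definition remove_min :: com where
  "remove_min = Assign 6 (Reg 16 -\<^sub>e Const 1) ;; pop ;;
     (Assign 27 (Reg 15 +\<^sub>e Reg 11 +\<^sub>e Const 1 -\<^sub>e Arr 9 (Reg 6)) ;; Assign 13 (Reg 13 +\<^sub>e Const 1)) ;;
     Loop (Reg 27) (Assign 27 (Reg 27 div\<^sub>e Const 2) ;; Assign 13 (Reg 13 +\<^sub>e Const 1))"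

definition next_path :: com where
  "next_path = Assign 6 (Arr 8 (Reg 10)) ;; Assign 10 (Reg 10 +\<^sub>e Const 1)"

text \<open>The choice between heap and path uses no comparison: the heap minimum is next exactly
  when the number of path vertices before it, found at its release, equals the number of those
  already removed.\<close>

definition remove :: com where
  "remove = Assign 16 (Arr 13 (Const 0)) ;;
     Cond ((Const 0 <\<^sub>e Reg 16) *\<^sub>e (Arr 10 (Reg 16 -\<^sub>e Const 1) =\<^sub>e Reg 10)) remove_min next_path ;;
     (Assign 14 (Reg 15 +\<^sub>e Reg 11 +\<^sub>e Const 1) ;; Assign 15 (Reg 15 +\<^sub>e Const 1) ;; Assign 7 (Arr 2 (Reg 6)))"

definition release_step :: com where
  "release_step =
     (Assign 8 (Arr 1 (Reg 7 -\<^sub>e Const 1)) ;; Store 5 (Reg 8) (Arr 5 (Reg 8) -\<^sub>e Const 1)) ;;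
     Cond (Arr 5 (Reg 8) =\<^sub>e Const 0) release Skip ;;
     Assign 7 (Arr 3 (Reg 7))"

definition simulate :: com where
  "simulate = init_sources ;; Loop (Reg 15 <\<^sub>e Reg 0) (remove ;; Loop (Reg 7) release_step) ;;
     Assign 0 (Reg 13)"

lemma loop_free_next_path [simp]: "loop_free next_path"
  by (simp add: next_path_def)

lemma syntax_release [simp]:
  "sample_free release" "wregs release = {11, 18, 19, 20, 21, 22, 23, 24, 25}"
  "warrs release = {9, 10, 11, 12, 13}"
  by (auto simp: release_def)

lemma syntax_init_sources [simp]:
  "sample_free init_sources" "wregs init_sources = {2, 8, 11, 18, 19, 20, 21, 22, 23, 24, 25}"
  "warrs init_sources = {9, 10, 11, 12, 13}"
  by (auto simp: init_sources_def)

lemma syntax_remove_min [simp]: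
  "sample_free remove_min" "wregs remove_min = {6, 13, 20, 21, 22, 23, 24, 25, 27}" "warrs remove_min = {12, 13}"
  by (auto simp: remove_min_def)

lemma halving_sum_1 [simp]: "halving_sum (Suc 0) = 0"
  by (simp add: halving_sum_pos)

lemma downward_closed_eq_lessThan:
  fixes D :: "nat set"
  assumes "finite D" "\<And>x y. x \<in> D \<Longrightarrow> y < x \<Longrightarrow> y \<in> D"
  shows "D = {..<card D}"
proof -
  have "\<exists>x. x \<notin> D" using assms(1) by (rule ex_new_if_finite[OF infinite_UNIV_nat])
  then obtain g where g: "g \<notin> D" "\<And>y. y < g \<Longrightarrow> y \<in> D" using exists_least_iff[of "\<lambda>x. x \<notin> D"] by auto
  have "D = {..<g}"
  proof
    show "{..<g} \<subseteq> D" using g(2) by auto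
    show "D \<subseteq> {..<g}"
    proof
      fix x assume "x \<in> D"
      then have "\<not> g < x" "x \<noteq> g" using assms(2) g(1) by blast+
      then show "x \<in> {..<g}" by simp
    qed
  qed
  then show ?thesis by simp
qed

locale simulation = arc_list +
  fixes N :: "nat set" and P :: "nat list" and r :: "nat rel"
  assumes N_n: "N \<subseteq> {..<n}" and P_dist: "distinct P" and P_set: "set P = {..<n} - N"
    and P_sorted: "sorted_wrt (\<lambda>u v. (u, v) \<in> (set xs)\<^sup>+) P"
    and r: "r \<in> TO" and W_val: "n * (2 * n + 3) < W"
begin

sublocale dag_split n "set xs" N
  using N_n by unfold_locales

sublocale ram_order W n r
  using W_n r_total[OF r] r_trans[OF r] by unfold_locales auto

section \<open>The path relative to the sampled order\<close>

definition gap :: "nat \<Rightarrow> nat" where "gap v = card {u. u \<notin> N \<and> (u, v) \<in> r}"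
definition removed_path :: "nat \<Rightarrow> nat" where "removed_path i = card {u. u < n \<and> u \<notin> N \<and> pos r u < i}"
definition Y :: "nat \<Rightarrow> nat" where "Y v = Suc (blen (stay r v))"

lemma P_sorted_r: "i < j \<Longrightarrow> j < length P \<Longrightarrow> (P ! i, P ! j) \<in> r"
  using P_sorted r_trancl[OF r] unfolding sorted_wrt_iff_nth_less by blast

lemma length_P: "length P \<le> n"
proof -
  have "length P = card (set P)" using P_dist by (simp add: distinct_card)
  also have "\<dots> \<le> card {..<n}" unfolding P_set by (intro card_mono) auto
  finally show ?thesis by simp
qed

text \<open>The path is a chain in every topological order, so its vertices before \<open>v\<close>
  form an initial segment. This monotonicity makes \<open>gap v\<close> the result of the galloping
  search.\<close>

lemma P_before_iff:
  assumes "k < length P"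
  shows "(P ! k, v) \<in> r \<longleftrightarrow> k < gap v"
proof -
  define K where "K = {k. k < length P \<and> (P ! k, v) \<in> r}"
  have "K = {..<card K}"
  proof (rule downward_closed_eq_lessThan)
    fix x y assume "x \<in> K" "y < x"
    then show "y \<in> K" using P_sorted_r[of y x] r_trans[OF r] by (auto simp: K_def)
  qed (simp add: K_def)
  moreover have "card K = gap v"
  proof -
    have "bij_betw ((!) P) K {u. u \<notin> N \<and> (u, v) \<in> r}"
    proof (rule bij_betw_imageI)
      show "inj_on ((!) P) K" using P_dist by (auto simp: inj_on_def K_def nth_eq_iff_index_eq)
      show "(!) P ` K = {u. u \<notin> N \<and> (u, v) \<in> r}"
      proof (intro equalityI subsetI)
        fix u assume "u \<in> (!) P ` K"
        then show "u \<in> {u. u \<notin> N \<and> (u, v) \<in> r}" using P_set nth_mem unfolding K_def by blast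
      next
        fix u assume u: "u \<in> {u. u \<notin> N \<and> (u, v) \<in> r}"
        then have "u \<in> set P" using r_sub[OF r, of u v] by (simp add: P_set)
        then obtain k where "k < length P" "u = P ! k" by (auto simp: in_set_conv_nth)
        then show "u \<in> (!) P ` K" using u by (auto simp: K_def)
      qed
    qed
    then show ?thesis unfolding gap_def by (rule bij_betw_same_card)
  qed
  ultimately have "k \<in> K \<longleftrightarrow> k < gap v" by auto
  then show ?thesis using assms by (simp add: K_def)
qed

lemma gap_le: "gap v \<le> length P"
proof -
  have "gap v \<le> card (set P)" unfolding gap_def
    by (intro card_mono) (use r_sub[OF r] in \<open>auto simp: P_set\<close>)
  then show ?thesis using P_dist by (simp add: distinct_card)
qed

lemma P_gap: "k < length P \<Longrightarrow> gap (P ! k) = k"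
proof -
  assume k: "k < length P"
  have "\<not> k < gap (P ! k)" using P_before_iff[OF k, of "P ! k"] r_irrefl[OF r] by simp
  moreover have "j < gap (P ! k)" if "j < k" for j
    using P_before_iff[of j "P ! k"] P_sorted_r[OF that k] that k by simp
  ultimately have "\<not> gap (P ! k) < k" "\<not> k < gap (P ! k)" by blast+
  then show ?thesis by linarith
qed

lemma gap_eq_removed_path: "v < n \<Longrightarrow> gap v = removed_path (pos r v)"
  unfolding gap_def removed_path_def
  by (rule arg_cong[where f = card]) (use pos_less_iff[OF r] r_sub[OF r] in blast)

lemma removed_path_mono: "i \<le> j \<Longrightarrow> removed_path i \<le> removed_path j"
  unfolding removed_path_def by (intro card_mono) auto

lemma removed_path_le: "i \<le> j \<Longrightarrow> removed_path j \<le> removed_path i + (j - i)"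
proof -
  assume ij: "i \<le> j"
  have fin: "finite {u. u < n \<and> i \<le> pos r u \<and> pos r u < j}" by simp
  have "card {u. u < n \<and> i \<le> pos r u \<and> pos r u < j} \<le> card {i..<j}"
  proof (rule card_inj_on_le[where f = "pos r"])
    show "inj_on (pos r) {u. u < n \<and> i \<le> pos r u \<and> pos r u < j}"
      using pos_inj[OF r] by (auto simp: inj_on_def)
  qed auto
  moreover have "removed_path j \<le> card ({u. u < n \<and> u \<notin> N \<and> pos r u < i} \<union> {u. u < n \<and> i \<le> pos r u \<and> pos r u < j})"
    unfolding removed_path_def by (intro card_mono) auto
  moreover have "\<dots> \<le> removed_path i + card {u. u < n \<and> i \<le> pos r u \<and> pos r u < j}"
    unfolding removed_path_def by (rule card_Un_le)
  ultimately show ?thesis by simp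
qed

lemma Y_le: "v < n \<Longrightarrow> Y v \<le> 2 * n + 1"
proof -
  assume v: "v < n"
  have "blen (stay r v) \<le> stay r v" by (rule blen_le)
  also have "\<dots> \<le> btime r v" by (simp add: stay_def)
  also have "\<dots> \<le> n + card N" using btime_le[OF r v] .
  also have "\<dots> \<le> n + n" using card_mono[OF _ N_n] by simp
  finally show ?thesis by (simp add: Y_def)
qed

lemma sum_Y_less: "A \<subseteq> N \<Longrightarrow> (\<Sum>v\<in>A. Y v) < W"
proof -
  assume A: "A \<subseteq> N"
  have "(\<Sum>v\<in>A. Y v) \<le> (\<Sum>v\<in>A. 2 * n + 1)" using A N_n by (intro sum_mono Y_le) auto
  also have "\<dots> = card A * (2 * n + 1)" by simp
  also have "\<dots> \<le> n * (2 * n + 3)"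
  proof (rule mult_le_mono)
    have "card A \<le> card {..<n}" using A N_n by (intro card_mono) auto
    then show "card A \<le> n" by simp
  qed simp
  finally show ?thesis using W_val by linarith
qed

text \<open>The potential for the release of the vertices in \<open>R\<close>. The first term pays
  for the levels treated by \<open>push\<close>, at 42 steps each; the second covers the remaining
  \<open>11 * blen (stay r v) + 61\<close> steps per vertex.\<close>

definition cost :: "nat set \<Rightarrow> nat" where
  "cost R = 42 * halving_sum (Suc (card R)) + 72 * (\<Sum>v\<in>R. Y v)"

definition env :: "state \<Rightarrow> bool" where
  "env s \<longleftrightarrow> static s \<and> arrs s 7 = (\<lambda>v. of_bool (v \<in> N)) \<and> regs s 5 = length P
     \<and> (\<forall>k<length P. arrs s 8 k = P ! k) \<and> sampled s = r"

text \<open>\<open>R\<close> are the vertices released so far, \<open>A\<close> those among them that are still in the heap.\<close>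

definition hinv :: "nat set \<Rightarrow> nat set \<Rightarrow> nat \<Rightarrow> state \<Rightarrow> bool" where
  "hinv R A i s \<longleftrightarrow> env s \<and> R \<subseteq> N \<and> A \<subseteq> R \<and> regs s 11 = card R \<and> inj_on (arrs s 11) R
     \<and> (\<forall>v\<in>R. arrs s 11 v < card R \<and> arrs s 9 v = atime r v \<and> arrs s 10 v = gap v
          \<and> atime r v \<le> arrs s 11 v + i)
     \<and> tree_ok r (card R) (arrs s 11) A (arrs s 12) \<and> mins_ok r 0 (card R) (arrs s 11) A (arrs s 13)"

lemma hinv_cong:
  assumes "hinv R A i s" "regs s' 0 = regs s 0" "regs s' 5 = regs s 5" "regs s' 11 = regs s 11"
    "arrs s' 1 = arrs s 1" "arrs s' 2 = arrs s 2" "arrs s' 3 = arrs s 3" "arrs s' 7 = arrs s 7" "arrs s' 8 = arrs s 8"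
    "arrs s' 9 = arrs s 9" "arrs s' 10 = arrs s 10" "arrs s' 11 = arrs s 11" "arrs s' 12 = arrs s 12"
    "arrs s' 13 = arrs s 13" "sampled s' = sampled s"
  shows "hinv R A i s'"
  using assms unfolding hinv_def env_def static_def by simp

text \<open>The bounds for time and comparisons differ by the summand 2: releasing a vertex outside
  \<open>N\<close> takes time but no comparison.\<close>

lemma wp_release:
  assumes H: "hinv R A i s" and z: "regs s 8 = z" "z < n" "z \<notin> R"
    and lo: "z \<in> N \<Longrightarrow> regs s 14 = atime r z \<and> regs s 10 \<le> gap z \<and> gap z - regs s 10 + 1 \<le> stay r z
      \<and> atime r z \<le> card R + i"
  shows "wp W release (\<lambda>s'. hinv (if z \<in> N then insert z R else R) (if z \<in> N then insert z A else A) i s'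
     \<and> time s' + cost R \<le> time s + cost (if z \<in> N then insert z R else R) + 2
     \<and> comparisons s' + cost R \<le> comparisons s + cost (if z \<in> N then insert z R else R)) s"
proof (cases "z \<in> N")
  case False
  have "arrs s 7 z = 0" using H False by (simp add: hinv_def env_def)
  then have "wp W release (\<lambda>s'. s' = tick 1 (tick 1 s)) s"
    unfolding release_def using z by (intro wp_Cond wp_run) simp_all
  then show ?thesis
    by (rule wp_conseq) (use False in \<open>auto intro: hinv_cong[OF H]\<close>)
next
  case True
  have H': "env s" "R \<subseteq> N" "A \<subseteq> R" "regs s 11 = card R" "inj_on (arrs s 11) R"
    "\<forall>v\<in>R. arrs s 11 v < card R \<and> arrs s 9 v = atime r v \<and> arrs s 10 v = gap v \<and> atime r v \<le> arrs s 11 v + i"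
    "tree_ok r (card R) (arrs s 11) A (arrs s 12)" "mins_ok r 0 (card R) (arrs s 11) A (arrs s 13)"
    using H by (simp_all add: hinv_def)
  have e: "arrs s 7 z = 1" "regs s 5 = length P" "\<forall>k<length P. arrs s 8 k = P ! k" "sampled s = r"
    using H'(1) True by (simp_all add: env_def)
  have lo: "regs s 14 = atime r z" "regs s 10 \<le> gap z" "gap z - regs s 10 + 1 \<le> stay r z" "atime r z \<le> card R + i"
    using lo True by blast+
  have finR: "finite R" using H'(2) N_n finite_subset[OF _ finite_lessThan[of n]] by (meson order_trans)
  have cR: "card R < n"
  proof -
    have "insert z R \<subseteq> {..<n}" using z(2) H'(2) N_n by auto
    then have "card (insert z R) \<le> card {..<n}" by (intro card_mono) auto
    then show ?thesis using z(3) finR by simp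
  qed
  have "wp W release (\<lambda>s'. hinv (insert z R) (insert z A) i s' \<and> time s' + cost R \<le> time s + cost (insert z R)) s"
    unfolding release_def
  proof (rule wp_Cond, goal_cases)
    case 1
    let ?F = "\<lambda>s'. env s' \<and> regs s' 8 = z \<and> regs s' 10 = regs s 10 \<and> regs s' 11 = card R
      \<and> arrs s' 9 = (arrs s 9)(z := atime r z) \<and> arrs s' 11 = arrs s 11 \<and> arrs s' 12 = arrs s 12 \<and> arrs s' 13 = arrs s 13"
    show ?case
    proof (rule wp_Seq'[where P = "\<lambda>s'. ?F s' \<and> arrs s' 10 = arrs s 10 \<and> time s' = time s + 2"], goal_cases)
      case 1
      show ?case
        by (rule wp_run; use z(1) H'(1,4) lo(1) in \<open>simp add: env_def static_def\<close>)
    next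
      case (2 s1)
      have g: "wp W gallop (\<lambda>s'. regs s' 18 = gap z \<and>
          (\<exists>j. 2 ^ j \<le> gap z - regs s 10 + 1 \<and> time s' \<le> time s1 + 11 * j + 12)) s1"
      proof (rule wp_gallop)
        fix k assume "k < length P"
        then show "(arrs s1 8 k, z) \<in> r \<longleftrightarrow> k < gap z" using 2 P_before_iff by (simp add: env_def)
      qed (use 2 lo(2) gap_le length_P in \<open>simp_all add: env_def\<close>)
      show ?case
      proof (rule wp_Seq'[where P = "\<lambda>s'. ?F s' \<and> arrs s' 10 = arrs s 10 \<and> regs s' 18 = gap z \<and>
          time s' \<le> time s + 11 * blen (stay r z) + 14"], goal_cases)
        case 1
        show ?case
        proof (rule wp_frame[OF g], goal_cases)
          case (2 s2)
          then obtain j where j: "2 ^ j \<le> gap z - regs s 10 + 1" "time s2 \<le> time s1 + 11 * j + 12" by blast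
          have "2 ^ j \<le> stay r z" using j(1) lo(3) by (rule order_trans)
          then have "j < blen (stay r z)" by (rule less_blenI)
          with j(2) 2 \<open>?F s1 \<and> _\<close> show ?case by (simp add: env_def static_def)
        qed simp
      next
        case (2 s2)
        show ?case
        proof (rule wp_Seq'[where P = "\<lambda>s'. ?F s' \<and> arrs s' 10 = (arrs s 10)(z := gap z) \<and>
            time s' \<le> time s + 11 * blen (stay r z) + 15"], goal_cases)
          case 1
          show ?case by (rule wp_run; use 2 in \<open>simp add: env_def static_def\<close>)
        next
          case (2 s3)
          have F: "env s3" "regs s3 8 = z" "regs s3 11 = card R" "arrs s3 9 = (arrs s 9)(z := atime r z)"
            "arrs s3 10 = (arrs s 10)(z := gap z)" "arrs s3 11 = arrs s 11" "arrs s3 12 = arrs s 12"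
            "arrs s3 13 = arrs s 13" "time s3 \<le> time s + 11 * blen (stay r z) + 15" using 2 by simp_all
          have p: "wp W push (\<lambda>s'. regs s' 11 = Suc (card R) \<and> arrs s' 11 = (arrs s 11)(z := card R)
             \<and> tree_ok r (Suc (card R)) ((arrs s 11)(z := card R)) (insert z A) (arrs s' 12)
             \<and> mins_ok r 0 (Suc (card R)) ((arrs s 11)(z := card R)) (insert z A) (arrs s' 13)
             \<and> time s' + 42 * halving_sum (Suc (card R)) \<le> time s3 + 42 * halving_sum (Suc (Suc (card R))) + 46) s3"
            by (rule wp_push) (use F z cR H' N_n in \<open>auto simp: env_def\<close>)
          show ?case
          proof (rule wp_frame[OF p], goal_cases)
            case (2 s4)
            have cI: "card (insert z R) = Suc (card R)" using z(3) finR by simp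
            have fr: "arrs s4 9 = (arrs s 9)(z := atime r z)" "arrs s4 10 = (arrs s 10)(z := gap z)" "env s4"
              using 2(3,4) 2(2)[of 0] 2(2)[of 5] F by (simp_all add: env_def static_def)
            have inj: "inj_on ((arrs s 11)(z := card R)) (insert z R)"
            proof -
              have ni: "card R \<notin> arrs s 11 ` R" using H'(6) by auto
              have "inj_on ((arrs s 11)(z := card R)) R" using H'(5) ni by (rule inj_on_fun_updI)
              moreover have "((arrs s 11)(z := card R)) z \<notin> ((arrs s 11)(z := card R)) ` (R - {z})"
                using z(3) ni by auto
              ultimately show ?thesis unfolding inj_on_insert by (intro conjI)
            qed
            have all: "\<forall>v\<in>insert z R. ((arrs s 11)(z := card R)) v < Suc (card R) \<and> ((arrs s 9)(z := atime r z)) v = atime r v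
              \<and> ((arrs s 10)(z := gap z)) v = gap v \<and> atime r v \<le> ((arrs s 11)(z := card R)) v + i"
              using H'(6) z(3) lo(4) by (auto simp: less_Suc_eq)
            have "hinv (insert z R) (insert z A) i s4"
              unfolding hinv_def cI using 2(1) fr inj all H'(2,3) True by auto
            moreover have "time s4 + cost R \<le> time s + cost (insert z R)"
              using 2(1) F(9) z(3) finR by (simp add: cost_def cI Y_def)
            ultimately show ?case by blast
          qed simp
        qed
      qed
    qed
  next
    case 2
    then show ?case using z(1) e(1) by simp
  qed
  \<comment> \<open>For a vertex of \<open>N\<close> the time bound has no extra summand, so it
    carries over to comparisons.\<close>
  then show ?thesis by (rule wp_frame) (use True in auto)
qed

lemma wp_remove_min:
  assumes H: "hinv R A i s" and w: "regs s 16 = Suc w" "w \<in> A" "pos r w = i" and c: "card R = rel r i"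
    and a: "regs s 15 = i" "regs s 13 = V" "V + Y w < W"
  shows "wp W remove_min (\<lambda>s'. hinv R (A - {w}) (Suc i) s' \<and> regs s' 6 = w \<and> regs s' 13 = V + Y w
    \<and> time s' \<le> time s + 50 * Y w) s"
proof -
  have H': "env s" "R \<subseteq> N" "A \<subseteq> R" "regs s 11 = card R" "inj_on (arrs s 11) R"
    "\<forall>v\<in>R. arrs s 11 v < card R \<and> arrs s 9 v = atime r v \<and> arrs s 10 v = gap v \<and> atime r v \<le> arrs s 11 v + i"
    "tree_ok r (card R) (arrs s 11) A (arrs s 12)" "mins_ok r 0 (card R) (arrs s 11) A (arrs s 13)"
    using H by (simp_all add: hinv_def)
  have wR: "w \<in> R" "w \<in> N" "w < n" using w(2) H'(2,3) N_n by auto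
  have cRn: "card R \<le> n" using card_mono[of "{..<n}" R] H'(2) N_n by auto
  have i: "i < n" using pos_less[OF r wR(3)] w(3) by simp
  have b: "btime r w = Suc i + card R" by (simp add: btime_def w(3) c)
  define d where "d = stay r w"
  have d: "d = i + card R + 1 - atime r w" by (simp add: d_def stay_def b)
  have Yd: "Y w = Suc (blen d)" by (simp add: Y_def d_def)
  have W1: "0 < W" "Suc 0 < W" "2 < W" "Suc (i + card R) < W" "i + card R < W" "Suc w < W" "w < W"
    using W_n i cRn wR(3) by - linarith+
  let ?F = "\<lambda>A' s'. env s' \<and> regs s' 6 = w \<and> regs s' 11 = card R \<and> arrs s' 11 = arrs s 11 \<and> arrs s' 9 = arrs s 9
    \<and> arrs s' 10 = arrs s 10 \<and> tree_ok r (card R) (arrs s 11) A' (arrs s' 12) \<and> mins_ok r 0 (card R) (arrs s 11) A' (arrs s' 13)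
    \<and> regs s' 15 = i"
  have fin: "hinv R (A - {w}) (Suc i) s'" if "?F (A - {w}) s'" for s'
    unfolding hinv_def using that H'(2,3,5,6) by auto
  show ?thesis unfolding remove_min_def
  proof (rule wp_Seq'[where P = "\<lambda>s'. ?F A s' \<and> regs s' 13 = V \<and> time s' = time s + 1"], goal_cases)
    case 1
    show ?case
      by (rule wp_run; use w(1) H'(1,4,7,8) a(1,2) W1 in \<open>simp add: env_def static_def\<close>)
  next
    case (2 s1)
    have p: "wp W pop (\<lambda>s'. tree_ok r (card R) (arrs s 11) (A - {w}) (arrs s' 12)
       \<and> mins_ok r 0 (card R) (arrs s 11) (A - {w}) (arrs s' 13)
       \<and> (\<exists>j. 2 ^ j \<le> card R - arrs s 11 w \<and> time s' \<le> time s1 + 42 * j + 45)) s1"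
    proof (rule wp_pop)
      show "arrs s 11 v < card R" if "v \<in> A" for v using H'(3,6) that by auto
      show "inj_on (arrs s 11) A" using H'(5,3) by (rule inj_on_subset)
      show "A \<subseteq> {..<n}" using H'(2,3) N_n by auto
    qed (use 2 w(2) cRn in \<open>simp_all add: env_def\<close>)
    show ?case
    proof (rule wp_Seq'[where P = "\<lambda>s'. ?F (A - {w}) s' \<and> regs s' 13 = V \<and> time s' \<le> time s + 42 * blen d + 46"], goal_cases)
      case 1
      show ?case
      proof (rule wp_frame[OF p], goal_cases)
        case (2 s2)
        then obtain j where j: "2 ^ j \<le> card R - arrs s 11 w" "time s2 \<le> time s1 + 42 * j + 45" by blast
        \<comment> \<open>This clause of the invariant dates the insertion of \<open>w\<close> no
          earlier than its \<open>atime\<close>. Thus the insertions since then, each a tick, fit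
          into the stay, and the working-set bound becomes logarithmic in the stay.\<close>
        have "atime r w \<le> arrs s 11 w + i" using H'(6) wR(1) by blast
        then have "card R - arrs s 11 w \<le> d" unfolding d by linarith
        with j(1) have "2 ^ j \<le> d" by (rule order_trans)
        then have "j < blen d" by (rule less_blenI)
        with j(2) 2 \<open>?F A s1 \<and> _\<close> show ?case by (simp add: env_def static_def)
      qed simp
    next
      case (2 s2)
      have at: "arrs s2 9 w = atime r w" using 2 H'(6) wR(1) by simp
      have dW: "Suc (i + card R) - atime r w < W" "V < W" "Suc V < W" using W1 a(3) by (simp_all add: Yd)
      define I where "I s' \<longleftrightarrow> ?F (A - {w}) s' \<and> regs s' 27 \<le> d \<and> regs s' 13 + blen (regs s' 27) = V + Y w
        \<and> time s' + 3 * blen (regs s' 27) \<le> time s + 45 * blen d + 48" for s' :: state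
      show ?case
      proof (rule wp_Seq'[where P = I], goal_cases)
        case 1
        show ?case
          by (rule wp_run; use 2 at dW W1 in \<open>simp add: I_def d Yd env_def static_def\<close>)
      next
        case (2 s3)
        have "Suc (i + card R) - atime r w < W" by (fact dW)
        then have "d < W" by (simp add: d)
        show ?case
        proof (rule wp_Loop[where I = I and m = "\<lambda>s. regs s 27"], goal_cases)
          case 1
          show ?case using 2 .
        next
          case (3 s')
          then have "?F (A - {w}) s'" "regs s' 27 = 0" by (simp_all add: I_def)
          moreover from this have "hinv R (A - {w}) (Suc i) (tick 1 s')" by (intro fin) (simp add: env_def static_def)
          ultimately show ?case using 3(1) by (simp add: I_def Yd)
        next
          case (2 s')
          define x where "x = regs s' 27"
          have x: "0 < x" "x \<le> d" "x div 2 < W" "x < W" using 2 \<open>d < W\<close> by (auto simp: I_def x_def)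
          have bx: "blen x = Suc (blen (x div 2))" using x(1) by (rule blen_pos)
          have vW: "Suc (regs s' 13) < W" using 2(1) a(3) bx by (simp add: I_def x_def)
          have mods: "x div 2 mod W = x div 2" "2 mod W = 2" "1 mod W = 1" "Suc 0 mod W = Suc 0" "Suc (regs s' 13) mod W = Suc (regs s' 13)"
            using x W1 vW by simp_all
          have "x div 2 \<le> d" "x div 2 < x" using x(1,2) by - linarith+
          then show ?case
            by (intro wp_run; use 2(1) x_def[symmetric] bx mods in \<open>simp add: I_def env_def static_def\<close>)
        qed
      qed
    qed
  qed
qed

section \<open>Released vertices and processed arcs\<close>

definition free :: "nat set \<Rightarrow> nat set" where "free D = {v\<in>N. indeg D v = 0}"
definition before :: "nat \<Rightarrow> nat set" where "before i = {e. e < m \<and> pos r (ta e) < i}"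
definition partial_val :: "nat \<Rightarrow> nat" where "partial_val i = (\<Sum>v | v \<in> N \<and> pos r v < i. Y v)"

lemma finite_free [simp]: "finite (free D)"
  using finite_N by (simp add: free_def)

lemma card_free_before: "card (free (before i)) = rel r i"
proof -
  have "indeg (before i) w = 0 \<longleftrightarrow> (\<forall>u. (u, w) \<in> set xs \<longrightarrow> pos r u < i)" for w
    unfolding indeg_0_iff before_def arc_iff by blast
  then show ?thesis by (simp add: free_def rel_def)
qed

lemma free_insert:
  assumes "e < m" "e \<notin> D"
  shows "free (insert e D) =
    (if indeg (insert e D) (he e) = 0 \<and> he e \<in> N then insert (he e) (free D) else free D)"
    and "he e \<notin> free D"
proof -
  show n: "he e \<notin> free D" using assms by (auto simp: free_def indeg_0_iff)
  have "indeg (insert e D) v = indeg D v" if "v \<noteq> he e" for v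
    using that by (simp add: indeg_insert[OF assms])
  then have "v \<in> free (insert e D) \<longleftrightarrow> v \<in> free D" if "v \<noteq> he e" for v
    using that by (simp add: free_def)
  moreover have "he e \<in> free (insert e D) \<longleftrightarrow> indeg (insert e D) (he e) = 0 \<and> he e \<in> N"
    by (auto simp: free_def)
  ultimately show "free (insert e D) =
    (if indeg (insert e D) (he e) = 0 \<and> he e \<in> N then insert (he e) (free D) else free D)"
    using n by (intro set_eqI; rename_tac x; case_tac "x = he e") simp_all
qed

text \<open>If \<open>z\<close> is released when \<open>j\<close> vertices have been removed, the
  search passes over path vertices that are removed while \<open>z\<close> waits. Each such removal
  is a tick of its stay, so the search can be charged to \<open>stay r z\<close>.\<close>

lemma stay_ge:
  assumes z: "z < n" and j: "j \<le> pos r z" and at: "atime r z \<le> j + rel r j"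
  shows "removed_path j \<le> gap z" "gap z - removed_path j + 1 \<le> stay r z"
proof -
  show "removed_path j \<le> gap z" unfolding gap_eq_removed_path[OF z] using j by (rule removed_path_mono)
  have "gap z \<le> removed_path j + (pos r z - j)"
    unfolding gap_eq_removed_path[OF z] using j by (rule removed_path_le)
  moreover have "rel r j \<le> rel r (pos r z)" using j by (rule rel_mono)
  then have "pos r z - j + 1 \<le> stay r z"
    unfolding stay_def btime_def using at j by linarith
  ultimately show "gap z - removed_path j + 1 \<le> stay r z" by linarith
qed

lemma wp_init_sources:
  assumes s: "split_ok N P s" "sampled s = r" "regs s 10 = 0" "regs s 11 = 0" "regs s 14 = 0"
    "arrs s 12 = (\<lambda>_. 0)" "arrs s 13 = (\<lambda>_. 0)"
  shows "wp W init_sources (\<lambda>s'. hinv (free {}) (free {}) 0 s' \<and> arrs s' 5 = indeg {} \<and> regs s' 10 = 0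
    \<and> comparisons s' \<le> cost (free {}) \<and> time s' \<le> time s + cost (free {}) + 6 * n + 2) s"
proof -
  define R where "R k = {v\<in>N. v < k \<and> indeg {} v = 0}" for k
  define I where "I s' \<longleftrightarrow> hinv (R (regs s' 2)) (R (regs s' 2)) 0 s' \<and> regs s' 2 \<le> n \<and> arrs s' 5 = indeg {}
    \<and> regs s' 10 = 0 \<and> regs s' 14 = 0 \<and> comparisons s' \<le> cost (R (regs s' 2))
    \<and> time s' \<le> time s + cost (R (regs s' 2)) + 6 * regs s' 2 + 1" for s' :: state
  have W1: "0 < W" "Suc 0 < W" "Suc n < W" using W_n by simp_all
  have R0: "R 0 = {}" by (simp add: R_def)
  have c0: "cost {} = 0" by (simp add: cost_def)
  have h0: "hinv {} {} 0 s'" if "env s'" "regs s' 11 = 0" "arrs s' 12 = (\<lambda>_. 0)" "arrs s' 13 = (\<lambda>_. 0)" for s'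
    using that by (simp add: hinv_def tree_ok_def mins_ok_def segm_def prefx_def)
  have Rn: "R n = free {}" using N_n by (auto simp: R_def free_def)
  show ?thesis unfolding init_sources_def
  proof (rule wp_Seq'[where P = I], goal_cases)
    case 1
    let ?s = "run W (Assign 2 (Const 0)) s"
    have "env ?s" using s(1,2) by (simp add: env_def split_ok_def static_def)
    then have "hinv {} {} 0 ?s" by (rule h0) (use s in simp_all)
    then show ?case
      by (intro wp_run) (use s in \<open>simp_all add: I_def R0 c0 split_ok_def\<close>)
  next
    case (2 s1)
    show ?case
    proof (rule wp_Loop[where I = I and m = "\<lambda>s. n - regs s 2"], goal_cases)
      case 1
      show ?case using 2 .
    next
      case (3 s')
      have "regs s' 0 = n" using 3(1) by (simp add: I_def hinv_def env_def static_def)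
      then have "regs s' 2 = n" using 3 W1 by (auto simp: I_def split: if_splits)
      then have "hinv (free {}) (free {}) 0 s'" using 3(1) by (simp add: I_def Rn)
      then have "hinv (free {}) (free {}) 0 (tick 1 s')" by (rule hinv_cong) simp_all
      with 3(1) \<open>regs s' 2 = n\<close> show ?case by (simp add: I_def Rn)
    next
      case (2 s')
      define k where "k = regs s' 2"
      have H: "hinv (R k) (R k) 0 s'" "arrs s' 5 = indeg {}" "regs s' 10 = 0" "regs s' 14 = 0"
        "comparisons s' \<le> cost (R k)" "time s' \<le> time s + cost (R k) + 6 * k + 1" "regs s' 2 = k" "k \<le> n"
        using 2(1) by (simp_all add: I_def k_def)
      have n0: "regs s' 0 = n" using H(1) by (simp add: hinv_def env_def static_def)
      have k: "k < n" using 2(2) H(7,8) n0 W1 by (auto split: if_splits)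
      have mods: "Suc 0 mod W = Suc 0" "1 mod W = 1" "Suc k mod W = Suc k" using W1 k by simp_all
      have Rk: "R (Suc k) = (if indeg {} k = 0 \<and> k \<in> N then insert k (R k) else R k)"
        by (auto simp: R_def less_Suc_eq)
      let ?Q = "\<lambda>s3. hinv (R (Suc k)) (R (Suc k)) 0 s3 \<and> arrs s3 5 = indeg {}
        \<and> regs s3 10 = 0 \<and> regs s3 14 = 0 \<and> regs s3 2 = k \<and> comparisons s3 \<le> cost (R (Suc k))
        \<and> time s3 \<le> time s + cost (R (Suc k)) + 6 * k + 6"
      show ?case
      proof (rule wp_Seq'[where P = ?Q], goal_cases)
        case 1
        show ?case
        proof (rule wp_Cond, goal_cases)
          case 1
          then have ind: "indeg {} k = 0" using H(2,7) W1 by (auto split: if_splits)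
          show ?case
          proof (rule wp_Seq'[where P = "\<lambda>s2. s2 = tick 1 (set_reg 8 k (tick 1 (tick 1 s')))"], goal_cases)
            case 1
            show ?case by (rule wp_run) (simp_all add: H(7))
          next
            case (2 s2)
            have H2: "hinv (R k) (R k) 0 s2" using H(1) by (rule hinv_cong) (simp_all add: 2)
            have kz: "k \<notin> R k" by (simp add: R_def)
            \<comment> \<open>Sources are released before the first removal, so
              \<open>stay_ge\<close> is applied with \<open>j = 0\<close>.\<close>
            have nopred: "atime r k = 0"
              using atime_cases[of r k] ind unfolding indeg_0_iff arc_iff by blast
            have pre: "k \<in> N \<Longrightarrow> regs s2 14 = atime r k \<and> regs s2 10 \<le> gap k \<and> gap k - regs s2 10 + 1 \<le> stay r k
              \<and> atime r k \<le> card (R k) + 0"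
              using stay_ge[OF k, of 0] nopred H(3,4) by (simp add: 2 removed_path_def)
            have rl: "(if k \<in> N then insert k (R k) else R k) = R (Suc k)" by (simp add: Rk ind)
            note rel = wp_release[OF H2 _ k kz pre, unfolded rl]
            have r8: "regs s2 8 = k" by (simp add: 2)
            show ?case
              by (rule wp_frame[OF rel[OF r8]]) (use H 2 in auto)
          qed
        next
          case 2
          then have ind: "indeg {} k \<noteq> 0" using H(2,7) W1 by (auto split: if_splits)
          have "hinv (R (Suc k)) (R (Suc k)) 0 (tick 1 (tick 1 (tick 1 s')))"
            unfolding Rk using ind H(1) by (auto intro: hinv_cong)
          then show ?case
            by (intro wp_run) (use H ind in \<open>simp_all add: Rk\<close>)
        qed
      next
        case (2 s3)
        let ?s = "run W (Assign 2 (Reg 2 +\<^sub>e Const 1)) s3"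
        have r2: "regs s3 2 = k" using 2 by blast
        have "hinv (R (Suc k)) (R (Suc k)) 0 s3" using 2 by blast
        then have "hinv (R (Suc k)) (R (Suc k)) 0 ?s" by (rule hinv_cong) simp_all
        moreover have "regs ?s 2 = Suc k" using r2 mods by simp
        ultimately show ?case
          by (intro wp_run) (use 2 k H(7) in \<open>simp_all add: I_def\<close>)
      qed
    qed
  qed
qed

text \<open>The time bound has terms for removed vertices and processed arcs, whereas comparisons
  are charged to \<open>N\<close> alone. The factor 50 pays for a removal from the heap and for
  counting the bits of the stay.\<close>

definition ginv :: "nat \<Rightarrow> nat \<Rightarrow> state \<Rightarrow> bool" where
  "ginv T i s \<longleftrightarrow> hinv (free (before i)) (free (before i) - {v. pos r v < i}) i s
     \<and> arrs s 5 = indeg (before i) \<and> regs s 15 = i \<and> regs s 10 = removed_path i \<and> regs s 13 = partial_val i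
     \<and> comparisons s \<le> cost (free (before i)) + 50 * partial_val i
     \<and> time s \<le> T + cost (free (before i)) + 50 * partial_val i + 20 * i + 8 * card (before i)"

lemma pos_less_Suc:
  assumes "w < n" "pos r w = i" "u < n"
  shows "pos r u < Suc i \<longleftrightarrow> pos r u < i \<or> u = w"
proof (cases "pos r u = i")
  case True
  then have "u = w" using pos_inj[OF r assms(3,1)] assms(2) by simp
  with True show ?thesis by simp
next
  case False
  then have "u \<noteq> w" using assms(2) by blast
  with False show ?thesis by (simp add: less_Suc_eq)
qed

lemma pos_less_Suc_N:
  assumes "w < n" "pos r w = i" "u \<in> N"
  shows "pos r u < Suc i \<longleftrightarrow> pos r u < i \<or> u = w"
  by (rule pos_less_Suc[OF assms(1,2)]) (use assms(3) N_n in auto)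

lemma partial_val_Suc:
  assumes "w < n" "pos r w = i"
  shows "partial_val (Suc i) = partial_val i + (if w \<in> N then Y w else 0)"
proof -
  have "{v. v \<in> N \<and> pos r v < Suc i} = (if w \<in> N then insert w {v. v \<in> N \<and> pos r v < i} else {v. v \<in> N \<and> pos r v < i})"
    by (intro set_eqI) (use pos_less_Suc_N[OF assms] in \<open>simp; blast\<close>)
  then show ?thesis using assms(2) finite_N by (simp add: partial_val_def)
qed

lemma removed_path_Suc:
  assumes "w < n" "pos r w = i"
  shows "removed_path (Suc i) = removed_path i + (if w \<in> N then 0 else 1)"
proof -
  have "{u. u < n \<and> u \<notin> N \<and> pos r u < Suc i} = (if w \<in> N then {u. u < n \<and> u \<notin> N \<and> pos r u < i}
    else insert w {u. u < n \<and> u \<notin> N \<and> pos r u < i})"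
    by (intro set_eqI) (use pos_less_Suc[OF assms] assms(1) in \<open>simp; blast\<close>)
  then show ?thesis using assms(2) by (simp add: removed_path_def)
qed

lemma wp_remove:
  assumes G: "ginv T i s" and w: "w < n" "pos r w = i"
  shows "wp W remove (\<lambda>s'. hinv (free (before i)) (free (before i) - {v. pos r v < Suc i}) (Suc i) s'
     \<and> arrs s' 5 = indeg (before i) \<and> regs s' 15 = Suc i \<and> regs s' 10 = removed_path (Suc i)
     \<and> regs s' 13 = partial_val (Suc i) \<and> regs s' 14 = btime r w \<and> regs s' 7 = last_arc ta w m
     \<and> comparisons s' \<le> cost (free (before i)) + 50 * partial_val (Suc i)
     \<and> time s' \<le> T + cost (free (before i)) + 50 * partial_val (Suc i) + 20 * i + 8 * card (before i) + 7) s"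
proof -
  let ?R = "free (before i)" and ?A = "free (before i) - {v. pos r v < i}" and ?B = "free (before i) - {v. pos r v < Suc i}"
  have H: "hinv ?R ?A i s" and G': "arrs s 5 = indeg (before i)" "regs s 15 = i" "regs s 10 = removed_path i"
    "regs s 13 = partial_val i" "comparisons s \<le> cost ?R + 50 * partial_val i"
    "time s \<le> T + cost ?R + 50 * partial_val i + 20 * i + 8 * card (before i)"
    using G by (simp_all add: ginv_def)
  have AN: "?A \<subseteq> N" by (auto simp: free_def)
  have i: "i < n" using pos_less[OF r w(1)] w(2) by simp
  have cR: "card ?R = rel r i" by (rule card_free_before)
  have cRn: "card ?R \<le> n" using card_mono[of "{..<n}" ?R] N_n by (auto simp: free_def)
  have bt: "btime r w = Suc (i + card ?R)" by (simp add: btime_def w(2) cR)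
  have W1: "0 < W" "Suc 0 < W" "Suc (i + card ?R) < W" "i + card ?R < W" "Suc i < W" "Suc n < W"
    using W_n i cRn by - linarith+
  have H': "env s" "regs s 11 = card ?R" "\<forall>v\<in>?R. arrs s 11 v < card ?R \<and> arrs s 10 v = gap v"
    "mins_ok r 0 (card ?R) (arrs s 11) ?A (arrs s 13)" using H by (simp_all add: hinv_def)
  have pe: "prefx (arrs s 11) ?A (card ?R) 0 = ?A" using H'(3) by (auto simp: prefx_0)
  have "is_min r (arrs s 13 0) (prefx (arrs s 11) ?A (card ?R) 0)" using H'(4) unfolding mins_ok_def by blast
  then have mn: "is_min r (arrs s 13 0) ?A" unfolding pe .
  have gw: "gap w = removed_path i" using gap_eq_removed_path[OF w(1)] w(2) by simp
  have rest: "x = w \<or> (w, x) \<in> r" if "x < n" "\<not> pos r x < i" for x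
    using that w pos_less_iff[OF r w(1) that(1)] pos_inj[OF r that(1) w(1)] by linarith
  have pvW: "partial_val (Suc i) < W" unfolding partial_val_def by (rule sum_Y_less) auto
  have preds: "pos r u < i" if "(u, w) \<in> set xs" for u using pos_mono[OF r r_arcs[OF r that]] w(2) by simp
  let ?F = "\<lambda>s'. arrs s' 5 = indeg (before i) \<and> regs s' 15 = i"
  show ?thesis unfolding remove_def
  proof (rule wp_Seq'[where P = "\<lambda>s'. s' = tick 1 (set_reg 16 (arrs s 13 0) s)"], goal_cases)
    case 1
    show ?case by (rule wp_run) simp_all
  next
    case (2 s1)
    have H1: "hinv ?R ?A i s1" using H by (rule hinv_cong) (simp_all add: 2)
    have x16: "regs s1 16 = arrs s 13 0" by (simp add: 2)
    have x_le: "arrs s 13 0 \<le> n" by (rule is_min_le[OF mn order_trans[OF AN N_n]])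
    let ?M = "\<lambda>s'. hinv ?R ?B (Suc i) s' \<and> regs s' 6 = w \<and> arrs s' 5 = indeg (before i) \<and> regs s' 15 = i
      \<and> regs s' 10 = removed_path (Suc i) \<and> regs s' 13 = partial_val (Suc i)
      \<and> comparisons s' \<le> cost ?R + 50 * partial_val (Suc i)
      \<and> time s' \<le> T + cost ?R + 50 * partial_val (Suc i) + 20 * i + 8 * card (before i) + 4"
    show ?case
    proof (rule wp_Seq'[where P = ?M], goal_cases)
      case 1
      show ?case
      proof (cases "w \<in> N")
        case True
        \<comment> \<open>All predecessors of \<open>w\<close> are gone, so \<open>w\<close> has
          been released; being first among the remaining vertices, it is the heap minimum.\<close>
        have wA: "w \<in> ?A"
        proof -
          have "indeg (before i) w = 0" unfolding indeg_0_iff before_def using preds arc_iff by blast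
          then show ?thesis using True w by (simp add: free_def)
        qed
        have x: "arrs s 13 0 = Suc w"
        proof -
          obtain v where v: "v \<in> ?A" "arrs s 13 0 = Suc v" "\<forall>u\<in>?A. u = v \<or> (v, u) \<in> r"
            using mn wA unfolding is_min_def by blast
          have "v < n" using v(1) AN N_n by auto
          then have "v = w \<or> (w, v) \<in> r" using v(1) by (intro rest) auto
          moreover have "w = v \<or> (v, w) \<in> r" using v(3) wA by blast
          ultimately have "v = w" using r_trans[OF r] r_irrefl[OF r] by blast
          with v(2) show ?thesis by simp
        qed
        have pv: "partial_val (Suc i) = partial_val i + Y w" using partial_val_Suc[OF w] True by simp
        have rp: "removed_path (Suc i) = removed_path i" using removed_path_Suc[OF w] True by simp
        have B: "?A - {w} = ?B" using pos_less_Suc_N[OF w] by (auto simp: free_def)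
        have g10: "arrs s 10 w = removed_path i" using H'(3) wA gw by auto
        show ?thesis
        proof (rule wp_Cond, goal_cases)
          case 1
          have Ht: "hinv ?R ?A i (tick 1 s1)" using H1 by (rule hinv_cong) simp_all
          have "wp W remove_min (\<lambda>s'. hinv ?R (?A - {w}) (Suc i) s' \<and> regs s' 6 = w
            \<and> regs s' 13 = partial_val i + Y w \<and> time s' \<le> time (tick 1 s1) + 50 * Y w) (tick 1 s1)"
            by (rule wp_remove_min[OF Ht _ wA w(2) cR]) (use x x16 G' pvW pv 2 in simp_all)
          then show ?case unfolding B
            by (rule wp_frame) (use G' 2 pv rp in auto)
        next
          case 2
          then have False using x x16 g10 G'(3) W1 w(1) \<open>s1 = _\<close> by simp
          then show ?case ..
        qed
      next
        case False
        have pv: "partial_val (Suc i) = partial_val i" using partial_val_Suc[OF w] False by simp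
        have rp: "removed_path (Suc i) = Suc (removed_path i)" using removed_path_Suc[OF w] False by simp
        have B: "?A = ?B" using pos_less_Suc_N[OF w] False by (auto simp: free_def)
        have "w \<in> set P" using w(1) False by (simp add: P_set)
        then obtain k where k: "k < length P" "P ! k = w" by (auto simp: in_set_conv_nth)
        have kr: "k = removed_path i" using P_gap[OF k(1)] k(2) gw by simp
        have rpW: "Suc (removed_path i) < W" using k(1) kr length_P W1 by linarith
        \<comment> \<open>The path vertex \<open>w\<close> precedes every vertex in the heap and has
          not been counted as removed, so the gap of the heap minimum is larger than the current
          count.\<close>
        have ngap: "arrs s 10 v \<noteq> removed_path i" if v: "arrs s 13 0 = Suc v" for v
        proof -
          have vA: "v \<in> ?A" using mn v by (simp add: is_min_Suc)
          then have "v \<noteq> w" "v < n" using AN False N_n by auto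
          then have "(w, v) \<in> r" using rest[of v] vA by auto
          then have "(P ! k, v) \<in> r" using k(2) by simp
          then have "k < gap v" using P_before_iff[OF k(1)] by simp
          then show ?thesis using kr H'(3) vA by auto
        qed
        show ?thesis
        proof (rule wp_Cond, goal_cases)
          case 1
          have "arrs s 13 0 = 0 \<or> arrs s 10 (arrs s 13 0 - 1) \<noteq> removed_path i"
            using ngap by (cases "arrs s 13 0") auto
          then have False using 1 2 W1 x_le G'(3) by (auto split: if_splits)
          then show ?case ..
        next
          case 2
          let ?s = "run W next_path (tick 1 s1)"
          have "arrs s 8 (removed_path i) = w" using H'(1) k kr by (auto simp: env_def)
          then have "regs ?s 6 = w" "regs ?s 10 = Suc (removed_path i)" "arrs ?s 5 = arrs s 5" "regs ?s 15 = i"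
            "regs ?s 13 = partial_val i" "comparisons ?s = comparisons s" "time ?s = time s + 4"
            using \<open>s1 = _\<close> G' W1 rpW by (simp_all add: next_path_def)
          moreover have "hinv ?R ?A (Suc i) ?s"
          proof -
            have "hinv ?R ?A i ?s" using H1 by (rule hinv_cong) (simp_all add: next_path_def)
            then show ?thesis unfolding hinv_def by (auto intro: le_SucI)
          qed
          ultimately show ?case
            by (intro wp_run) (use B pv rp G' in simp_all)
        qed
      qed
    next
      case (2 s2)
      have a2: "arrs s2 2 = (\<lambda>v. last_arc ta v m)" "regs s2 11 = card ?R" using 2 by (auto simp: hinv_def env_def static_def)
      let ?c = "Assign 14 (Reg 15 +\<^sub>e Reg 11 +\<^sub>e Const 1) ;; Assign 15 (Reg 15 +\<^sub>e Const 1) ;; Assign 7 (Arr 2 (Reg 6))"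
      have "hinv ?R ?B (Suc i) s2" using 2 by blast
      then have "hinv ?R ?B (Suc i) (run W ?c s2)" by (rule hinv_cong) simp_all
      moreover have "regs (run W ?c s2) 14 = btime r w" "regs (run W ?c s2) 15 = Suc i" "regs (run W ?c s2) 7 = last_arc ta w m"
        using 2 a2 W1 by (simp_all add: bt)
      ultimately show ?case by (intro wp_run) (use 2 in simp_all)
    qed
  qed
qed

lemma wp_release_step:
  assumes w: "w < n" "pos r w = i" and e: "e < m" "ta e = w" "e \<notin> D" and D: "before i \<subseteq> D" "D \<subseteq> before (Suc i)"
    and H: "hinv (free D) (free D - {v. pos r v < Suc i}) (Suc i) s" and a: "arrs s 5 = indeg D"
    "regs s 7 = Suc e" "regs s 10 = removed_path (Suc i)" "regs s 14 = btime r w"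
  shows "wp W release_step (\<lambda>s'. hinv (free (insert e D)) (free (insert e D) - {v. pos r v < Suc i}) (Suc i) s'
     \<and> arrs s' 5 = indeg (insert e D) \<and> regs s' 7 = last_arc ta w e \<and> regs s' 10 = regs s 10
     \<and> regs s' 13 = regs s 13 \<and> regs s' 14 = regs s 14 \<and> regs s' 15 = regs s 15
     \<and> time s' + cost (free D) \<le> time s + cost (free (insert e D)) + 6
     \<and> comparisons s' + cost (free D) \<le> comparisons s + cost (free (insert e D))) s"
proof -
  define z where "z = he e"
  define D' where "D' = insert e D"
  have zn: "z < n" using ta_he_less(2)[OF e(1)] by (simp add: z_def)
  have arc: "(w, z) \<in> set xs" using e(1,2) arc_iff z_def by blast
  have pz: "Suc i \<le> pos r z" using pos_mono[OF r r_arcs[OF r arc]] w(2) by simp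
  have st: "arrs s 1 = he" "arrs s 3 (Suc e) = last_arc ta w e"
    using H e(1,2) by (auto simp: hinv_def env_def static_def)
  have ind: "indeg D' = (indeg D)(z := indeg D z - 1)" unfolding D'_def z_def by (rule indeg_insert[OF e(1,3)])
  have fr: "free D' = (if indeg D' z = 0 \<and> z \<in> N then insert z (free D) else free D)" "z \<notin> free D"
    unfolding D'_def z_def using free_insert[OF e(1,3)] by blast+
  have W1: "0 < W" "Suc 0 < W" "e < W" "indeg D z - 1 < W" "indeg D z - Suc 0 < W"
    using W_n W_xs e(1) indeg_le[of D z] by (simp_all add: m_def)
  let ?B = "{v. pos r v < Suc i}"
  let ?K = "\<lambda>t s'. hinv (free D') (free D' - ?B) (Suc i) s' \<and> arrs s' 5 = indeg D' \<and> regs s' 7 = Suc e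
     \<and> regs s' 10 = regs s 10 \<and> regs s' 13 = regs s 13 \<and> regs s' 14 = regs s 14 \<and> regs s' 15 = regs s 15
     \<and> time s' + cost (free D) \<le> time s + cost (free D') + t
     \<and> comparisons s' + cost (free D) \<le> comparisons s + cost (free D')"
  show ?thesis unfolding release_step_def D'_def[symmetric]
  proof (rule wp_Seq'[where P = "\<lambda>s'. s' = tick 1 (set_arr 5 z (indeg D z - 1) (tick 1 (set_reg 8 z s)))"], goal_cases)
    case 1
    show ?case by (rule wp_run) (use a st W1 in \<open>simp_all add: z_def[symmetric]\<close>)
  next
    case (2 s1)
    have H1: "hinv (free D) (free D - ?B) (Suc i) s1" using H by (rule hinv_cong) (simp_all add: 2)
    have i5: "arrs s1 5 = indeg D'" by (simp add: 2 a(1) ind)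
    have r8: "regs s1 8 = z" by (simp add: 2)
    show ?case
    proof (rule wp_Seq'[where P = "?K 5"], goal_cases)
      case 1
      show ?case
      proof (rule wp_Cond, goal_cases)
        case 1
        then have i0: "indeg D' z = 0" using i5 r8 W1 by (auto split: if_splits)
        have Ht: "hinv (free D) (free D - ?B) (Suc i) (tick 1 s1)" using H1 by (rule hinv_cong) simp_all
        \<comment> \<open>The indegree reaches 0 with an arc from \<open>w\<close>, and all other
          predecessors of \<open>z\<close> were removed earlier, so the removal of \<open>w\<close>
          is what \<open>atime r z\<close> records.\<close>
        have at: "atime r z = btime r w" if "z \<in> N"
        proof -
          have ge: "btime r w \<le> atime r z" using arc by (rule atime_ge)
          then have "atime r z \<noteq> 0" using btime_pos[of r w] by linarith
          then obtain u where u: "(u, z) \<in> set xs" "atime r z = btime r u" using atime_cases[of r z] by auto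
          obtain e' where e': "e' < m" "ta e' = u" "he e' = z" using u(1) arc_iff by blast
          then have "e' \<in> D'" using i0 unfolding indeg_0_iff by blast
          then have "pos r u < Suc i \<or> u = w" using e' e(2) D(2) by (auto simp: D'_def before_def)
          then have "pos r u < i \<or> u = w" using pos_less_Suc[OF w, of u] e' ta_he_less(1) by blast
          then have "btime r u \<le> btime r w" using btime_less[of r u w] w(2) by (auto intro: less_imp_le)
          with ge u(2) show ?thesis by simp
        qed
        have bt: "btime r w = Suc i + rel r i" by (simp add: btime_def w(2))
        have "rel r i \<le> card (free D)"
        proof -
          have "free (before i) \<subseteq> free D" using D(1) by (auto simp: free_def indeg_0_iff)
          then show ?thesis unfolding card_free_before[symmetric] by (intro card_mono) simp_all
        qed
        moreover have "rel r i \<le> rel r (Suc i)" by (rule rel_mono) simp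
        ultimately have pre: "z \<in> N \<Longrightarrow> regs (tick 1 s1) 14 = atime r z \<and> regs (tick 1 s1) 10 \<le> gap z
            \<and> gap z - regs (tick 1 s1) 10 + 1 \<le> stay r z \<and> atime r z \<le> card (free D) + Suc i"
          using stay_ge[OF zn pz] at bt a(3,4) by (simp add: 2)
        have r8': "regs (tick 1 s1) 8 = z" using r8 by simp
        have e1: "(if z \<in> N then insert z (free D) else free D) = free D'" using fr i0 by simp
        have e2: "(if z \<in> N then insert z (free D - ?B) else free D - ?B) = free D' - ?B"
          using fr i0 pz by auto
        show ?case
          by (rule wp_frame[OF wp_release[OF Ht r8' zn fr(2) pre, unfolded e1 e2]]) (use 2 a i5 in auto)
      next
        case 2
        then have "indeg D' z \<noteq> 0" using i5 r8 W1 by (auto split: if_splits)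
        then have fe: "free D' = free D" using fr by simp
        have "hinv (free D) (free D - ?B) (Suc i) (tick 1 (tick 1 s1))" using H1 by (rule hinv_cong) simp_all
        then show ?case
          by (intro wp_run) (use \<open>s1 = _\<close> a i5 in \<open>simp_all add: fe\<close>)
      qed
    next
      case (2 s2)
      have s3: "arrs s2 3 (Suc e) = last_arc ta w e"
        using 2 e(1,2) by (auto simp: hinv_def env_def static_def)
      have "hinv (free D') (free D' - ?B) (Suc i) s2" using 2 by blast
      then have "hinv (free D') (free D' - ?B) (Suc i) (run W (Assign 7 (Arr 3 (Reg 7))) s2)"
        by (rule hinv_cong) simp_all
      then show ?case by (intro wp_run) (use 2 s3 in simp_all)
    qed
  qed
qed

lemma wp_simulate:
  assumes s: "split_ok N P s" "sampled s = r" "regs s 10 = 0" "regs s 11 = 0" "regs s 13 = 0"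
    "regs s 14 = 0" "regs s 15 = 0" "arrs s 12 = (\<lambda>_. 0)" "arrs s 13 = (\<lambda>_. 0)"
  shows "wp W simulate (\<lambda>s'. regs s' 0 = val r \<and> comparisons s' \<le> 164 * val r
    \<and> time s' \<le> time s + 164 * val r + 26 * n + 8 * m + 4) s"
proof -
  define T where "T = time s + 6 * n + 2"
  have W1: "0 < W" "Suc 0 < W" "Suc n < W" using W_n by simp_all
  define I where "I s' \<longleftrightarrow> (\<exists>i\<le>n. ginv T i s')" for s' :: state
  have gn: "regs s' 0 = n" if "ginv T i s'" for i s'
    using that by (simp add: ginv_def hinv_def env_def static_def)
  have g15: "regs s' 15 = i" if "ginv T i s'" for i s' using that by (simp add: ginv_def)
  show ?thesis unfolding simulate_def
  proof (rule wp_Seq'[where P = I], goal_cases)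
    case 1
    have b0: "before 0 = {}" "removed_path 0 = 0" "partial_val 0 = 0"
      by (simp_all add: before_def removed_path_def partial_val_def)
    show ?case
    proof (rule wp_frame[OF wp_init_sources[OF s(1-4,6,8,9)]], goal_cases)
      case (2 s')
      have "regs s' 13 = 0" "regs s' 15 = 0" using 2(2) s by simp_all
      then have "ginv T 0 s'" using 2(1) by (simp add: ginv_def b0 T_def)
      then show ?case unfolding I_def by blast
    qed simp
  next
    case (2 s1)
    show ?case
    proof (rule wp_Seq'[where P = "\<lambda>s'. \<exists>s0. ginv T n s0 \<and> s' = tick 1 s0"], goal_cases)
      case 1
      show ?case
      proof (rule wp_Loop[where I = I and m = "\<lambda>s. n - regs s 15"], goal_cases)
        case 1
        show ?case using 2 .
      next
        case (3 s')
        then obtain i where i: "i \<le> n" "ginv T i s'" unfolding I_def by blast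
        then have "i = n" using 3(2) gn[OF i(2)] g15[OF i(2)] W1 by (auto split: if_splits)
        with i show ?case by blast
      next
        case (2 s')
        then obtain i where i: "i \<le> n" "ginv T i s'" unfolding I_def by blast
        have iln: "i < n" using 2(2) gn[OF i(2)] g15[OF i(2)] i(1) W1 by (auto split: if_splits)
        obtain w where w: "w < n" "pos r w = i" using pos_ex[OF r iln] by blast
        have G: "ginv (Suc T) i (tick 1 s')"
        proof -
          have "hinv (free (before i)) (free (before i) - {v. pos r v < i}) i (tick 1 s')"
            by (rule hinv_cong[of _ _ _ s']) (use i(2) in \<open>simp_all add: ginv_def\<close>)
          then show ?thesis using i(2) by (simp add: ginv_def)
        qed
        define J where "J D s1 \<longleftrightarrow> hinv (free D) (free D - {v. pos r v < Suc i}) (Suc i) s1 \<and> arrs s1 5 = indeg D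
          \<and> regs s1 15 = Suc i \<and> regs s1 10 = removed_path (Suc i) \<and> regs s1 13 = partial_val (Suc i)
          \<and> regs s1 14 = btime r w \<and> before i \<subseteq> D \<and> D \<subseteq> before (Suc i)
          \<and> comparisons s1 \<le> cost (free D) + 50 * partial_val (Suc i)
          \<and> time s1 \<le> T + 8 + cost (free D) + 50 * partial_val (Suc i) + 20 * i + 8 * card D" for D s1
        have fin: "finite (before j)" for j by (simp add: before_def)
        show ?case
        proof (rule wp_Seq'[OF wp_remove[OF G w]], goal_cases)
          case (1 s1)
          have "wp W (Loop (Reg 7) release_step)
            (\<lambda>s'. \<exists>s0. J (before i \<union> {e. e < m \<and> ta e = w}) s0 \<and> s' = tick 1 s0) s1"
          proof (rule wp_adjacency_loop)
            show "J (before i) s1" using 1 unfolding J_def by (auto simp: before_def)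
            show "regs s1 7 = last_arc ta w m" using 1 by blast
            show "e \<notin> before i" if "e < m" "ta e = w" for e using that w(2) by (simp add: before_def)
            fix D e s2
            assume a: "J D s2" "regs s2 7 = Suc e" "e < m" "ta e = w" "e \<notin> D"
            have J: "hinv (free D) (free D - {v. pos r v < Suc i}) (Suc i) s2" "arrs s2 5 = indeg D"
              "regs s2 15 = Suc i" "regs s2 10 = removed_path (Suc i)" "regs s2 13 = partial_val (Suc i)"
              "regs s2 14 = btime r w" "before i \<subseteq> D" "D \<subseteq> before (Suc i)"
              "comparisons s2 \<le> cost (free D) + 50 * partial_val (Suc i)"
              "time s2 \<le> T + 8 + cost (free D) + 50 * partial_val (Suc i) + 20 * i + 8 * card D"
              using a(1) unfolding J_def by blast+
            have Ht: "hinv (free D) (free D - {v. pos r v < Suc i}) (Suc i) (tick 1 s2)"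
              using J(1) by (rule hinv_cong) simp_all
            have fD: "finite D" using J(8) fin by (rule finite_subset)
            have eb: "e \<in> before (Suc i)" using a(3,4) w(2) by (simp add: before_def)
            show "wp W release_step (\<lambda>s'. J (insert e D) s' \<and> regs s' 7 = last_arc ta w e) (tick 1 s2)"
            proof (rule wp_conseq[OF wp_release_step[OF w a(3,4,5) J(7,8) Ht]], goal_cases)
              case (5 s3)
              have "card (insert e D) = Suc (card D)" using a(5) fD by simp
              then show ?case using 5 J eb unfolding J_def by auto
            qed (use J a(2) in simp_all)
          qed
          then show ?case
          proof (rule wp_conseq)
            fix s3 assume "\<exists>s0. J (before i \<union> {e. e < m \<and> ta e = w}) s0 \<and> s3 = tick 1 s0"
            then obtain s0 where s0: "J (before i \<union> {e. e < m \<and> ta e = w}) s0" "s3 = tick 1 s0" by blast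
            have "before i \<union> {e. e < m \<and> ta e = w} = before (Suc i)"
              using pos_less_Suc[OF w] ta_he_less(1) by (auto simp: before_def)
            with s0(1) have "J (before (Suc i)) s0" by simp
            then have J: "hinv (free (before (Suc i))) (free (before (Suc i)) - {v. pos r v < Suc i}) (Suc i) s0"
              "arrs s0 5 = indeg (before (Suc i))" "regs s0 15 = Suc i" "regs s0 10 = removed_path (Suc i)"
              "regs s0 13 = partial_val (Suc i)"
              "comparisons s0 \<le> cost (free (before (Suc i))) + 50 * partial_val (Suc i)"
              "time s0 \<le> T + 8 + cost (free (before (Suc i))) + 50 * partial_val (Suc i) + 20 * i + 8 * card (before (Suc i))"
              unfolding J_def by blast+
            have "hinv (free (before (Suc i))) (free (before (Suc i)) - {v. pos r v < Suc i}) (Suc i) s3"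
              using J(1) by (rule hinv_cong) (simp_all add: s0(2))
            then have "ginv T (Suc i) s3" using J unfolding ginv_def by (simp add: s0(2))
            then show "I s3 \<and> n - regs s3 15 < n - regs s' 15"
              using iln g15[OF i(2)] g15 unfolding I_def by (auto intro!: exI[of _ "Suc i"])
          qed
        qed
      qed
    next
      case (2 s2)
      then obtain s0 where s0: "ginv T n s0" "s2 = tick 1 s0" by blast
      have pn: "pos r v < n" if "v \<in> N" for v using pos_less[OF r] N_n that by auto
      have fN: "free (before n) = N"
        using pos_less[OF r] ta_he_less(1) by (auto simp: free_def indeg_0_iff before_def)
      have vY: "(\<Sum>v\<in>N. Y v) = val r" by (simp add: val_def Y_def)
      have Nn: "{v. v \<in> N \<and> pos r v < n} = N" using pn by blast
      have pv: "partial_val n = val r" unfolding partial_val_def Nn by (rule vY)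
      have "(\<Sum>v\<in>N. 1) \<le> val r" unfolding val_def by (rule sum_mono) simp
      then have "card N \<le> val r" by simp
      moreover have "halving_sum (Suc (card N)) < Suc (card N)" by (rule halving_sum_less) simp
      \<comment> \<open>114 is 42 + 72. The strict bound on \<open>halving_sum\<close> cancels the
        successor, so no additive constant remains; this matters for comparisons when
        \<open>val r\<close> is 0.\<close>
      ultimately have cN: "cost (free (before n)) \<le> 114 * val r" unfolding fN cost_def vY by linarith
      have cb: "card (before n) \<le> m" using card_mono[of "{..<m}" "before n"] by (auto simp: before_def)
      have "regs s0 13 = val r" "comparisons s0 \<le> cost (free (before n)) + 50 * val r"
        "time s0 \<le> T + cost (free (before n)) + 50 * val r + 20 * n + 8 * card (before n)"
        using s0(1) by (simp_all add: ginv_def pv)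
      then show ?case
        by (intro wp_run) (use cN cb s0(2) in \<open>simp_all add: T_def\<close>)
    qed
  qed
qed

end

context arc_list
begin

text \<open>Path vertices are already comparable in the graph. The right-hand side does not mention
  \<open>r\<close>, so all topological orders agree on them, as \<open>card_val_le\<close>
  requires.\<close>

lemma split_ok_chain:
  assumes S: "split_ok N P s" and r: "r \<in> TO" and u: "u < n" "u \<notin> N" and v: "v < n" "v \<notin> N"
  shows "(u, v) \<in> r \<longleftrightarrow> (\<exists>i j. i < j \<and> j < length P \<and> u = P ! i \<and> v = P ! j)"
proof -
  have P: "distinct P" "set P = {..<n} - N" "sorted_wrt (\<lambda>u v. (u, v) \<in> (set xs)\<^sup>+) P"
    using S by (simp_all add: split_ok_def)
  have srt: "(P ! i, P ! j) \<in> r" if "i < j" "j < length P" for i j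
    using P(3) r_trancl[OF r] that unfolding sorted_wrt_iff_nth_less by blast
  have "u \<in> set P" "v \<in> set P" using u v P(2) by simp_all
  then obtain i j where ij: "i < length P" "j < length P" "u = P ! i" "v = P ! j" by (auto simp: in_set_conv_nth)
  show ?thesis
  proof
    assume uv: "(u, v) \<in> r"
    have "i \<noteq> j" using uv ij r_irrefl[OF r] by auto
    moreover have "\<not> j < i" using srt[of j i] uv ij r_trans[OF r] r_irrefl[OF r] by blast
    ultimately have "i < j" by linarith
    then show "\<exists>i j. i < j \<and> j < length P \<and> u = P ! i \<and> v = P ! j" using ij by blast
  qed (use srt in blast)
qed

end

section \<open>The estimate\<close>

definition estimate :: com where
  "estimate = split_vertices ;; Sample ;; simulate"

text \<open>The product bounds the largest possible estimate. The exponent 4 is forced by the first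
  inequality at \<open>n = m = 0\<close>, which reads 16 \<le> 2 ^ 4.\<close>

lemma word_bound_ge:
  fixes n m :: nat
  defines "W \<equiv> (n + m + 2) ^ 4"
  shows "8 * n + 16 \<le> W" "m + 2 < W" "n * (2 * n + 3) < W"
proof -
  define b where "b = n + m + 2"
  have b: "2 \<le> b" "n \<le> b" by (simp_all add: b_def)
  have b2: "2 * b \<le> b * b" using b by (intro mult_le_mono1)
  have b3: "2 * (b * b) \<le> b * (b * b)" using b by (intro mult_le_mono1)
  have W: "W = b * (b * (b * b))" by (simp add: W_def b_def eval_nat_numeral)
  have b4: "2 * (b * (b * b)) \<le> W" unfolding W using b by (intro mult_le_mono1)
  show "8 * n + 16 \<le> W" "m + 2 < W" using b2 b3 b4 by (simp_all add: b_def)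
  have "2 * n + 3 \<le> b * b" using b2 by (simp add: b_def)
  then have "n * (2 * n + 3) \<le> b * (b * b)" using b(2) by (intro mult_le_mono)
  moreover have "0 < b * (b * b)" using b by simp
  ultimately show "n * (2 * n + 3) < W" using b4 by linarith
qed

lemma exec_sample:
  assumes c1: "exec W p t c1 s0 (return_pmf s1)"
    and c2: "\<And>r. r \<in> set_pmf p \<Longrightarrow> exec W p t c2 (tick t (s1\<lparr>sampled := r\<rparr>)) (return_pmf (F r))"
  shows "exec W p t (c1 ;; Sample ;; c2) s0 (map_pmf F p)"
proof -
  let ?g = "\<lambda>r. tick t (s1\<lparr>sampled := r\<rparr>)"
  \<comment> \<open>The state after \<open>Sample\<close> still records the order, so the
    continuation can be written as a function of that state.\<close>
  have "exec W p t (Sample ;; c2) s1 (bind_pmf (map_pmf ?g p) (\<lambda>s. return_pmf (F (sampled s))))"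
    by (rule exec.Seq[OF exec.Sample]) (auto simp: c2)
  moreover have "bind_pmf (map_pmf ?g p) (\<lambda>s. return_pmf (F (sampled s))) = map_pmf F p"
    by (simp add: map_pmf_def[symmetric] pmf.map_comp o_def)
  ultimately have "exec W p t (Sample ;; c2) s1 (map_pmf F p)" by simp
  then have "exec W p t (c1 ;; Sample ;; c2) s0 (bind_pmf (return_pmf s1) (\<lambda>_. map_pmf F p))"
    by (intro exec.Seq[OF c1]) simp
  then show ?thesis by (simp add: bind_return_pmf)
qed

lemma prob_le_card:
  fixes p :: "'x pmf"
  assumes "finite S" "\<And>x. x \<in> S \<Longrightarrow> pmf p x \<le> q" "0 \<le> q" "A \<inter> set_pmf p \<subseteq> S" "real (card S) \<le> k"
  shows "measure_pmf.prob p A \<le> k * q"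
proof -
  have "measure_pmf.prob p A = measure_pmf.prob p (A \<inter> set_pmf p)" by (rule measure_Int_set_pmf[symmetric])
  also have "\<dots> \<le> measure_pmf.prob p S" using assms(4) by (intro measure_pmf.finite_measure_mono) auto
  also have "\<dots> = (\<Sum>x\<in>S. pmf p x)" using assms(1) by (rule measure_measure_pmf_finite)
  also have "\<dots> \<le> (\<Sum>x\<in>S. q)" using assms(2) by (rule sum_mono)
  also have "\<dots> = real (card S) * q" by simp
  also have "\<dots> \<le> k * q" using assms(5,3) by (rule mult_right_mono)
  finally show ?thesis .
qed

theorem theoremA1:
  fixes c :: real
  assumes "1 \<le> c"
  shows "\<exists>(P :: com) (k :: nat) (K :: real). 1 \<le> K \<and>
    (\<forall>(G :: nat pair_pre_digraph) (as :: (nat \<times> nat) list) (p :: nat rel pmf) (t_sample :: nat) (T :: nat).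
       dag G \<and> arc_listing G as \<and> sampling_algorithm c G p t_sample \<and>
       T = card (topological_orders G) \<longrightarrow>
       (\<exists>D :: state pmf.
          exec (word_bound k G) p t_sample P (init_state G as) D \<and>
          (\<forall>s\<in>set_pmf D.
             real (time s) \<le> K * (real t_sample + log 2 (real T)) \<and>
             real (comparisons s) \<le> K * log 2 (real T)) \<and>
          measure_pmf.prob D
            {s. \<not> (log 2 (real T) / K \<le> real (returned s) \<and>
                   real (returned s) \<le> K * log 2 (real T))}
            \<le> K / real T powr 0.9))"
proof -
  \<comment> \<open>2200 exceeds 164 * 13, the product of the cost per unit of \<open>val r\<close>
    and the bound on \<open>val r\<close> per unit of \<open>log T\<close>; it also exceeds 20, as
    the error bound needs. The summand \<open>c\<close> is for the sampling probabilities.\<close>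
  define K where "K = 2200 + c"
  have K: "1 \<le> K" "2200 \<le> K" "c \<le> K" "0 < K" using assms by (simp_all add: K_def)
  show ?thesis
  proof (intro exI[of _ estimate] exI[of _ "4::nat"] exI[of _ K] conjI allI impI)
    show "1 \<le> K" by (fact K)
  next
    fix G :: "nat pair_pre_digraph" and as :: "(nat \<times> nat) list" and p :: "nat rel pmf" and t T :: nat
    assume *: "dag G \<and> arc_listing G as \<and> sampling_algorithm c G p t \<and> T = card (topological_orders G)"
    define n where "n = card (pverts G)"
    define W where "W = word_bound 4 G"
    have V: "pverts G = {..<n}" and dist: "distinct as" and E: "set as = parcs G"
      using * by (simp_all add: arc_listing_def n_def)
    have len: "length as = card (parcs G)" using dist E by (metis distinct_card)
    have W': "W = (n + length as + 2) ^ 4" by (simp add: W_def word_bound_def n_def len)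
    note Wb = word_bound_ge[where n = n and m = "length as", folded W']
    have Vsub: "set as \<subseteq> {..<n} \<times> {..<n}"
    proof -
      have "pair_wf_digraph G" using * by (simp add: dag_def pair_fin_digraph_def)
      then show ?thesis unfolding E V[symmetric]
        by (auto dest: pair_wf_digraph.arc_fst_in_verts pair_wf_digraph.arc_snd_in_verts)
    qed
    have acyc: "acyclic (set as)" using * E by (simp add: dag_def)
    interpret arc_list W n as
      using Wb(1,2) Vsub acyc by unfold_locales
    have TO: "TO = topological_orders G" unfolding TO_def unfolding topological_orders_def V E ..
    have T: "T = card TO" using * TO by simp
    have sa: "sampling_algorithm c G p t" using * by blast
    have close: "pointwise_close c p (pmf_of_set TO)"
      using sa unfolding sampling_algorithm_def TO[symmetric] by blast
    have t: "1 \<le> t" "n \<le> t" "length as \<le> t"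
      using sa by (simp_all add: sampling_algorithm_def n_def len)
    have W7: "wp W split_vertices (\<lambda>s'. (\<exists>N P. split_ok N P s') \<and> time s' \<le> 14 * n + 13 * m + 5) (init_state G as)"
      by (rule wp_split_vertices)
        (simp_all add: init_state_def n_def m_def ta_def he_def fun_eq_iff cong: if_cong)
    have "wp W split_vertices (\<lambda>s'. (\<exists>N P. split_ok N P s') \<and> time s' \<le> 14 * n + 13 * m + 5
      \<and> regs s' 10 = 0 \<and> regs s' 11 = 0 \<and> regs s' 13 = 0 \<and> regs s' 14 = 0 \<and> regs s' 15 = 0
      \<and> arrs s' 12 = (\<lambda>_. 0) \<and> arrs s' 13 = (\<lambda>_. 0)) (init_state G as)"
      by (rule wp_frame[OF W7]) (simp_all add: init_state_def)
    then obtain s1 N P where s1: "\<And>p t. exec W p t split_vertices (init_state G as) (return_pmf s1)"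
      "split_ok N P s1" "time s1 \<le> 14 * n + 13 * m + 5"
      "regs s1 10 = 0" "regs s1 11 = 0" "regs s1 13 = 0" "regs s1 14 = 0" "regs s1 15 = 0"
      "arrs s1 12 = (\<lambda>_. 0)" "arrs s1 13 = (\<lambda>_. 0)"
      unfolding wp_def by blast
    have S: "N \<subseteq> {..<n}" "distinct P" "set P = {..<n} - N" "sorted_wrt (\<lambda>u v. (u, v) \<in> (set as)\<^sup>+) P"
      "2 ^ card N \<le> card TO ^ 2" "TO \<noteq> {}"
      using s1(2) by (simp_all add: split_ok_def)
    have T1: "1 \<le> T" using S(6) finite_TO by (simp add: T Suc_le_eq card_gt_0_iff)
    define lT where "lT = log 2 (real T)"
    have lT: "0 \<le> lT" using T1 by (simp add: lT_def)
    interpret ds: dag_split n "set as" N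
      using S(1) by unfold_locales
    have ub: "pmf p x \<le> c * pmf (pmf_of_set TO) x" for x
      using close unfolding pointwise_close_def by blast
    have pmf_le: "pmf p x \<le> c / real T" if "x \<in> TO" for x
      using ub[of x] that S(6) finite_TO by (simp add: T)
    have supp: "set_pmf p \<subseteq> TO"
    proof
      fix x assume x: "x \<in> set_pmf p"
      show "x \<in> TO"
      proof (rule ccontr)
        assume "x \<notin> TO"
        then have "pmf (pmf_of_set TO) x = 0" using S(6) finite_TO by simp
        then have "pmf p x \<le> 0" using ub[of x] by simp
        moreover have "0 < pmf p x" using x by (simp add: pmf_positive)
        ultimately show False by simp
      qed
    qed
    have "\<exists>s'. (\<forall>p t. exec W p t simulate (tick t0 (s1\<lparr>sampled := r\<rparr>)) (return_pmf s'))
        \<and> regs s' 0 = ds.val r \<and> comparisons s' \<le> 164 * ds.val r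
        \<and> time s' \<le> t0 + time s1 + 164 * ds.val r + 26 * n + 8 * m + 4" if r: "r \<in> TO" for r t0
    proof -
      interpret sim: simulation W n as N P r
        using S(1-4) r Wb(3) by unfold_locales
      have "split_ok N P (tick t0 (s1\<lparr>sampled := r\<rparr>))"
        using s1(2) by (simp add: split_ok_def static_def)
      from sim.wp_simulate[OF this] s1(4-) show ?thesis
        unfolding wp_def by (auto simp: add.commute[of t0])
    qed
    then have "\<forall>r. \<exists>s'. r \<in> TO \<longrightarrow> ((\<forall>p' t'. exec W p' t' simulate (tick t (s1\<lparr>sampled := r\<rparr>)) (return_pmf s'))
        \<and> regs s' 0 = ds.val r \<and> comparisons s' \<le> 164 * ds.val r
        \<and> time s' \<le> t + time s1 + 164 * ds.val r + 26 * n + 8 * m + 4)" by blast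
    then obtain F where F: "\<And>r. r \<in> TO \<Longrightarrow> (\<forall>p' t'. exec W p' t' simulate (tick t (s1\<lparr>sampled := r\<rparr>)) (return_pmf (F r)))
        \<and> regs (F r) 0 = ds.val r \<and> comparisons (F r) \<le> 164 * ds.val r
        \<and> time (F r) \<le> t + time s1 + 164 * ds.val r + 26 * n + 8 * m + 4" by metis
    have ex: "exec W p t estimate (init_state G as) (map_pmf F p)"
      unfolding estimate_def by (rule exec_sample[OF s1(1)]) (use F supp in blast)
    have val_le: "real (ds.val r) \<le> 13 * lT" if "r \<in> TO" for r
    proof -
      have "2 ^ ds.val r \<le> T ^ 13" using ds.two_power_val_le[OF that S(5)] by (simp only: T)
      then have "real (2 ^ ds.val r) \<le> real (T ^ 13)" by (rule of_nat_mono)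
      then have "(2::real) ^ ds.val r \<le> real T ^ 13" by simp
      then have "log 2 (2 ^ ds.val r) \<le> log 2 (real T ^ 13)" using T1 by (subst log_le_cancel_iff) auto
      then show ?thesis using T1 by (simp add: log_nat_power lT_def)
    qed
    have upper: "13 * lT \<le> K * lT" using K(2) lT by (intro mult_right_mono) auto
    have cost: "real (time (F r)) \<le> K * (real t + lT) \<and> real (comparisons (F r)) \<le> K * lT" if r: "r \<in> TO" for r
    proof
      have ml: "m = length as" by (simp add: m_def)
      have "time (F r) \<le> t + (14 * n + 13 * m + 5) + 164 * ds.val r + 26 * n + 8 * m + 4"
        using F[OF r] s1(3) by linarith
      \<comment> \<open>The running time of the sampler includes reading the arcs and writing the
        vertices, so it absorbs all terms in \<open>n\<close> and \<open>m\<close>.\<close>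
      then have "time (F r) \<le> 100 * t + 164 * ds.val r" using t unfolding ml by linarith
      then have "real (time (F r)) \<le> 100 * real t + 164 * real (ds.val r)" by linarith
      then have "real (time (F r)) \<le> 2200 * real t + 2200 * lT" using val_le[OF r] lT by linarith
      also have "\<dots> \<le> K * real t + K * lT" using K(2) lT by (intro add_mono mult_right_mono) auto
      finally show "real (time (F r)) \<le> K * (real t + lT)" by (simp add: algebra_simps)
      have "real (comparisons (F r)) \<le> 164 * real (ds.val r)" using F[OF r] by linarith
      then have "real (comparisons (F r)) \<le> 2200 * lT" using val_le[OF r] lT by linarith
      also have "\<dots> \<le> K * lT" using K(2) lT by (intro mult_right_mono) auto
      finally show "real (comparisons (F r)) \<le> K * lT" .
    qed
    have error: "measure_pmf.prob p {r. \<not> (lT / K \<le> real (returned (F r)) \<and> real (returned (F r)) \<le> K * lT)}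
      \<le> K / real T powr 0.9"
    proof -
      \<comment> \<open>Values below \<open>lT / K\<close> are at most \<open>x\<close>. Since
        \<open>K\<close> is at least 20, \<open>4 ^ x\<close> is at most \<open>T\<close> to the
        power 0.1.\<close>
      define x where "x = nat \<lfloor>lT / K\<rfloor>"
      define B where "B = {r\<in>TO. ds.val r \<le> x}"
      have cardB: "card B \<le> 4 ^ x" unfolding B_def
        by (rule ds.card_val_le) (use split_ok_chain[OF s1(2)] in blast)
      have "real x \<le> lT / K" using lT K by (simp add: x_def)
      also have "\<dots> \<le> lT / 20" using lT K by (intro divide_left_mono) auto
      finally have x: "2 * real x \<le> 0.1 * lT" by simp
      have "real (card B) \<le> real (4 ^ x)" using cardB by (rule of_nat_mono)
      then have "real (card B) \<le> 4 ^ x" by simp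
      moreover have "(4::real) ^ x = 2 powr (2 * real x)"
      proof -
        have "(2::real) powr real (2 * x) = 2 ^ (2 * x)" by (rule powr_realpow) simp
        then show ?thesis by (simp add: power_mult)
      qed
      moreover have "2 powr (2 * real x) \<le> 2 powr (0.1 * lT)" using x by (intro powr_mono) auto
      moreover have "2 powr (0.1 * lT) = real T powr 0.1"
      proof -
        have "2 powr (0.1 * lT) = (2 powr lT) powr 0.1" by (simp add: powr_powr mult.commute)
        also have "2 powr lT = real T" using T1 by (simp add: lT_def)
        finally show ?thesis .
      qed
      ultimately have cB: "real (card B) \<le> real T powr 0.1" by linarith
      \<comment> \<open>The upper bound never fails on the support of \<open>p\<close>, so every
        error is an order whose estimate is too small.\<close>
      have sub: "{r. \<not> (lT / K \<le> real (returned (F r)) \<and> real (returned (F r)) \<le> K * lT)} \<inter> set_pmf p \<subseteq> B"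
      proof
        fix r assume r: "r \<in> {r. \<not> (lT / K \<le> real (returned (F r)) \<and> real (returned (F r)) \<le> K * lT)} \<inter> set_pmf p"
        then have rT: "r \<in> TO" using supp by blast
        then have v: "returned (F r) = ds.val r" using F by (simp add: returned_def)
        have "real (ds.val r) \<le> K * lT" using val_le[OF rT] upper by linarith
        with r v have "real (ds.val r) < lT / K" by auto
        then have "ds.val r \<le> x" unfolding x_def by linarith
        with rT show "r \<in> B" by (simp add: B_def)
      qed
      have "measure_pmf.prob p {r. \<not> (lT / K \<le> real (returned (F r)) \<and> real (returned (F r)) \<le> K * lT)}
        \<le> real T powr 0.1 * (c / real T)"
      proof (rule prob_le_card[OF _ _ _ sub cB])
        show "finite B" using finite_TO by (simp add: B_def)
        show "pmf p r \<le> c / real T" if "r \<in> B" for r using that pmf_le by (simp add: B_def)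
        show "0 \<le> c / real T" using assms by simp
      qed
      also have "\<dots> = c / real T powr 0.9"
      proof -
        have "real T = real T powr 0.1 * real T powr 0.9" using T1 by (simp add: powr_add[symmetric])
        moreover have "0 < real T powr 0.1" "0 < real T powr 0.9" using T1 by simp_all
        ultimately show ?thesis by (simp add: field_simps)
      qed
      also have "\<dots> \<le> K / real T powr 0.9" using K(3) by (intro divide_right_mono) auto
      finally show ?thesis .
    qed
    show "\<exists>D. exec (word_bound 4 G) p t estimate (init_state G as) D \<and>
          (\<forall>s\<in>set_pmf D. real (time s) \<le> K * (real t + log 2 (real T)) \<and> real (comparisons s) \<le> K * log 2 (real T)) \<and>
          measure_pmf.prob D {s. \<not> (log 2 (real T) / K \<le> real (returned s) \<and> real (returned s) \<le> K * log 2 (real T))}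
            \<le> K / real T powr 0.9"
    proof (intro exI[of _ "map_pmf F p"] conjI)
      show "exec (word_bound 4 G) p t estimate (init_state G as) (map_pmf F p)" using ex by (simp only: W_def)
      show "\<forall>s\<in>set_pmf (map_pmf F p). real (time s) \<le> K * (real t + log 2 (real T)) \<and> real (comparisons s) \<le> K * log 2 (real T)"
        using cost supp unfolding lT_def by auto
      show "measure_pmf.prob (map_pmf F p) {s. \<not> (log 2 (real T) / K \<le> real (returned s) \<and> real (returned s) \<le> K * log 2 (real T))}
        \<le> K / real T powr 0.9"
        using error by (simp add: lT_def vimage_def)
    qed
  qed
qed

end
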